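(* Let $\mathfrak g$ be an $\mathbb N$-graded filiform real Lie algebra with $\dim\mathfrak g\ge 3$, and let $\mathfrak h$ be a proper subalgebra of $\mathfrak g$ that is totally geodesic with respect to some inner product on $\mathfrak g$. Then one of the following holds: (a) $\mathfrak g$ has a presentation with basis $\{X_1,\dots,X_n\}$ and relations $[X_1,X_i]=X_{i+1}$ for all $1<i<n$. In this case $\dim(\mathfrak h)\le\dim(\mathfrak g)-2$. (b) $\mathfrak g$ has, for some $k\ge 3$, a presentation with basis $\{X_1,\dots,X_{2k+1}\}$ and relations $[X_1,X_i]=X_{i+1}$ for all $1<i<2k+1$ and $[X_l,X_{2k+1-l}]=(-1)^{l+1}X_{2k+1}$ for all $1<l<k+1$. In this case $\dim(\mathfrak h)\le\dim(\mathfrak g)-4$. (c) $\mathfrak g$ is not isomorphic to any of the algebras in (a) and (b), in which case $\dim(\mathfrak h)\le\lfloor\dim(\mathfrak g)/2\rfloor$. Moreover, each of these bounds is attained: for every $\mathbb N$-graded filiform Lie algebra $\mathfrak g$ of dimension at least $3$ there exist an inner product on $\mathfrak g$ and a proper totally geodesic subalgebra $\mathfrak h$ of $\mathfrak g$ for which equality holds in the bound corresponding to the case (a), (b) or (c) to which $\mathfrak g$ belongs.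
   Context: All Lie algebras are finite-dimensional and real. In presentations, brackets of basis elements that are not determined by the listed ones through skew-symmetry are zero. An $n$-dimensional nilpotent Lie algebra $\mathfrak g$ is called $\mathbb N$-graded filiform if it can be decomposed as a direct sum of one-dimensional subspaces $\mathfrak g=\bigoplus_{i=1}^n V_i$ with $[V_1,V_i]=V_{i+1}$ for all $i>1$ and $[V_i,V_j]\subset V_{i+j}$ for all $i,j\in\mathbb N$, where $V_i=0$ for $i>n$. If $\mathfrak g$ is equipped with an inner product $\langle\cdot,\cdot\rangle$ and $\mathfrak h$ is a Lie subalgebra with orthogonal complement $\mathfrak h^\perp$, then $\mathfrak h$ is called totally geodesic if $\langle[X,Y],Z\rangle+\langle[X,Z],Y\rangle=0$ for all $X\in\mathfrak h^\perp$ and $Y,Z\in\mathfrak h$. *)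

theory Defs
  imports "HOL-Analysis.Analysis"
begin

text \<open>
  A Lie algebra is a bracket on a whole type of class \<open>real_vector\<close>; its underlying
  vector space is \<open>UNIV\<close>. The class \<open>real_vector\<close>, unlike \<open>euclidean_space\<close>, carries no
  distinguished inner product: inner products are bilinear forms chosen separately.
\<close>

locale fin_dim_lie_algebra =
  fixes br :: "'a::real_vector \<Rightarrow> 'a \<Rightarrow> 'a"
  assumes finite_dim: "\<exists>B::'a set. finite B \<and> span B = UNIV"
    and bilinear_br: "bilinear br"
    and br_self: "br x x = 0"
    and jacobi: "br x (br y z) + br y (br z x) + br z (br x y) = 0"

definition bracket_span :: "('a::real_vector \<Rightarrow> 'a \<Rightarrow> 'a) \<Rightarrow> 'a set \<Rightarrow> 'a set \<Rightarrow> 'a set" where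
  "bracket_span br A B = span {br x y | x y. x \<in> A \<and> y \<in> B}"

primrec lower_central_series ::
    "('a::real_vector \<Rightarrow> 'a \<Rightarrow> 'a) \<Rightarrow> nat \<Rightarrow> 'a set" where
  "lower_central_series br 0 = UNIV"
| "lower_central_series br (Suc k) = bracket_span br UNIV (lower_central_series br k)"

definition nilpotent_lie :: "('a::real_vector \<Rightarrow> 'a \<Rightarrow> 'a) \<Rightarrow> bool" where
  "nilpotent_lie br \<longleftrightarrow> (\<exists>k. lower_central_series br k = {0})"

definition is_direct_sum :: "nat \<Rightarrow> (nat \<Rightarrow> 'a::real_vector set) \<Rightarrow> bool" where
  "is_direct_sum n V \<longleftrightarrow>
     (\<forall>x. \<exists>!v. v \<in> (\<Pi>\<^sub>E i\<in>{1..n}. V i) \<and> x = (\<Sum>i = 1..n. v i))"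

text \<open>Indices of the grading start at \<open>1\<close>; the value \<open>V 0\<close> plays no role.\<close>

definition N_graded_filiform :: "('a::real_vector \<Rightarrow> 'a \<Rightarrow> 'a) \<Rightarrow> bool" where
  "N_graded_filiform br \<longleftrightarrow> nilpotent_lie br \<and>
     (let n = dim (UNIV :: 'a set) in
      \<exists>V :: nat \<Rightarrow> 'a set.
        (\<forall>i\<in>{1..n}. subspace (V i) \<and> dim (V i) = 1) \<and>
        (\<forall>i>n. V i = {0}) \<and>
        is_direct_sum n V \<and>
        (\<forall>i>1. bracket_span br (V 1) (V i) = V (i + 1)) \<and>
        (\<forall>i\<ge>1. \<forall>j\<ge>1. bracket_span br (V i) (V j) \<subseteq> V (i + j)))"

definition lie_subalgebra :: "('a::real_vector \<Rightarrow> 'a \<Rightarrow> 'a) \<Rightarrow> 'a set \<Rightarrow> bool" where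
  "lie_subalgebra br h \<longleftrightarrow> subspace h \<and> (\<forall>x\<in>h. \<forall>y\<in>h. br x y \<in> h)"

definition is_inner_product :: "('a::real_vector \<Rightarrow> 'a \<Rightarrow> real) \<Rightarrow> bool" where
  "is_inner_product ip \<longleftrightarrow>
     bilinear ip \<and> (\<forall>x y. ip x y = ip y x) \<and> (\<forall>x. x \<noteq> 0 \<longrightarrow> ip x x > 0)"

definition ortho_compl :: "('a::real_vector \<Rightarrow> 'a \<Rightarrow> real) \<Rightarrow> 'a set \<Rightarrow> 'a set" where
  "ortho_compl ip h = {x. \<forall>y\<in>h. ip x y = 0}"

definition totally_geodesic ::
    "('a::real_vector \<Rightarrow> 'a \<Rightarrow> 'a) \<Rightarrow> ('a \<Rightarrow> 'a \<Rightarrow> real) \<Rightarrow> 'a set \<Rightarrow> bool" where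
  "totally_geodesic br ip h \<longleftrightarrow>
     (\<forall>x\<in>ortho_compl ip h. \<forall>y\<in>h. \<forall>z\<in>h. ip (br x y) z + ip (br x z) y = 0)"

definition is_basis_upto :: "nat \<Rightarrow> (nat \<Rightarrow> 'a::real_vector) \<Rightarrow> bool" where
  "is_basis_upto n X \<longleftrightarrow>
     inj_on X {1..n} \<and> independent (X ` {1..n}) \<and> span (X ` {1..n}) = UNIV"

text \<open>
  A triple \<open>(i, j, v)\<close> in \<open>R\<close> stands for the listed relation \<open>[X\<^sub>i, X\<^sub>j] = v\<close>. Brackets of basis
  elements that no listed relation determines, even up to skew-symmetry, are zero.
\<close>

definition lie_presentation ::
    "('a::real_vector \<Rightarrow> 'a \<Rightarrow> 'a) \<Rightarrow> nat \<Rightarrow> (nat \<Rightarrow> 'a) \<Rightarrow> (nat \<times> nat \<times> 'a) set \<Rightarrow> bool" where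
  "lie_presentation br n X R \<longleftrightarrow> is_basis_upto n X \<and>
     (\<forall>(i, j, v)\<in>R. br (X i) (X j) = v) \<and>
     (\<forall>i\<in>{1..n}. \<forall>j\<in>{1..n}.
        (\<forall>v. (i, j, v) \<notin> R \<and> (j, i, v) \<notin> R) \<longrightarrow> br (X i) (X j) = 0)"

definition type_a :: "('a::real_vector \<Rightarrow> 'a \<Rightarrow> 'a) \<Rightarrow> bool" where
  "type_a br \<longleftrightarrow> (\<exists>n X. lie_presentation br n X
     {(1, i, X (i + 1)) | i. 1 < i \<and> i < n})"

definition type_b :: "('a::real_vector \<Rightarrow> 'a \<Rightarrow> 'a) \<Rightarrow> bool" where
  "type_b br \<longleftrightarrow> (\<exists>k\<ge>3. \<exists>X. lie_presentation br (2 * k + 1) X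
     ({(1, i, X (i + 1)) | i. 1 < i \<and> i < 2 * k + 1} \<union>
      {(l, 2 * k + 1 - l, (-1) ^ (l + 1) *\<^sub>R X (2 * k + 1)) | l. 1 < l \<and> l < k + 1}))"

text \<open>
  A Lie algebra is isomorphic to the one given by a presentation iff it has a basis
  satisfying that presentation, so this says that the algebra is isomorphic to none of
  the algebras of the two families above.
\<close>

definition type_c :: "('a::real_vector \<Rightarrow> 'a \<Rightarrow> 'a) \<Rightarrow> bool" where
  "type_c br \<longleftrightarrow> \<not> type_a br \<and> \<not> type_b br"

end

theory Submission
  imports Defs
begin

text \<open>
  Let \<open>X i\<close> span the degree \<open>i\<close> part and let \<open>F j\<close> be the ideal spanned by the \<open>X i\<close> with \<open>i \<ge> j\<close>.
  The dimension of a subspace is its number of leading degrees. If \<open>h\<close> is not contained in \<open>F 2\<close>,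
  the skew-symmetry of \<open>ad y\<close> for \<open>y\<close> orthogonal to \<open>h\<close> forces \<open>h\<close> to be a line. Otherwise one argues by induction
  along the quotients by the ideals \<open>F (t + 1)\<close>. When the image of \<open>F t\<close> splits into a
  tangential and a normal part, \<open>h\<close> descends to the quotient by \<open>F t\<close>, and of two degrees \<open>i\<close>, \<open>t - i\<close>
  with nonzero structure constant at most one is a leading degree of \<open>h\<close> whenever \<open>t\<close> is none.
  When it does not split, the tangential part of \<open>X t\<close> is centralised by \<open>h\<close> modulo \<open>F (t + 1)\<close>, which
  gives similar constraints. The induction starts at the least degree \<open>k\<close> with a nonzero bracket
  of two basis vectors of degree at least 2; there is none in case (a), and \<open>k = n \<ge> 7\<close> in case (b). By the Jacobi
  identity, \<open>n \<le> k + 4\<close> if \<open>7 \<le> k < n\<close>, while for \<open>k = 5\<close> everything depends on a single parameter, which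
  takes only the values \<open>0\<close> and \<open>1/10\<close> (the Witt algebra) if \<open>n \<ge> 12\<close>.

  The bounds are attained by the span of the even degrees in case (c), and in cases (a) and (b) by subspaces of
  \<open>F 2\<close>, viewed as truncated power series on which \<open>ad X\<^sub>1\<close> is multiplication by the variable,
  that are spanned by polynomials times a fixed series: \<open>1\<close> in case (a), an inverse square root in case (b),
  where \<open>X n\<close> is added.
\<close>

section \<open>Graded filiform algebras and leading degrees\<close>

text \<open>Neither the inner product nor \<open>h\<close> respects the grading, so only the
  filtration by the \<open>F j\<close> is available, and a degree may be a leading degree of both
  \<open>h\<close> and its complement, or of neither. The second case, at the top degree
  \<open>t\<close>, is the obstacle. If the tangential part of \<open>X t\<close> has leading degree
  \<open>a\<close>, skew-symmetry gives \<open>c (t - a) a = 0\<close>. If the row of degree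
  \<open>t\<close>, formed by the \<open>c i j\<close> with \<open>i + j = t\<close>, has no zero
  off its middle, only \<open>a = t/2\<close> is left and counting still works. Trouble is confined
  to the few zeros of the rows: the pair 2, \<open>k\<close> in row \<open>k + 2\<close> for
  \<open>k \<ge> 7\<close>, and for \<open>k = 5\<close> the values 0, 2/5, 1/2, 1 of the parameter
  and the zeros of row 11. Each needs its own argument, the first one a pencil of two skew forms.
  The inverse square root in case (b) has this origin: the bracket of two series f, g is a
  coefficient of f(-x) g(x), and a factor v with v^2 E = 1 makes the first normal polynomial E
  commute with the tangential ones.\<close>

lemma bilinear_alternating_skew:
  assumes f: "bilinear f" and z: "\<And>x. f x x = 0" shows "f x y = - f y x"
proof -
  have "f x y + f y x = 0"
  proof -
    have "f (x + y) (x + y) = (f x x + f x y) + (f y x + f y y)"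
      by (simp only: bilinear_ladd[OF f] bilinear_radd[OF f]) simp
    then show ?thesis by (simp add: z)
  qed
  then show ?thesis by (rule eq_neg_iff_add_eq_0[THEN iffD2])
qed

text \<open>\<open>X i\<close> is 0 outside \<open>{1..n}\<close>, so \<open>br_X\<close> needs no
  bound on \<open>i + j\<close>. The values \<open>c i j\<close> with \<open>i + j > n\<close> are
  arbitrary; facts about \<open>c\<close> therefore carry \<open>i + j \<le> n\<close>.\<close>

locale graded_filiform =
  fixes br :: "'a::real_vector \<Rightarrow> 'a \<Rightarrow> 'a" and n :: nat and X :: "nat \<Rightarrow> 'a"
    and co :: "nat \<Rightarrow> 'a \<Rightarrow> real" and c :: "nat \<Rightarrow> nat \<Rightarrow> real"
  assumes bil: "bilinear br"
    and br_self: "br x x = 0"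
    and jac: "br x (br y z) + br y (br z x) + br z (br x y) = 0"
    and n3: "3 \<le> n"
    and lin_co: "linear (co i)"
    and expand: "v = (\<Sum>i = 1..n. co i v *\<^sub>R X i)"
    and co_X0: "i \<in> {1..n} \<Longrightarrow> j \<in> {1..n} \<Longrightarrow> co i (X j) = (if i = j then 1 else 0)"
    and co_out: "i \<notin> {1..n} \<Longrightarrow> co i v = 0"
    and X_out: "i \<notin> {1..n} \<Longrightarrow> X i = 0"
    and br_X: "1 \<le> i \<Longrightarrow> 1 \<le> j \<Longrightarrow> br (X i) (X j) = c i j *\<^sub>R X (i + j)"
    and c1: "2 \<le> i \<Longrightarrow> i < n \<Longrightarrow> c 1 i = 1"
begin

lemmas br_simps = bilinear_ladd[OF bil] bilinear_radd[OF bil] bilinear_lmul[OF bil]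
  bilinear_rmul[OF bil] bilinear_lsub[OF bil] bilinear_rsub[OF bil] bilinear_lzero[OF bil]
  bilinear_rzero[OF bil] bilinear_lneg[OF bil] bilinear_rneg[OF bil]

lemmas co_simps = linear_add[OF lin_co] linear_scale[OF lin_co] linear_diff[OF lin_co]
  linear_0[OF lin_co] linear_neg[OF lin_co]

lemma co_X: "co i (X j) = (if i = j \<and> i \<in> {1..n} then 1 else 0)"
proof (cases "i \<in> {1..n} \<and> j \<in> {1..n}")
  case True then show ?thesis using co_X0 by simp
next
  case False
  show ?thesis
  proof (cases "i \<in> {1..n}")
    case True
    then have "X j = 0" using False X_out by blast
    moreover have "i \<noteq> j" using True False by blast
    ultimately show ?thesis by (simp add: linear_0[OF lin_co])
  next
    case False
    then show ?thesis using co_out[OF False] by simp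
  qed
qed

lemma br_skew: "br x y = - br y x"
  by (rule bilinear_alternating_skew[OF bil br_self])

lemma co_0: "co 0 v = 0"
  by (rule co_out) simp

lemma vec_eqI: "(\<And>i. i \<in> {1..n} \<Longrightarrow> co i v = co i w) \<Longrightarrow> v = w"
proof -
  assume "\<And>i. i \<in> {1..n} \<Longrightarrow> co i v = co i w"
  then have "(\<Sum>i=1..n. co i v *\<^sub>R X i) = (\<Sum>i=1..n. co i w *\<^sub>R X i)"
    by (intro sum.cong) auto
  then show ?thesis by (rule trans[OF expand trans[OF _ expand[symmetric]]])
qed

lemma c_skew:
  assumes "1 \<le> i" "1 \<le> j" "i + j \<le> n" shows "c j i = - c i j"
proof -
  have "co (i + j) (br (X i) (X j)) = - co (i + j) (br (X j) (X i))"
    by (subst br_skew) (simp add: co_simps)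
  then show ?thesis using assms by (simp add: br_X co_simps co_X add.commute)
qed

lemma c_diag: "1 \<le> i \<Longrightarrow> i + i \<le> n \<Longrightarrow> c i i = 0"
  using c_skew[of i i] by simp

lemma c_jac:
  assumes "1 \<le> i" "1 \<le> j" "1 \<le> l" "i + j + l \<le> n"
  shows "c j l * c i (j + l) + c l i * c j (l + i) + c i j * c l (i + j) = 0"
proof -
  have "br (X i) (br (X j) (X l)) + br (X j) (br (X l) (X i)) + br (X l) (br (X i) (X j)) = 0"
    by (rule jac)
  then have "co (i + j + l) (br (X i) (br (X j) (X l)) + br (X j) (br (X l) (X i))
      + br (X l) (br (X i) (X j))) = 0"
    by (simp add: co_simps)
  then show ?thesis using assms by (simp add: br_X br_simps co_simps co_X add_ac)
qed

text \<open>\<open>ad X_1\<close> is a derivation acting as a shift. Hence the row of degree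
  \<open>t + 1\<close> is determined by the row of degree \<open>t\<close> and a single entry; for
  even \<open>t + 1\<close> the vanishing middle entry serves, so new parameters arise in odd
  degrees only.\<close>

lemma c_rec:
  assumes "2 \<le> i" "2 \<le> j" "i + j + 1 \<le> n"
  shows "c i j = c (i + 1) j + c i (j + 1)"
proof -
  have "c i j * c 1 (i + j) + c j 1 * c i (j + 1) + c 1 i * c j (1 + i) = 0"
    using c_jac[of 1 i j] assms by simp
  moreover have "c 1 (i + j) = 1" "c 1 i = 1" "c 1 j = 1" using assms by (intro c1; simp)+
  moreover have "c j 1 = - c 1 j" using c_skew[of 1 j] assms by simp
  moreover have "c j (1 + i) = - c (1 + i) j" using c_skew[of "1 + i" j] assms by simp
  ultimately show ?thesis by (simp add: add.commute[of 1])
qed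

definition F :: "nat \<Rightarrow> 'a set" where "F j = {v. \<forall>i<j. co i v = 0}"

definition lead :: "nat \<Rightarrow> 'a \<Rightarrow> bool" where "lead i v \<longleftrightarrow> v \<in> F i \<and> co i v \<noteq> 0"

definition D :: "'a set \<Rightarrow> nat set" where "D U = {i. \<exists>v\<in>U. lead i v}"

lemma subspace_F: "subspace (F j)"
  by (auto simp: subspace_def F_def co_simps)

lemmas F_closed = subspace_0[OF subspace_F] subspace_add[OF subspace_F]
  subspace_scale[OF subspace_F] subspace_diff[OF subspace_F] subspace_neg[OF subspace_F]

lemma F_mono: "i \<le> j \<Longrightarrow> v \<in> F j \<Longrightarrow> v \<in> F i"
  by (auto simp: F_def)

lemma F_1: "v \<in> F (Suc 0)"
  by (auto simp: F_def co_0)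

lemma F_zero: "v \<in> F j \<Longrightarrow> n < j \<Longrightarrow> v = 0"
  by (rule vec_eqI) (auto simp: F_def co_simps)

lemma F_Suc: "v \<in> F (Suc j) \<longleftrightarrow> v \<in> F j \<and> co j v = 0"
  by (auto simp: F_def less_Suc_eq)

lemma X_F: "j \<le> i \<Longrightarrow> X i \<in> F j"
  by (auto simp: F_def co_X)

lemma lead_X: "1 \<le> i \<Longrightarrow> i \<le> n \<Longrightarrow> lead i (X i)"
  by (auto simp: lead_def X_F co_X)

lemma leadD: "lead i v \<Longrightarrow> v \<in> F i" "lead i v \<Longrightarrow> co i v \<noteq> 0"
  by (auto simp: lead_def)

lemma lead_range: "lead i v \<Longrightarrow> i \<in> {1..n}"
  using co_out lead_def by metis

lemma lead_nz: "lead i v \<Longrightarrow> v \<noteq> 0"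
  by (auto simp: lead_def co_simps)

lemma lead_F: assumes "lead i v" "v \<in> F j" shows "j \<le> i"
proof (rule ccontr)
  assume "\<not> j \<le> i"
  then have "co i v = 0" using assms(2) by (simp add: F_def)
  then show False using assms(1) by (simp add: lead_def)
qed

lemma lead_unique: "lead i v \<Longrightarrow> lead j v \<Longrightarrow> i = j"
  using lead_F[of i v j] lead_F[of j v i] by (simp add: lead_def)

lemma ex_lead: assumes "v \<noteq> 0" "v \<in> F j" obtains i where "lead i v" "j \<le> i" "i \<le> n"
proof -
  have "\<exists>i. co i v \<noteq> 0"
  proof (rule ccontr)
    assume "\<nexists>i. co i v \<noteq> 0"
    then have "v = 0" by (intro vec_eqI) (simp add: linear_0[OF lin_co])
    then show False using assms(1) by simp
  qed
  then obtain i where i: "co i v \<noteq> 0" "\<forall>k<i. co k v = 0"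
    using exists_least_iff[of "\<lambda>i. co i v \<noteq> 0"] by auto
  then have "lead i v" by (auto simp: lead_def F_def)
  then show thesis using that[of i] lead_F[OF _ assms(2), of i] lead_range[of i v] by simp
qed

lemma ex_lead_not_F: assumes "v \<notin> F j" obtains i where "lead i v" "i < j"
proof -
  have "v \<noteq> 0" using assms F_closed(1) by auto
  then obtain i where i: "lead i v" using ex_lead[OF _ F_1] by blast
  have "i < j"
  proof (rule ccontr)
    assume "\<not> i < j"
    then show False using i assms F_mono[of j i v] by (simp add: lead_def)
  qed
  then show thesis using that i by blast
qed

lemma reduce: assumes "lead i x" "v \<in> F i" obtains \<alpha> where "v - \<alpha> *\<^sub>R x \<in> F (Suc i)"
proof -
  have "v - (co i v / co i x) *\<^sub>R x \<in> F (Suc i)"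
    using assms by (auto simp: F_Suc lead_def F_closed co_simps)
  then show thesis using that by blast
qed

lemma lead_diff: assumes "lead i v" "v - w \<in> F (Suc i)" shows "lead i w"
proof -
  have "v - w \<in> F i" "co i (v - w) = 0" using assms by (auto simp: F_Suc)
  then have "w \<in> F i" "co i w = co i v" using assms(1) F_closed(4)[of v i "v - w"]
    by (auto simp: lead_def linear_diff[OF lin_co])
  then show ?thesis using assms by (simp add: lead_def)
qed

lemma span_X: "span (X ` {1..n}) = UNIV"
proof -
  have "v \<in> span (X ` {1..n})" for v
  proof -
    have "(\<Sum>i = 1..n. co i v *\<^sub>R X i) \<in> span (X ` {1..n})"
      by (intro span_sum span_scale span_base) auto
    then show ?thesis by (simp only: expand[symmetric])
  qed
  then show ?thesis by blast
qed

lemma D_range: "D U \<subseteq> {1..n}"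
  using lead_range by (auto simp: D_def)

lemma finite_D: "finite (D U)"
  using D_range finite_subset by blast

lemma D_mono: "U \<subseteq> W \<Longrightarrow> D U \<subseteq> D W"
  by (auto simp: D_def)

lemma D_obtain: assumes "i \<in> D U" obtains v where "v \<in> U" "lead i v"
  using assms by (auto simp: D_def)

lemma D_I: "v \<in> U \<Longrightarrow> lead i v \<Longrightarrow> i \<in> D U"
  by (auto simp: D_def)

text \<open>Vectors with distinct leading degrees are independent, and one vector per leading degree
  suffices to reduce every vector of \<open>U\<close> to 0, degree by degree.\<close>

lemma dim_eq_card_D:
  assumes U: "subspace U" shows "dim U = card (D U)"
proof -
  have "\<forall>i\<in>D U. \<exists>v. v \<in> U \<and> lead i v" by (auto simp: D_def)
  then obtain u where u: "\<And>i. i \<in> D U \<Longrightarrow> u i \<in> U \<and> lead i (u i)" by metis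
  let ?B = "u ` D U"
  have inj: "inj_on u (D U)"
    by (rule inj_onI) (metis u lead_unique)
  have "v \<in> span ?B" if "v \<in> U" "v \<in> F (n + 1 - j)" "j \<le> n" for v j
    using that
  proof (induction j arbitrary: v)
    case 0
    then have "v = 0" using F_zero[of v "n + 1"] by simp
    then show ?case by (simp add: span_zero)
  next
    case (Suc j)
    let ?i = "n + 1 - Suc j"
    have S: "Suc ?i = n + 1 - j" using Suc.prems by simp
    show ?case
    proof (cases "co ?i v = 0")
      case True
      then have "v \<in> F (n + 1 - j)" using Suc.prems S F_Suc by metis
      then show ?thesis using Suc by simp
    next
      case False
      then have l: "lead ?i v" using Suc.prems by (simp add: lead_def)
      then have i: "?i \<in> D U" using Suc.prems by (auto intro: D_I)
      obtain \<alpha> where a: "v - \<alpha> *\<^sub>R u ?i \<in> F (Suc ?i)"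
        using reduce[of ?i "u ?i" v] u[OF i] Suc.prems by blast
      have "v - \<alpha> *\<^sub>R u ?i \<in> span ?B"
        using Suc.IH[of "v - \<alpha> *\<^sub>R u ?i"] a S Suc.prems u[OF i] U
        by (simp add: subspace_diff subspace_scale)
      moreover have "\<alpha> *\<^sub>R u ?i \<in> span ?B" using i by (simp add: span_base span_scale)
      ultimately show ?thesis using span_add by fastforce
    qed
  qed
  from this[of _ n] have "U \<subseteq> span ?B" using F_1 by auto
  moreover have "span ?B \<subseteq> U" using u U by (intro span_minimal) auto
  ultimately have sp: "span ?B = span U" using U by (metis span_eq_iff subset_antisym)
  have "independent ?B"
  proof
    assume "dependent ?B"
    then obtain g where g: "\<exists>v\<in>?B. g v \<noteq> 0" "(\<Sum>v\<in>?B. g v *\<^sub>R v) = 0"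
      using finite_D[of U] by (auto simp: dependent_finite)
    then have s: "(\<Sum>i\<in>D U. g (u i) *\<^sub>R u i) = 0"
      using inj by (simp add: sum.reindex)
    from g have "\<exists>i. i \<in> D U \<and> g (u i) \<noteq> 0" by auto
    then obtain i where i: "i \<in> D U" "g (u i) \<noteq> 0" "\<forall>k<i. \<not> (k \<in> D U \<and> g (u k) \<noteq> 0)"
      using exists_least_iff[of "\<lambda>i. i \<in> D U \<and> g (u i) \<noteq> 0"] by auto
    have "co i (\<Sum>k\<in>D U. g (u k) *\<^sub>R u k) = (\<Sum>k\<in>D U. g (u k) * co i (u k))"
      by (simp add: linear_sum[OF lin_co] co_simps)
    also have "\<dots> = (\<Sum>k\<in>D U. if k = i then g (u i) * co i (u i) else 0)"
    proof (rule sum.cong[OF refl])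
      fix k assume k: "k \<in> D U"
      show "g (u k) * co i (u k) = (if k = i then g (u i) * co i (u i) else 0)"
      proof (cases "k < i")
        case True then show ?thesis using i k by auto
      next
        case False
        then show ?thesis using u[OF k] by (auto simp: lead_def F_def)
      qed
    qed
    also have "\<dots> \<noteq> 0" using i u[OF i(1)] finite_D[of U] by (simp add: lead_def)
    finally show False using s by (simp add: co_simps)
  qed
  then have "dim U = card ?B" using dim_eq_card[OF sp] by blast
  then show ?thesis using inj by (simp add: card_image)
qed

lemma co_br:
  assumes "1 \<le> l" "l \<le> n"
  shows "co l (br v w) = (\<Sum>a=1..n. \<Sum>b=1..n. if a + b = l then co a v * co b w * c a b else 0)"
proof -
  have "br v w = (\<Sum>a=1..n. \<Sum>b=1..n. (co a v * co b w * c a b) *\<^sub>R X (a + b))"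
  proof -
    have "br v w = br (\<Sum>a=1..n. co a v *\<^sub>R X a) (\<Sum>b=1..n. co b w *\<^sub>R X b)"
      by (rule arg_cong2[where f = br, OF expand[of v] expand[of w]])
    also have "\<dots> = (\<Sum>a=1..n. \<Sum>b=1..n. br (co a v *\<^sub>R X a) (co b w *\<^sub>R X b))"
      by (subst bilinear_sum[OF bil]) (rule sum.cartesian_product[symmetric])
    also have "\<dots> = (\<Sum>a=1..n. \<Sum>b=1..n. (co a v * co b w * c a b) *\<^sub>R X (a + b))"
      by (intro sum.cong refl) (simp add: br_simps br_X mult_ac)
    finally show ?thesis .
  qed
  then have "co l (br v w) = (\<Sum>a=1..n. \<Sum>b=1..n. co a v * co b w * c a b * co l (X (a + b)))"
    by (simp add: linear_sum[OF lin_co] co_simps)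
  also have "\<dots> = (\<Sum>a=1..n. \<Sum>b=1..n. if a + b = l then co a v * co b w * c a b else 0)"
    using assms by (intro sum.cong refl) (auto simp: co_X)
  finally show ?thesis .
qed

lemma br_F_row:
  assumes v: "v \<in> F i" and w: "w \<in> F j" and l: "\<And>a b. i \<le> a \<Longrightarrow> j \<le> b \<Longrightarrow> a + b < l \<Longrightarrow> a + b \<le> n \<Longrightarrow> c a b = 0"
  shows "br v w \<in> F l"
  unfolding F_def
proof (safe)
  fix k assume k: "k < l"
  show "co k (br v w) = 0"
  proof (cases "1 \<le> k \<and> k \<le> n")
    case False then show ?thesis using co_out by auto
  next
    case True
    show ?thesis
      unfolding co_br[OF True[THEN conjunct1] True[THEN conjunct2]]
    proof (intro sum.neutral ballI)
      fix a b assume "a \<in> {1..n}" "b \<in> {1..n}"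
      show "(if a + b = k then co a v * co b w * c a b else 0) = 0"
        using v w l[of a b] k True by (cases "a < i"; cases "b < j") (auto simp: F_def)
    qed
  qed
qed

lemma br_F: "v \<in> F i \<Longrightarrow> w \<in> F j \<Longrightarrow> br v w \<in> F (i + j)"
  by (rule br_F_row) auto

lemma br_F': "v \<in> F i \<Longrightarrow> w \<in> F j \<Longrightarrow> l \<le> i + j \<Longrightarrow> br v w \<in> F l"
  using br_F F_mono by blast

lemma co_br_lead:
  assumes "v \<in> F i" "w \<in> F j" "1 \<le> i" "1 \<le> j" "i + j \<le> n"
  shows "co (i + j) (br v w) = c i j * co i v * co j w"
proof -
  have "co (i + j) (br v w) = (\<Sum>a=1..n. \<Sum>b=1..n. if a + b = i + j then co a v * co b w * c a b else 0)"
    using assms by (intro co_br) auto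
  also have "\<dots> = (\<Sum>a=1..n. \<Sum>b=1..n. if a = i \<and> b = j then co i v * co j w * c i j else 0)"
  proof (intro sum.cong refl)
    fix a b assume "a \<in> {1..n}" "b \<in> {1..n}"
    have "a < i \<Longrightarrow> co a v = 0" "b < j \<Longrightarrow> co b w = 0" using assms by (auto simp: F_def)
    then show "(if a + b = i + j then co a v * co b w * c a b else 0) =
        (if a = i \<and> b = j then co i v * co j w * c i j else 0)"
      by (cases "a < i"; cases "b < j") auto
  qed
  also have "\<dots> = (\<Sum>a=1..n. if a = i then co i v * co j w * c i j else 0)"
    using assms by (intro sum.cong refl) auto
  also have "\<dots> = co i v * co j w * c i j"
    using assms by simp
  finally show ?thesis by simp
qed

lemma lead_br: "lead i v \<Longrightarrow> lead j w \<Longrightarrow> i + j \<le> n \<Longrightarrow> c i j \<noteq> 0 \<Longrightarrow> lead (i + j) (br v w)"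
  using co_br_lead[of v i w j] br_F[of v i w j] lead_range[of i v] lead_range[of j w]
  by (auto simp: lead_def)

end

section \<open>Totally geodesic subalgebras of the quotients\<close>

locale graded_filiform_ip = graded_filiform br n X co c
  for br :: "'a::real_vector \<Rightarrow> 'a \<Rightarrow> 'a" and n X co c +
  fixes ip :: "'a \<Rightarrow> 'a \<Rightarrow> real"
  assumes ip: "is_inner_product ip"
begin

lemma ip_bil: "bilinear ip" and ip_sym: "ip x y = ip y x"
  using ip by (auto simp: is_inner_product_def)

lemmas ip_simps = bilinear_ladd[OF ip_bil] bilinear_radd[OF ip_bil] bilinear_lmul[OF ip_bil]
  bilinear_rmul[OF ip_bil] bilinear_lsub[OF ip_bil] bilinear_rsub[OF ip_bil]
  bilinear_lzero[OF ip_bil] bilinear_rzero[OF ip_bil] bilinear_lneg[OF ip_bil]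
  bilinear_rneg[OF ip_bil]

lemma ip_pos: "x \<noteq> 0 \<Longrightarrow> ip x x > 0"
  using ip by (simp add: is_inner_product_def)

lemma ip_eq_0: "ip x x = 0 \<Longrightarrow> x = 0"
  using ip_pos[of x] by fastforce

abbreviation perp :: "'a set \<Rightarrow> 'a set" where "perp H \<equiv> ortho_compl ip H"

lemma perpI: "(\<And>x. x \<in> H \<Longrightarrow> ip v x = 0) \<Longrightarrow> v \<in> perp H"
  by (simp add: ortho_compl_def)

lemma perpD: "v \<in> perp H \<Longrightarrow> x \<in> H \<Longrightarrow> ip v x = 0"
  by (simp add: ortho_compl_def)

lemma perpD': "v \<in> perp H \<Longrightarrow> x \<in> H \<Longrightarrow> ip x v = 0"
  using perpD[of v H x] ip_sym[of x v] by simp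

lemma subspace_perp: "subspace (perp H)"
  by (auto simp: subspace_def ortho_compl_def ip_simps)

lemmas perp_closed = subspace_0[OF subspace_perp] subspace_add[OF subspace_perp]
  subspace_scale[OF subspace_perp] subspace_diff[OF subspace_perp] subspace_neg[OF subspace_perp]

lemma perp_int: "x \<in> H \<Longrightarrow> x \<in> perp H \<Longrightarrow> x = 0"
  by (rule ip_eq_0) (rule perpD)

lemma finite_independent: "independent (B :: 'a set) \<Longrightarrow> finite B"
  using independent_span_bound[of "X ` {1..n}" B] span_X by auto

text \<open>Gram-Schmidt: the projection onto the larger span is corrected along
  \<open>b - q\<close>, the part of \<open>b\<close> orthogonal to the old span.\<close>

lemma proj_span:
  assumes "finite (B :: 'a set)"
  shows "\<exists>p\<in>span B. \<forall>x\<in>span B. ip (v - p) x = 0"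
  using assms
proof (induction B arbitrary: v)
  case empty
  then show ?case by (auto simp: ip_simps)
next
  case (insert b B)
  obtain q where q: "q \<in> span B" "\<forall>x\<in>span B. ip (b - q) x = 0" using insert.IH by blast
  obtain p where p: "p \<in> span B" "\<forall>x\<in>span B. ip (v - p) x = 0" using insert.IH by blast
  have mono: "x \<in> span (insert b B)" if "x \<in> span B" for x
    using that span_mono[of B "insert b B"] by blast
  show ?case
  proof (cases "b = q")
    case True
    then have "span (insert b B) = span B" using q span_redundant by blast
    then show ?thesis using p by auto
  next
    case False
    let ?e = "b - q"
    have e: "ip ?e ?e \<noteq> 0" using ip_pos[of ?e] False by simp
    let ?k = "ip (v - p) ?e / ip ?e ?e"
    let ?p = "p + ?k *\<^sub>R ?e"
    have "b \<in> span (insert b B)" by (simp add: span_base)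
    then have "?e \<in> span (insert b B)" using mono[OF q(1)] by (rule span_diff)
    then have 1: "?p \<in> span (insert b B)" using mono[OF p(1)] by (intro span_add span_scale)
    have "ip (v - ?p) x = 0" if x: "x \<in> span (insert b B)" for x
    proof -
      obtain k where k: "x - k *\<^sub>R b \<in> span B" using x span_breakdown_eq by blast
      define y where "y = x - k *\<^sub>R ?e"
      have "y = (x - k *\<^sub>R b) + k *\<^sub>R q" by (simp add: y_def scaleR_diff_right)
      then have y: "y \<in> span B" using k q(1) by (simp add: span_add span_scale)
      have xy: "x = y + k *\<^sub>R ?e" by (simp add: y_def)
      have v: "v - ?p = (v - p) - ?k *\<^sub>R ?e" by simp
      have id: "a - K * B + k * (A - K * E) = (a + k * A) - K * (B + k * E)" for a K B k A E :: real
        by (simp add: algebra_simps)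
      have 1: "ip (v - p) y = 0" "ip ?e y = 0" using p(2) q(2) y by auto
      have "ip (v - ?p) x = (ip (v - p) y + k * ip (v - p) ?e) - ?k * (ip ?e y + k * ip ?e ?e)"
        unfolding v xy bilinear_lsub[OF ip_bil, of "v - p"] bilinear_lmul[OF ip_bil]
          bilinear_radd[OF ip_bil] bilinear_rmul[OF ip_bil] real_scaleR_def by (rule id)
      also have "\<dots> = 0" unfolding 1 using e by simp
      finally show ?thesis .
    qed
    then show ?thesis using 1 by blast
  qed
qed

lemma ex_proj:
  assumes "subspace H" obtains p where "p \<in> H" "v - p \<in> perp H"
proof -
  obtain B where B: "B \<subseteq> H" "independent B" "H \<subseteq> span B" using basis_exists[of H] by metis
  have "span B = H" using B assms by (metis span_minimal subset_antisym)
  then show thesis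
    using proj_span[OF finite_independent[OF B(2)], of v] that by (auto intro: perpI)
qed

text \<open>Bases of \<open>H\<close> and of its complement together form a basis of the whole
  space. Only the numbers add up: \<open>D H\<close> and \<open>D (perp H)\<close> may overlap and
  may miss degrees.\<close>

lemma card_perp:
  assumes H: "subspace H" shows "card (D H) + card (D (perp H)) = n"
proof -
  obtain B1 where B1: "B1 \<subseteq> H" "independent B1" "H \<subseteq> span B1" "card B1 = dim H"
    using basis_exists[of H] by metis
  obtain B2 where B2: "B2 \<subseteq> perp H" "independent B2" "perp H \<subseteq> span B2" "card B2 = dim (perp H)"
    using basis_exists[of "perp H"] by metis
  have f: "finite B1" "finite B2" using finite_independent B1 B2 by auto
  have int: "span B1 \<inter> span B2 \<subseteq> {0}"
  proof -
    have "span B1 \<subseteq> H" "span B2 \<subseteq> perp H" using span_minimal[OF B1(1) H] span_minimal[OF B2(1) subspace_perp] by auto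
    then show ?thesis using perp_int by blast
  qed
  have disj: "B1 \<inter> B2 = {}"
  proof -
    have "x \<notin> B2" if "x \<in> B1" for x
    proof
      assume "x \<in> B2"
      then have "x = 0" using that int span_base[of x B1] span_base[of x B2] by blast
      then show False using that B1(2) dependent_zero by blast
    qed
    then show ?thesis by blast
  qed
  have "independent (B1 \<union> B2)"
  proof
    assume "dependent (B1 \<union> B2)"
    then obtain g where g: "\<exists>v\<in>B1 \<union> B2. g v \<noteq> 0" "(\<Sum>v\<in>B1 \<union> B2. g v *\<^sub>R v) = 0"
      using f by (auto simp: dependent_finite)
    have s: "(\<Sum>v\<in>B1. g v *\<^sub>R v) + (\<Sum>v\<in>B2. g v *\<^sub>R v) = 0"
      using g(2) f disj by (simp add: sum.union_disjoint)
    have "(\<Sum>v\<in>B1. g v *\<^sub>R v) \<in> span B1" "(\<Sum>v\<in>B2. g v *\<^sub>R v) \<in> span B2"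
      by (intro span_sum span_scale span_base; assumption)+
    moreover have e: "(\<Sum>v\<in>B1. g v *\<^sub>R v) = - (\<Sum>v\<in>B2. g v *\<^sub>R v)"
      using s by (simp add: eq_neg_iff_add_eq_0)
    ultimately have "(\<Sum>v\<in>B1. g v *\<^sub>R v) \<in> span B1 \<inter> span B2" by (simp add: span_neg)
    then have z1: "(\<Sum>v\<in>B1. g v *\<^sub>R v) = 0" using int by blast
    then have z2: "(\<Sum>v\<in>B2. g v *\<^sub>R v) = 0" using s by simp
    show False using g(1) z1 z2 B1(2) B2(2) f by (auto simp: dependent_finite)
  qed
  moreover have "span (B1 \<union> B2) = span UNIV"
  proof -
    have "v \<in> span (B1 \<union> B2)" for v
    proof -
      obtain p where p: "p \<in> H" "v - p \<in> perp H" using ex_proj[OF H] by blast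
      have "p \<in> span (B1 \<union> B2)" "v - p \<in> span (B1 \<union> B2)"
        using p B1(3) B2(3) span_mono[of B1 "B1 \<union> B2"] span_mono[of B2 "B1 \<union> B2"] by blast+
      then show ?thesis using span_add by fastforce
    qed
    then show ?thesis by auto
  qed
  ultimately have "dim (UNIV::'a set) = card (B1 \<union> B2)" using dim_eq_card by metis
  also have "\<dots> = dim H + dim (perp H)" using B1 B2 f disj by (simp add: card_Un_disjoint)
  finally have "dim H + dim (perp H) = card (D UNIV)" using dim_eq_card_D[of UNIV] by simp
  moreover have "D UNIV = {1..n}" using D_range[of UNIV] D_I[OF UNIV_I lead_X] by auto
  ultimately show ?thesis using dim_eq_card_D[OF H] dim_eq_card_D[OF subspace_perp[of H]] by simp
qed

text \<open>
  \<open>tg t H\<close> encodes a totally geodesic subalgebra of the quotient by the ideal \<open>F (t + 1)\<close>, which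
  is identified with the orthogonal complement of \<open>F (t + 1)\<close>.
\<close>

definition tg :: "nat \<Rightarrow> 'a set \<Rightarrow> bool" where
  "tg t H \<longleftrightarrow> t \<le> n \<and> subspace H \<and> H \<subseteq> F 2 \<and> F (Suc t) \<subseteq> perp H \<and>
     (\<forall>x\<in>H. \<forall>y\<in>H. \<exists>h\<in>H. br x y - h \<in> F (Suc t)) \<and>
     (\<forall>y\<in>perp H. \<forall>x\<in>H. ip (br y x) x = 0)"

text \<open>Degree 1 and all degrees from \<open>t + 1\<close> to \<open>n\<close> always belong to
  \<open>D (perp H)\<close> (\<open>perp_1\<close>, \<open>tg_perp\<close>); \<open>M t H\<close>
  keeps the others.\<close>

definition M :: "nat \<Rightarrow> 'a set \<Rightarrow> nat set" where "M t H = D (perp H) \<inter> {2..t}"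

lemma tgD:
  assumes "tg t H"
  shows tg_le: "t \<le> n" and tg_sub: "subspace H" and tg_F2: "x \<in> H \<Longrightarrow> x \<in> F 2"
    and tg_perp: "v \<in> F (Suc t) \<Longrightarrow> v \<in> perp H"
    and tg_skew0: "y \<in> perp H \<Longrightarrow> x \<in> H \<Longrightarrow> ip (br y x) x = 0"
    and tg_zero: "x \<in> H \<Longrightarrow> x \<in> F (Suc t) \<Longrightarrow> x = 0"
  using assms perp_int unfolding tg_def by blast+

lemma tg_br:
  assumes "tg t H" "x \<in> H" "y \<in> H" obtains h where "h \<in> H" "br x y - h \<in> F (Suc t)"
  using assms unfolding tg_def by blast

lemma tg_closed:
  assumes "tg t H"
  shows "x \<in> H \<Longrightarrow> y \<in> H \<Longrightarrow> x + y \<in> H" "x \<in> H \<Longrightarrow> y \<in> H \<Longrightarrow> x - y \<in> H"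
    "x \<in> H \<Longrightarrow> r *\<^sub>R x \<in> H" "0 \<in> H"
  using tg_sub[OF assms] by (auto simp: subspace_add subspace_diff subspace_scale subspace_0)

lemma tg_skew:
  assumes "tg t H" "y \<in> perp H" "x \<in> H" "z \<in> H" shows "ip (br y x) z = - ip (br y z) x"
proof -
  have "ip (br y (x + z)) (x + z) = 0" using assms by (intro tg_skew0) (auto simp: tg_closed)
  then have "ip (br y x) x + ip (br y x) z + (ip (br y z) x + ip (br y z) z) = 0"
    unfolding bilinear_radd[OF bil] bilinear_ladd[OF ip_bil] bilinear_radd[OF ip_bil] by simp
  then show ?thesis using tg_skew0[OF assms(1,2)] assms(3,4) by simp
qed

lemma tg_D: assumes "tg t H" shows "D H \<subseteq> {2..t}"
proof
  fix i assume "i \<in> D H"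
  then obtain x where x: "x \<in> H" "lead i x" by (rule D_obtain)
  have "2 \<le> i" using lead_F[OF x(2)] tg_F2[OF assms x(1)] by blast
  moreover have "i \<le> t"
  proof (rule ccontr)
    assume "\<not> i \<le> t"
    then have "x \<in> F (Suc t)" using x(2) F_mono[of "Suc t" i x] by (simp add: lead_def)
    then have "x = 0" using tg_zero[OF assms x(1)] by blast
    then show False using lead_nz x by blast
  qed
  ultimately show "i \<in> {2..t}" by simp
qed

lemma D_bounds: assumes "tg t H" "i \<in> D H" shows "2 \<le> i" "i \<le> t"
  using subsetD[OF tg_D[OF assms(1)] assms(2)] by simp_all

lemma one_in_perp: assumes "tg t H" obtains y where "y \<in> perp H" "lead 1 y"
proof -
  obtain p where p: "p \<in> H" "X 1 - p \<in> perp H" using ex_proj[OF tg_sub[OF assms]] by blast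
  have "lead 1 (X 1)" using lead_X n3 by simp
  moreover have "X 1 - (X 1 - p) \<in> F (Suc 1)" using tg_F2[OF assms p(1)] by (simp add: numeral_2_eq_2)
  ultimately have "lead 1 (X 1 - p)" by (rule lead_diff)
  then show thesis using that p by blast
qed

lemma perp_1: "tg t H \<Longrightarrow> 1 \<in> D (perp H)"
  using one_in_perp[of t H] D_I by metis

lemma tg_card: assumes "tg t H" "1 \<le> t" shows "card (D H) + card (M t H) = t - 1"
proof -
  have "D (perp H) = M t H \<union> ({1} \<union> {Suc t..n})"
  proof -
    have "i \<in> D (perp H)" if "Suc t \<le> i" "i \<le> n" for i
      using tg_perp[OF assms(1) X_F[OF that(1)]] lead_X[of i] that by (auto intro: D_I)
    then show ?thesis using D_range[of "perp H"] perp_1[OF assms(1)] by (auto simp: M_def)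
  qed
  moreover have "card (M t H \<union> ({1} \<union> {Suc t..n})) = card (M t H) + card ({1} \<union> {Suc t..n})"
    by (intro card_Un_disjoint) (auto simp: M_def)
  moreover have "card ({1} \<union> {Suc t..n}) = 1 + (n - t)"
    using assms(2) by (subst card_Un_disjoint) auto
  ultimately show ?thesis using card_perp[OF tg_sub[OF assms(1)]] tg_le[OF assms(1)] assms(2) by simp
qed

lemma M_fin: "finite (M t H)" "M t H \<subseteq> {2..t}" "i \<in> M t H \<Longrightarrow> i \<in> D (perp H)"
  by (auto simp: M_def)

text \<open>By \<open>compat\<close>, \<open>F j\<close> splits into
  \<open>E = H \<inter> F j\<close> and a normal part. The orthogonal complement \<open>H'\<close>
  of \<open>E\<close> in \<open>H\<close> is then orthogonal to \<open>F j\<close> and represents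
  the image of \<open>H\<close> in the quotient by \<open>F j\<close>; degrees below
  \<open>j\<close> are unaffected.\<close>

lemma descend:
  assumes tg: "tg t H" and j: "2 \<le> j" "j \<le> t"
    and compat: "\<And>v. v \<in> F j \<Longrightarrow> \<exists>h\<in>H. h \<in> F j \<and> v - h \<in> perp H"
  obtains H' where "tg (j - 1) H'" "H' \<subseteq> H" "D H' = D H \<inter> {..<j}" "M (j - 1) H' = M t H \<inter> {..<j}"
    "\<And>x. x \<in> H \<Longrightarrow> \<exists>e\<in>H \<inter> F j. x - e \<in> H'"
proof -
  define E where "E = H \<inter> F j"
  define H' where "H' = H \<inter> perp E"
  note H = tg_sub[OF tg]
  have E: "subspace E" unfolding E_def using H subspace_F by (rule subspace_inter)
  have H': "subspace H'" unfolding H'_def using H subspace_perp by (rule subspace_inter)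
  have split: "\<exists>e\<in>E. x - e \<in> H'" if "x \<in> H" for x
  proof -
    obtain e where e: "e \<in> E" "x - e \<in> perp E" using ex_proj[OF E] by blast
    then have "x - e \<in> H" using that tg_closed(2)[OF tg] by (simp add: E_def)
    then show ?thesis using e by (auto simp: H'_def)
  qed
  have Fperp: "F j \<subseteq> perp H'"
  proof
    fix v assume "v \<in> F j"
    then obtain h where h: "h \<in> E" "v - h \<in> perp H" using compat by (auto simp: E_def)
    show "v \<in> perp H'"
    proof (rule perpI)
      fix x assume x: "x \<in> H'"
      have "ip (v - h) x = 0" "ip h x = 0"
        using x h perpD[of "v - h" H x] perpD'[of x E h] by (auto simp: H'_def)
      then show "ip v x = 0" by (simp add: ip_simps)
    qed
  qed
  \<comment> \<open>The complement of \<open>H'\<close> is \<open>perp H + E\<close>, and brackets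
    with \<open>E\<close> end in \<open>F j\<close>, which is orthogonal to
    \<open>H'\<close>.\<close>
  have perp': "\<exists>e\<in>E. y - e \<in> perp H" if y: "y \<in> perp H'" for y
  proof -
    obtain p where p: "p \<in> H" "y - p \<in> perp H" using ex_proj[OF H] by blast
    obtain e where e: "e \<in> E" "p - e \<in> H'" using split[OF p(1)] by blast
    have "ip (p - e) (p - e) = 0"
    proof -
      have "ip y (p - e) = 0" using perpD[OF y e(2)] .
      moreover have "ip (y - p) (p - e) = 0" using perpD[OF p(2)] e(2) by (auto simp: H'_def)
      moreover have "ip e (p - e) = 0" using e perpD'[of "p - e" E e] by (auto simp: H'_def)
      ultimately show ?thesis by (simp add: ip_simps)
    qed
    then have "p = e" using ip_eq_0 by fastforce
    then show ?thesis using p e by auto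
  qed
  have Sj: "Suc (j - 1) = j" using j by simp
  have sub: "F (Suc t) \<subseteq> F j" using j F_mono[of j "Suc t"] by auto
  have 1: "tg (j - 1) H'"
    unfolding tg_def Sj
  proof (intro conjI ballI)
    show "j - 1 \<le> n" using j tg_le[OF tg] by simp
    show "subspace H'" by (rule H')
    show "H' \<subseteq> F 2" using tg_F2[OF tg] by (auto simp: H'_def)
    show "F j \<subseteq> perp H'" by (rule Fperp)
    show "\<exists>h\<in>H'. br x y - h \<in> F j" if "x \<in> H'" "y \<in> H'" for x y
    proof -
      obtain h where h: "h \<in> H" "br x y - h \<in> F (Suc t)"
        using tg_br[OF tg, of x y] \<open>x \<in> H'\<close> \<open>y \<in> H'\<close> by (auto simp: H'_def)
      obtain e where e: "e \<in> E" "h - e \<in> H'" using split h by blast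
      have eq: "br x y - (h - e) = (br x y - h) + e" by simp
      have "br x y - h \<in> F j" "e \<in> F j" using h sub e by (auto simp: E_def)
      then have "br x y - (h - e) \<in> F j" unfolding eq by (rule F_closed(2))
      then show ?thesis using e by blast
    qed
    show "ip (br y x) x = 0" if "y \<in> perp H'" "x \<in> H'" for y x
    proof -
      obtain e where e: "e \<in> E" "y - e \<in> perp H" using perp' \<open>y \<in> perp H'\<close> by blast
      have xH: "x \<in> H" using \<open>x \<in> H'\<close> by (auto simp: H'_def)
      have "br e x \<in> F j" using e xH tg_F2[OF tg] br_F'[of e j x 2 j] by (auto simp: E_def)
      then have "ip (br e x) x = 0" using Fperp perpD \<open>x \<in> H'\<close> by blast
      moreover have "ip (br (y - e) x) x = 0" using tg_skew0[OF tg e(2) xH] .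
      ultimately show ?thesis by (simp add: bilinear_lsub[OF bil] bilinear_lsub[OF ip_bil])
    qed
  qed
  have 2: "D H' = D H \<inter> {..<j}"
  proof (intro equalityI subsetI)
    fix i assume i: "i \<in> D H'"
    then have "i \<in> D H" using D_mono[of H' H] by (auto simp: H'_def)
    moreover have "i < j" using D_bounds(2)[OF 1 i] j by simp
    ultimately show "i \<in> D H \<inter> {..<j}" by simp
  next
    fix i assume "i \<in> D H \<inter> {..<j}"
    then obtain x where x: "x \<in> H" "lead i x" "i < j" by (auto elim: D_obtain)
    obtain e where e: "e \<in> E" "x - e \<in> H'" using split x by blast
    have "x - (x - e) \<in> F (Suc i)" using e x F_mono[of "Suc i" j e] by (auto simp: E_def)
    then show "i \<in> D H'" using lead_diff[OF x(2)] D_I[OF e(2)] by blast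
  qed
  have 3: "M (j - 1) H' = M t H \<inter> {..<j}"
  proof (intro equalityI subsetI)
    fix i assume "i \<in> M (j - 1) H'"
    then obtain y where y: "y \<in> perp H'" "lead i y" and i: "2 \<le> i" "i < j"
      using j by (auto simp: M_def elim!: D_obtain)
    obtain e where e: "e \<in> E" "y - e \<in> perp H" using perp' y by blast
    have "y - (y - e) \<in> F (Suc i)" using e i F_mono[of "Suc i" j e] by (auto simp: E_def)
    then have "i \<in> D (perp H)" using lead_diff[OF y(2)] D_I[OF e(2)] by blast
    then show "i \<in> M t H \<inter> {..<j}" using i j by (auto simp: M_def)
  next
    fix i assume "i \<in> M t H \<inter> {..<j}"
    moreover have "perp H \<subseteq> perp H'" by (auto simp: H'_def ortho_compl_def)
    ultimately show "i \<in> M (j - 1) H'" using subsetD[OF D_mono[of "perp H" "perp H'"], of i]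
      by (auto simp: M_def)
  qed
  have 4: "H' \<subseteq> H" by (simp add: H'_def)
  show thesis using split by (intro that[OF 1 4 2 3]) (simp add: E_def)
qed

lemma perp_top:
  assumes tg: "tg t H" and t: "t \<in> D (perp H)" shows "F t \<subseteq> perp H"
proof
  fix v assume v: "v \<in> F t"
  obtain y where y: "y \<in> perp H" "lead t y" using t by (rule D_obtain)
  obtain \<alpha> where "v - \<alpha> *\<^sub>R y \<in> F (Suc t)" using reduce[OF y(2) v] by blast
  then have "v - \<alpha> *\<^sub>R y \<in> perp H" using tg_perp[OF tg] by blast
  then have "(v - \<alpha> *\<^sub>R y) + \<alpha> *\<^sub>R y \<in> perp H" using perp_closed(2)[OF _ perp_closed(3)[OF y(1)]] by blast
  then show "v \<in> perp H" by simp
qed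

lemma D_disjoint_top: assumes tg: "tg t H" and "t \<in> D (perp H)" shows "t \<notin> D H"
proof
  assume "t \<in> D H"
  then obtain x where x: "x \<in> H" "lead t x" by (rule D_obtain)
  then have "x \<in> perp H" using perp_top[OF assms] by (auto simp: lead_def)
  then show False using perp_int[OF x(1)] lead_nz x by blast
qed

text \<open>Modulo \<open>F (t + 1)\<close> the ideal \<open>F t\<close> is a line, so it splits as
  soon as a tangential or a normal vector has leading degree \<open>t\<close>.\<close>

lemma descend_top:
  assumes tg: "tg t H" and t: "2 \<le> t" "t \<in> D H \<or> t \<in> D (perp H)"
  obtains H' where "tg (t - 1) H'" "H' \<subseteq> H" "D H' = D H - {t}" "M (t - 1) H' = M t H - {t}"
proof -
  have compat: "\<exists>h\<in>H. h \<in> F t \<and> v - h \<in> perp H" if v: "v \<in> F t" for v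
  proof (cases "t \<in> D H")
    case True
    then obtain x where x: "x \<in> H" "lead t x" by (rule D_obtain)
    obtain \<alpha> where a: "v - \<alpha> *\<^sub>R x \<in> F (Suc t)" using reduce[OF x(2) v] by blast
    then have "\<alpha> *\<^sub>R x \<in> H" "\<alpha> *\<^sub>R x \<in> F t" using x tg_closed(3)[OF tg] F_closed by (auto simp: lead_def)
    then show ?thesis using a tg_perp[OF tg] by blast
  next
    case False
    then have "v \<in> perp H" using t perp_top[OF tg] v by blast
    then show ?thesis using tg_closed(4)[OF tg] F_closed(1) by (intro bexI[of _ 0]) auto
  qed
  have eq: "D H \<inter> {..<t} = D H - {t}" using D_bounds(2)[OF tg] by fastforce
  have eq': "M t H \<inter> {..<t} = M t H - {t}" by (auto simp: M_def)
  show thesis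
  proof (rule descend[OF tg t(1) order_refl compat])
    fix H' assume H': "tg (t - 1) H'" "H' \<subseteq> H" "D H' = D H \<inter> {..<t}" "M (t - 1) H' = M t H \<inter> {..<t}"
    show thesis by (rule that[OF H'(1,2)]) (simp_all only: H'(3,4) eq eq')
  qed
qed

lemma HH:
  assumes tg: "tg t H" and "i \<in> D H" "j \<in> D H" "i + j \<le> t" "c i j \<noteq> 0" shows "i + j \<in> D H"
proof -
  obtain x y where x: "x \<in> H" "lead i x" and y: "y \<in> H" "lead j y"
    using assms(2,3) by (auto elim!: D_obtain)
  obtain h where h: "h \<in> H" "br x y - h \<in> F (Suc t)" using tg_br[OF tg x(1) y(1)] .
  have "lead (i + j) (br x y)" using lead_br[OF x(2) y(2)] assms tg_le[OF tg] by simp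
  moreover have "br x y - h \<in> F (Suc (i + j))" using h F_mono[of "Suc (i + j)" "Suc t"] assms by simp
  ultimately have "lead (i + j) h" by (rule lead_diff)
  then show ?thesis using h D_I by blast
qed

text \<open>The tangential vector \<open>z\<close> of degree \<open>t\<close> is killed by all
  brackets modulo \<open>F (t + 1)\<close>, so skew-symmetry makes \<open>br y x\<close> orthogonal
  to \<open>z\<close>, while modulo \<open>F (t + 1)\<close> it is a multiple of
  \<open>z\<close>.\<close>

lemma HM_vec:
  assumes tg: "tg t H" and t: "t \<in> D H" and x: "x \<in> H" and y: "y \<in> perp H" and b: "br y x \<in> F t"
  shows "br y x \<in> F (Suc t)"
proof -
  obtain z where z: "z \<in> H" "lead t z" using t by (rule D_obtain)
  obtain \<alpha> where a: "br y x - \<alpha> *\<^sub>R z \<in> F (Suc t)" using reduce[OF z(2) b] by blast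
  have "br y z \<in> F (Suc t)" using br_F'[OF F_1 leadD(1)[OF z(2)]] by simp
  then have "ip (br y z) x = 0" using tg_perp[OF tg] perpD x by blast
  then have "ip (br y x) z = 0" using tg_skew[OF tg y x z(1)] by simp
  moreover have "ip (br y x - \<alpha> *\<^sub>R z) z = 0" using tg_perp[OF tg a] perpD z by blast
  ultimately have "\<alpha> * ip z z = 0" by (simp add: ip_simps)
  then have "\<alpha> = 0" using ip_pos[OF lead_nz[OF z(2)]] by simp
  then show ?thesis using a by simp
qed

lemma HM:
  assumes tg: "tg t H" and t: "t \<in> D H" and i: "i \<in> D H" and j: "j \<in> D (perp H)" and "i + j = t"
  shows "c j i = 0"
proof (rule ccontr)
  assume c: "c j i \<noteq> 0"
  obtain x y where x: "x \<in> H" "lead i x" and y: "y \<in> perp H" "lead j y"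
    using i j by (auto elim!: D_obtain)
  have l: "lead t (br y x)" using lead_br[OF y(2) x(2)] c assms(5) tg_le[OF tg] by (simp add: add.commute)
  then have "br y x \<in> F (Suc t)" using HM_vec[OF tg t x(1) y(1)] by (simp add: lead_def)
  then show False using l by (simp add: lead_def F_Suc)
qed

text \<open>\<open>HM\<close> with a normal vector of degree 1, which always exists, and
  \<open>c 1 (t - 1) = 1\<close>.\<close>

lemma consec: assumes tg: "tg t H" and t: "t \<in> D H" "2 < t" shows "t - 1 \<notin> D H"
proof
  assume "t - 1 \<in> D H"
  then have "c 1 (t - 1) = 0" using HM[OF tg t(1) _ perp_1[OF tg]] t by simp
  moreover have "2 \<le> t - 1" "t - 1 < n" using t tg_le[OF tg] by linarith+
  ultimately show False using c1[of "t - 1"] by simp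
qed

end

section \<open>Quotients whose top degree does not split\<close>

context graded_filiform_ip begin

lemma br_ideal: "w \<in> F j \<Longrightarrow> br v w \<in> F j"
  using br_F'[OF F_1, of w j j v] by simp

text \<open>
  The image of \<open>F t\<close> is not the direct sum of its intersections with \<open>H\<close> and its complement:
  \<open>z\<close> is the tangential part of \<open>X t\<close>.
\<close>

definition nc :: "nat \<Rightarrow> 'a set \<Rightarrow> nat \<Rightarrow> 'a \<Rightarrow> bool" where
  "nc t H a z \<longleftrightarrow> tg t H \<and> 1 \<le> t \<and> t \<notin> D H \<and> t \<notin> D (perp H) \<and> z \<in> H \<and> X t - z \<in> perp H \<and>
     lead a z \<and> 2 \<le> a \<and> a < t"

text \<open>If \<open>z\<close> were in \<open>F t\<close>, neither \<open>z\<close> nor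
  \<open>X t - z\<close> could have leading degree \<open>t\<close>, so both coordinates of degree
  \<open>t\<close> would vanish, although they add up to 1.\<close>

lemma nc_ex:
  assumes tg: "tg t H" "1 \<le> t" and t: "t \<notin> D H" "t \<notin> D (perp H)" obtains a z where "nc t H a z"
proof -
  obtain z where z: "z \<in> H" "X t - z \<in> perp H" using ex_proj[OF tg_sub[OF tg(1)]] by blast
  have lX: "lead t (X t)" using lead_X tg tg_le by blast
  have "z \<notin> F t"
  proof
    assume zF: "z \<in> F t"
    then have "X t - z \<in> F t" using X_F[of t t] F_closed by blast
    then have "co t (X t - z) = 0" using t(2) D_I[OF z(2)] by (auto simp: lead_def)
    moreover have "co t z = 0" using t(1) D_I[OF z(1)] zF by (auto simp: lead_def)
    ultimately have "co t (X t) = 0" by (simp add: linear_diff[OF lin_co])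
    then show False using lX by (simp add: lead_def)
  qed
  then obtain a where a: "lead a z" "a < t" using ex_lead_not_F by blast
  moreover have "2 \<le> a" using lead_F[OF a(1)] tg_F2[OF tg(1) z(1)] by blast
  ultimately show thesis using that z assms by (simp add: nc_def)
qed

lemma ncD:
  assumes "nc t H a z"
  shows nc_tg: "tg t H" and nc_t: "1 \<le> t" "t \<notin> D H" "t \<notin> D (perp H)" and nc_z: "z \<in> H" "X t - z \<in> perp H"
    and nc_lead: "lead a z" and nc_a: "2 \<le> a" "a < t"
  using assms by (simp_all add: nc_def)

lemma nc_aH: "nc t H a z \<Longrightarrow> a \<in> D H"
  using nc_z(1) nc_lead D_I by blast

lemma nc_lead_perp: assumes nc: "nc t H a z" shows "lead a (X t - z)"
proof -
  have "lead a (- z)" using nc_lead[OF nc] F_closed(5)[of z a] by (simp add: lead_def linear_neg[OF lin_co])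
  moreover have "- z - (X t - z) \<in> F (Suc a)"
    using X_F[of "Suc a" t] nc_a[OF nc] F_closed(5)[of "X t" "Suc a"] by simp
  ultimately show ?thesis by (rule lead_diff)
qed

lemma nc_ip: assumes nc: "nc t H a z" and x: "x \<in> H" shows "ip (X t) x = ip z x"
  using perpD[OF nc_z(2)[OF nc] x] by (simp add: ip_simps)

lemma nc_z_nz: assumes nc: "nc t H a z" shows "ip z z > 0"
  using ip_pos lead_nz nc_lead[OF nc] by blast

text \<open>\<open>X t\<close> is central modulo \<open>F (t + 1)\<close>, so the normal vector
  \<open>X t - z\<close> acts as \<open>- ad z\<close>. On \<open>H\<close> the operator
  \<open>ad z\<close> is thus nilpotent and skew-symmetric, hence zero. The induction goes through
  the \<open>H \<inter> F j\<close> for decreasing \<open>j\<close>.\<close>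

lemma nc_central:
  assumes nc: "nc t H a z" and x: "x \<in> H" shows "br z x \<in> F (Suc t)"
proof -
  note tg = nc_tg[OF nc] and z = nc_z[OF nc]
  have "\<forall>x\<in>H \<inter> F (Suc t - j). br z x \<in> F (Suc t)" for j
  proof (induction j)
    case 0
    then show ?case using br_ideal by simp
  next
    case (Suc j)
    show ?case
    proof
      fix x assume x: "x \<in> H \<inter> F (Suc t - Suc j)"
      then obtain h where h: "h \<in> H" "br z x - h \<in> F (Suc t)" using tg_br[OF tg z(1)] by blast
      have "br z x \<in> F (Suc t - j)" using leadD(1)[OF nc_lead[OF nc]] x nc_a[OF nc] by (auto intro!: br_F')
      moreover have "br z x - h \<in> F (Suc t - j)" using h F_mono[of "Suc t - j" "Suc t"] by simp
      ultimately have "br z x - (br z x - h) \<in> F (Suc t - j)" by (rule F_closed(4))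
      then have "h \<in> H \<inter> F (Suc t - j)" using h by simp
      then have zh: "br z h \<in> F (Suc t)" using Suc by blast
      define zm where "zm = X t - z"
      have Xt: "br (X t) y \<in> F (Suc t)" for y using br_F'[OF X_F[OF order_refl] F_1] by simp
      have zm: "br zm y = br (X t) y - br z y" for y by (simp add: zm_def bilinear_lsub[OF bil])
      have "br zm h \<in> F (Suc t)" unfolding zm using Xt zh by (rule F_closed(4))
      then have "ip (br zm h) x = 0" using tg_perp[OF tg] perpD x by blast
      then have "ip (br zm x) h = 0" using tg_skew[OF tg, of zm x h] z(2) x h by (simp add: zm_def)
      moreover have "br zm x + h \<in> F (Suc t)"
      proof -
        have "br zm x + h = br (X t) x - (br z x - h)" by (simp add: zm)
        then show ?thesis using F_closed(4)[OF Xt[of x] h(2)] by (simp only:)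
      qed
      then have "ip (br zm x + h) h = 0" using tg_perp[OF tg] perpD h by blast
      ultimately have "ip h h = 0" by (simp add: ip_simps)
      then have "h = 0" by (rule ip_eq_0)
      then show "br z x \<in> F (Suc t)" using h by simp
    qed
  qed
  from this[of "Suc t"] have "\<forall>x\<in>H \<inter> F 0. br z x \<in> F (Suc t)" by simp
  moreover have "x \<in> F 0" by (simp add: F_def)
  ultimately show ?thesis using x by blast
qed

text \<open>The tangential part of \<open>v\<close> commutes with \<open>z\<close> modulo
  \<open>F (t + 1)\<close> by \<open>nc_central\<close>, so skew-symmetry becomes available for
  every \<open>v\<close> acting on \<open>z\<close>.\<close>

lemma nc_perp_part:
  assumes nc: "nc t H a z" obtains y where "y \<in> perp H" "br v z - br y z \<in> F (Suc t)" "\<And>j. j \<le> 2 \<Longrightarrow> v \<in> F j \<Longrightarrow> y \<in> F j"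
proof -
  obtain p where p: "p \<in> H" "v - p \<in> perp H" using ex_proj[OF tg_sub[OF nc_tg[OF nc]]] by blast
  have "br v z - br (v - p) z = - br z p" using br_skew[of p z] by (simp add: bilinear_lsub[OF bil])
  then have "br v z - br (v - p) z \<in> F (Suc t)" using nc_central[OF nc p(1)] F_closed(5) by simp
  moreover have "v - p \<in> F j" if "j \<le> 2" "v \<in> F j" for j
    using that F_mono[OF that(1) tg_F2[OF nc_tg[OF nc] p(1)]] F_closed(4) by blast
  ultimately show thesis using that p by blast
qed

lemma reduce_X: assumes "v \<in> F t" "1 \<le> t" "t \<le> n" obtains \<alpha> where "v - \<alpha> *\<^sub>R X t \<in> F (Suc t)"
  using reduce[OF lead_X[OF assms(2,3)] assms(1)] by blast

text \<open>If \<open>br v z\<close> is \<open>\<alpha> X t\<close> modulo \<open>F (t + 1)\<close>,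
  its product with \<open>z\<close> is \<alpha> times \<open>ip z z\<close>, because
  \<open>z\<close> is the tangential part of \<open>X t\<close>; by skew-symmetry that product is
  0.\<close>

lemma nc_F:
  assumes nc: "nc t H a z" and v: "br v z \<in> F t" shows "br v z \<in> F (Suc t)"
proof -
  note tg = nc_tg[OF nc] and z = nc_z[OF nc]
  obtain \<alpha> where a: "br v z - \<alpha> *\<^sub>R X t \<in> F (Suc t)" using reduce_X[OF v nc_t(1)[OF nc] tg_le[OF tg]] .
  obtain y where y: "y \<in> perp H" "br v z - br y z \<in> F (Suc t)" using nc_perp_part[OF nc] by blast
  have "ip (br y z) z = 0" by (rule tg_skew0[OF tg y(1) z(1)])
  moreover have "ip (br v z - br y z) z = 0" using tg_perp[OF tg y(2)] perpD z by blast
  moreover have "ip (br v z - \<alpha> *\<^sub>R X t) z = 0" using tg_perp[OF tg a] perpD z by blast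
  moreover have "ip (X t) z = ip z z" using nc_ip[OF nc z(1)] .
  ultimately have "\<alpha> * ip z z = 0" by (simp add: ip_simps)
  then have "\<alpha> = 0" using nc_z_nz[OF nc] by simp
  then show ?thesis using a by simp
qed

text \<open>The constraint that makes the nonsplit case rare: \<open>a\<close> must be a zero of the
  row of degree \<open>t\<close>.\<close>

lemma nc_c: assumes nc: "nc t H a z" shows "c (t - a) a = 0"
proof (rule ccontr)
  assume c: "c (t - a) a \<noteq> 0"
  have l: "lead (t - a) (X (t - a))" using lead_X nc_a[OF nc] tg_le[OF nc_tg[OF nc]] by simp
  have "t - a + a = t" using nc_a[OF nc] by simp
  then have "lead t (br (X (t - a)) z)"
    using lead_br[OF l nc_lead[OF nc] _ c] tg_le[OF nc_tg[OF nc]] by simp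
  then show False using nc_F[OF nc, of "X (t - a)"] by (simp add: lead_def F_Suc)
qed

lemma nc_a_le: assumes nc: "nc t H a z" shows "a + 2 \<le> t"
proof (rule ccontr)
  assume "\<not> a + 2 \<le> t"
  then have "t - a = 1" "a < n" using nc_a[OF nc] tg_le[OF nc_tg[OF nc]] by auto
  then show False using nc_c[OF nc] c1[of a] nc_a[OF nc] by simp
qed

lemma nc_c': assumes nc: "nc t H a z" shows "c a (t - a) = 0"
  using nc_c[OF nc] c_skew[of "t - a" a] nc_a[OF nc] tg_le[OF nc_tg[OF nc]] by simp

lemma nc_row:
  assumes nc: "nc t H a z" and j: "j \<in> D H" "a + j \<le> t" shows "c a j = 0"
proof (rule ccontr)
  assume c: "c a j \<noteq> 0"
  obtain x where x: "x \<in> H" "lead j x" using j(1) by (rule D_obtain)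
  have "lead (a + j) (br z x)" using lead_br[OF nc_lead[OF nc] x(2) _ c] j tg_le[OF nc_tg[OF nc]] by simp
  then have "Suc t \<le> a + j" using lead_F nc_central[OF nc x(1)] by blast
  then show False using j by simp
qed

text \<open>A normal vector in \<open>F 2\<close> sends degree \<open>t - 1\<close> into
  \<open>F (t + 1)\<close>; so \<open>br v z\<close> is orthogonal to \<open>x\<close> as well as to
  \<open>z\<close>, which leaves no room for a tangential part.\<close>

lemma nc_F_pred:
  assumes nc: "nc t H a z" and t1: "t - 1 \<in> D H" and v: "v \<in> F 2" "br v z \<in> F (t - 1)"
  shows "br v z \<in> F (Suc t)"
proof -
  note tg = nc_tg[OF nc] and z = nc_z[OF nc]
  have t: "Suc (t - 1) = t" using nc_t[OF nc] by simp
  obtain x where x: "x \<in> H" "lead (t - 1) x" using t1 by (rule D_obtain)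
  obtain y where y: "y \<in> perp H" "br v z - br y z \<in> F (Suc t)" "y \<in> F 2"
    using nc_perp_part[OF nc] v(1) by (metis order_refl)
  obtain \<alpha> where "br v z - \<alpha> *\<^sub>R x \<in> F t" using reduce[OF x(2) v(2)] t by metis
  then obtain \<beta> where b: "br v z - \<alpha> *\<^sub>R x - \<beta> *\<^sub>R X t \<in> F (Suc t)"
    using reduce_X[OF _ nc_t(1)[OF nc] tg_le[OF tg]] by blast
  have "br y x \<in> F (Suc t)" using br_F'[OF y(3) leadD(1)[OF x(2)]] nc_t[OF nc] by simp
  then have "ip (br y x) z = 0" using tg_perp[OF tg] perpD z by blast
  then have 1: "ip (br y z) x = 0" using tg_skew[OF tg y(1) x(1) z(1)] by simp
  have 2: "ip (br y z) z = 0" by (rule tg_skew0[OF tg y(1) z(1)])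
  have 3: "ip (br v z - br y z) w = 0" if "w \<in> H" for w using tg_perp[OF tg y(2)] perpD that by blast
  have 4: "ip (br v z - \<alpha> *\<^sub>R x - \<beta> *\<^sub>R X t) w = 0" if "w \<in> H" for w
    using tg_perp[OF tg b] perpD that by blast
  have 5: "ip (br v z) w = 0" if "w \<in> {x, z}" for w
  proof -
    have "w \<in> H" "ip (br y z) w = 0" using that x z 1 2 by auto
    then show ?thesis using 3[of w] by (simp add: ip_simps)
  qed
  have 6: "\<alpha> * ip x w + \<beta> * ip z w = 0" if "w \<in> {x, z}" for w
  proof -
    have "w \<in> H" using that x z by auto
    then show ?thesis using 4[of w] 5[OF that] nc_ip[OF nc, of w] by (simp add: ip_simps)
  qed
  define w where "w = \<alpha> *\<^sub>R x + \<beta> *\<^sub>R z"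
  have wx: "ip w x = 0" and wz: "ip w z = 0" using 6[of x] 6[of z] by (simp_all add: w_def ip_simps)
  have "ip w w = \<alpha> * ip w x + \<beta> * ip w z"
    by (subst (2) w_def) (simp add: bilinear_radd[OF ip_bil] bilinear_rmul[OF ip_bil])
  then have w0: "w = 0" using wx wz by (intro ip_eq_0) simp
  have "a < t - 1" using nc_a_le[OF nc] by simp
  then have "co a x = 0" using x(2) by (auto simp: lead_def F_def)
  then have "\<beta> * co a z = 0"
    using arg_cong[OF w0, of "co a"] by (simp add: w_def co_simps)
  then have b0: "\<beta> = 0" using nc_lead[OF nc] by (simp add: lead_def)
  then have a0: "\<alpha> = 0" using w0 lead_nz[OF x(2)] by (simp add: w_def)
  then show ?thesis using b b0 by simp
qed

text \<open>\<open>a + 3 \<le> t\<close> makes the acting degree \<open>t - 1 - a\<close> at least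
  2, as \<open>nc_F_pred\<close> requires.\<close>

lemma nc_c_pred:
  assumes nc: "nc t H a z" and t1: "t - 1 \<in> D H" and a: "a + 3 \<le> t" shows "c (t - 1 - a) a = 0"
proof (rule ccontr)
  assume c: "c (t - 1 - a) a \<noteq> 0"
  have l: "lead (t - 1 - a) (X (t - 1 - a))" using lead_X a tg_le[OF nc_tg[OF nc]] by simp
  have "t - 1 - a + a = t - 1" using a by simp
  then have *: "lead (t - 1) (br (X (t - 1 - a)) z)"
    using lead_br[OF l nc_lead[OF nc] _ c] tg_le[OF nc_tg[OF nc]] by simp
  then have "br (X (t - 1 - a)) z \<in> F (Suc t)"
    using nc_F_pred[OF nc t1, of "X (t - 1 - a)"] X_F[of 2 "t - 1 - a"] a by (simp add: lead_def)
  then show False using lead_F[OF *] a by fastforce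
qed

end

section \<open>Rows of nonzero structure constants\<close>

lemma card_reflect_disjoint:
  fixes m :: nat
  assumes W: "finite W" and S: "S \<subseteq> W" and T: "(\<lambda>i. m - i) ` T \<subseteq> W" and le: "T \<subseteq> {..m}"
    and disj: "\<And>i. i \<in> T \<Longrightarrow> m - i \<notin> S"
  shows "card S + card T \<le> card W"
proof -
  have inj: "inj_on (\<lambda>i. m - i) T"
  proof (rule inj_onI)
    fix x y assume "x \<in> T" "y \<in> T" "m - x = m - y"
    moreover have "x \<le> m" "y \<le> m" using calculation le by blast+
    ultimately show "x = y" by linarith
  qed
  have "card S + card T = card S + card ((\<lambda>i. m - i) ` T)" using inj by (simp add: card_image)
  also have "\<dots> = card (S \<union> (\<lambda>i. m - i) ` T)"
    using disj finite_subset[OF S W] finite_subset[OF T W] by (intro card_Un_disjoint[symmetric]) auto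
  also have "\<dots> \<le> card W" using W S T by (intro card_mono) auto
  finally show ?thesis .
qed

lemma card_Int_Diff_le:
  assumes "finite A" "A \<subseteq> B \<union> C" "finite C" shows "card A \<le> card (A \<inter> B) + card C"
proof -
  have "card A \<le> card ((A \<inter> B) \<union> C)" using assms by (intro card_mono) auto
  also have "\<dots> \<le> card (A \<inter> B) + card C" by (rule card_Un_le)
  finally show ?thesis .
qed

context graded_filiform
begin

text \<open>The middle entry is exempt because \<open>c i i = 0\<close>.\<close>

definition full :: "nat \<Rightarrow> bool" where
  "full t \<longleftrightarrow> (\<forall>i. 2 \<le> i \<longrightarrow> i + 2 \<le> t \<longrightarrow> 2 * i \<noteq> t \<longrightarrow> c i (t - i) \<noteq> 0)"

lemma fullD: "full t \<Longrightarrow> 2 \<le> i \<Longrightarrow> i + 2 \<le> t \<Longrightarrow> 2 * i \<noteq> t \<Longrightarrow> c i (t - i) \<noteq> 0"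
  by (simp add: full_def)

end

context graded_filiform_ip
begin

lemma descend_top_ex:
  assumes "tg t H" "2 \<le> t" "t \<in> D H \<or> t \<in> D (perp H)"
  shows "\<exists>H'. tg (t - 1) H' \<and> D H' = D H - {t} \<and> M (t - 1) H' = M t H - {t}"
  by (rule descend_top[OF assms]) blast

definition bounded where "bounded t \<longleftrightarrow> (\<forall>H. tg t H \<longrightarrow> 2 * card (D H) \<le> t)"
definition nc_bounded where "nc_bounded t \<longleftrightarrow> (\<forall>H a z. nc t H a z \<longrightarrow> 2 * card (D H) \<le> t)"
text \<open>Strictness leaves room for one more tangential degree at level
  \<open>t + 1\<close>.\<close>

definition nc_strict where "nc_strict t \<longleftrightarrow> (\<forall>H a z. nc t H a z \<longrightarrow> 2 * card (D H) < t)"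

lemma nc_strict_bounded: "nc_strict t \<Longrightarrow> nc_bounded t"
  unfolding nc_strict_def nc_bounded_def by (meson less_imp_le)

lemma nc_HH:
  assumes tg: "tg t H" and t: "t \<notin> D H" and "i \<in> D H" "t - i \<in> D H" shows "c i (t - i) = 0"
proof (rule ccontr)
  assume "c i (t - i) \<noteq> 0"
  moreover have "i \<le> t" using D_bounds[OF tg] assms by blast
  ultimately show False using HH[OF tg assms(3,4)] t by simp
qed

text \<open>By \<open>nc_HH\<close> each pair \<open>i\<close>, \<open>t - i\<close> contributes at
  most one leading degree; only the middle degree of an even \<open>t\<close> is its own partner and
  remains unconstrained.\<close>

lemma full_pairs:
  assumes tg: "tg t H" and t: "t \<notin> D H" and full: "full t"
  shows "2 * card (D H \<inter> {2..t - 2}) \<le> t - 3 + (if even t then 1 else 0)"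
proof -
  define Z where "Z = (if even t then {t div 2} else {})"
  have Z: "2 * i = t \<Longrightarrow> i \<in> Z" for i by (auto simp: Z_def)
  let ?S = "D H \<inter> {2..t - 2}"
  let ?T = "?S - Z"
  have "card ?S + card ?T \<le> card {2..t - 2}"
  proof (rule card_reflect_disjoint[where m = t])
    fix i assume i: "i \<in> ?T"
    then have "2 \<le> i" "i + 2 \<le> t" "2 * i \<noteq> t" using Z by auto
    then have "c i (t - i) \<noteq> 0" by (rule fullD[OF full])
    then show "t - i \<notin> ?S" using nc_HH[OF tg t, of i] i by blast
  qed auto
  moreover have "card ?S \<le> card ?T + card Z"
  proof -
    have "card ?S \<le> card (?T \<union> Z)" by (intro card_mono) (auto simp: Z_def)
    also have "\<dots> \<le> card ?T + card Z" by (rule card_Un_le)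
    finally show ?thesis .
  qed
  moreover have "card Z = (if even t then 1 else 0)" by (simp add: Z_def)
  ultimately show ?thesis by (auto split: if_splits)
qed

lemma full_not_top:
  assumes tg: "tg t H" and t: "t \<notin> D H" "3 \<le> t" and full: "full t" shows "2 * card (D H) \<le> t"
proof -
  have "D H \<subseteq> {2..t - 2} \<union> {t - 1}"
  proof
    fix i assume "i \<in> D H"
    then have "2 \<le> i" "i \<le> t" "i \<noteq> t" using D_bounds[OF tg] t by auto
    then show "i \<in> {2..t - 2} \<union> {t - 1}" by auto
  qed
  then have "card (D H) \<le> card (D H \<inter> {2..t - 2}) + 1"
    using card_Int_Diff_le[OF finite_D, of H "{2..t - 2}" "{t - 1}"] by simp
  then show ?thesis using full_pairs[OF tg t(1) full] t by (auto split: if_splits)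
qed

text \<open>\<open>nc_c'\<close> leaves only \<open>2 * a = t\<close>. Then \<open>t - 1\<close> is
  no leading degree either: \<open>nc_c_pred\<close> would give \<open>c (a - 1) a = 0\<close>, and
  with \<open>c a a = 0\<close> the recursion would give
  \<open>c (a - 1) (a + 1) = 0\<close>.\<close>

lemma full_nc:
  assumes nc: "nc t H a z" and full: "full t" and t: "5 \<le> t" shows "even t" "2 * card (D H) + 2 \<le> t"
proof -
  note tg = nc_tg[OF nc]
  have a: "2 * a = t"
    using fullD[OF full nc_a(1)[OF nc] nc_a_le[OF nc]] nc_c'[OF nc] by blast
  then show ev: "even t" by auto
  have a3: "3 \<le> a" using a t by simp
  have "t - 1 \<notin> D H"
  proof
    assume "t - 1 \<in> D H"
    then have 0: "c (t - 1 - a) a = 0" using nc_c_pred[OF nc] a a3 by simp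
    have e: "t - 1 - a = a - 1" "t - (a - 1) = a + 1" using a a3 by linarith+
    have "c (a - 1) a = c (a - 1 + 1) a + c (a - 1) (a + 1)"
      using a a3 tg_le[OF tg] by (intro c_rec) auto
    moreover have "c (a - 1 + 1) a = 0" using a a3 c_diag[of a] tg_le[OF tg] by simp
    moreover have "c (a - 1) (t - (a - 1)) \<noteq> 0"
      by (rule fullD[OF full]) (use a a3 in linarith)+
    ultimately show False using 0 unfolding e by linarith
  qed
  then have "D H \<subseteq> {2..t - 2}"
  proof -
    assume t1: "t - 1 \<notin> D H"
    show ?thesis
    proof
      fix i assume i: "i \<in> D H"
      then have "2 \<le> i" "i \<le> t" "i \<noteq> t" "i \<noteq> t - 1" using D_bounds[OF tg] nc_t[OF nc] t1 by auto
      then show "i \<in> {2..t - 2}" by auto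
    qed
  qed
  then have "D H \<inter> {2..t - 2} = D H" by blast
  then show "2 * card (D H) + 2 \<le> t"
    using full_pairs[OF tg nc_t(2)[OF nc] full] ev t by simp
qed

lemma full_strict: "full t \<Longrightarrow> 5 \<le> t \<Longrightarrow> nc_strict t"
  using full_nc(2) unfolding nc_strict_def by fastforce

text \<open>By \<open>HM\<close> the reflection of a tangential degree at most \<open>t - 2\<close>
  is not normal. If \<open>t - 1\<close> were not normal, all normal degrees would lie in
  \<open>{2..t - 2}\<close>, too few for the count in \<open>tg_card\<close>.\<close>

lemma full_top:
  assumes tg: "tg t H" and t: "t \<in> D H" "odd t" "5 \<le> t" and full: "full t" shows "t - 1 \<in> M t H"
proof (rule ccontr)
  assume t1: "t - 1 \<notin> M t H"
  let ?A = "D H \<inter> {2..t - 2}"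
  have tM: "t \<notin> M t H" using D_disjoint_top[OF tg] t by (auto simp: M_def)
  have D: "D H \<subseteq> {2..t - 2} \<union> {t}"
  proof
    fix i assume i: "i \<in> D H"
    then have "2 \<le> i" "i \<le> t" "i \<noteq> t - 1" using D_bounds[OF tg] consec[OF tg t(1)] t by auto
    then show "i \<in> {2..t - 2} \<union> {t}" by auto
  qed
  have "card (M t H) + card ?A \<le> card {2..t - 2}"
  proof (rule card_reflect_disjoint[where m = t])
    show "M t H \<subseteq> {2..t - 2}"
    proof
      fix i assume i: "i \<in> M t H"
      then have "2 \<le> i" "i \<le> t" "i \<noteq> t" "i \<noteq> t - 1" using tM t1 by (auto simp: M_def)
      then show "i \<in> {2..t - 2}" by auto
    qed
    fix i assume i: "i \<in> ?A"
    show "t - i \<notin> M t H"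
    proof
      assume "t - i \<in> M t H"
      then have "c (t - i) i = 0" using HM[OF tg t(1), of i "t - i"] i by (auto simp: M_def)
      moreover have e: "t - (t - i) = i" "2 \<le> t - i" "t - i + 2 \<le> t" using i t by auto
      moreover have "2 * (t - i) \<noteq> t" using t(2) by (metis dvd_triv_left)
      ultimately show False using fullD[OF full, of "t - i"] by simp
    qed
  qed auto
  moreover have "card (D H) \<le> card ?A + 1"
    using card_Int_Diff_le[OF finite_D D] by simp
  ultimately show False using tg_card[OF tg] t by simp
qed

text \<open>Only a tangential \<open>t\<close> needs care. Then \<open>t - 1\<close> is not
  tangential; if it is normal, two levels are removed at the cost of one dimension. Otherwise level
  \<open>t - 1\<close> does not split, which \<open>S\<close> controls: either strictness leaves a
  spare unit or \<open>full_top\<close> excludes the case.\<close>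

lemma bounded_step:
  assumes t: "4 \<le> t" and B1: "bounded (t - 1)" and B2: "bounded (t - 2)" and N: "nc_bounded t"
    and S: "nc_strict (t - 1) \<or> (odd t \<and> full t)"
  shows "bounded t"
  unfolding bounded_def
proof (intro allI impI)
  fix H assume tg: "tg t H"
  have t2: "2 \<le> t" "2 \<le> t - 1" using t by auto
  consider (h) "t \<in> D H" | (m) "t \<in> D (perp H)" | (n) "t \<notin> D H" "t \<notin> D (perp H)" by blast
  then show "2 * card (D H) \<le> t"
  proof cases
    case m
    obtain H1 where H1: "tg (t - 1) H1" "D H1 = D H - {t}" using descend_top_ex[OF tg t2(1)] m by blast
    then have "D H1 = D H" using D_disjoint_top[OF tg m] by blast
    then show ?thesis using B1 H1(1) t by (fastforce simp: bounded_def)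
  next
    case n
    then obtain a z where "nc t H a z" using nc_ex[OF tg _ n] t by auto
    then show ?thesis using N by (auto simp: nc_bounded_def)
  next
    case h
    obtain H1 where H1: "tg (t - 1) H1" "D H1 = D H - {t}" "M (t - 1) H1 = M t H - {t}"
      using descend_top_ex[OF tg t2(1)] h by blast
    have c1: "card (D H) = card (D H1) + 1" using card_Suc_Diff1[OF finite_D h] H1(2) by simp
    have t1: "t - 1 \<notin> D H1" using consec[OF tg h] H1 t by simp
    have Mt: "t - 1 \<in> D (perp H1) \<longleftrightarrow> t - 1 \<in> M t H"
    proof -
      have "t - 1 \<in> D (perp H1) \<longleftrightarrow> t - 1 \<in> M (t - 1) H1" using t2(2) by (simp add: M_def)
      also have "\<dots> \<longleftrightarrow> t - 1 \<in> M t H" unfolding H1(3) using t by auto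
      finally show ?thesis .
    qed
    show ?thesis
    proof (cases "t - 1 \<in> M t H")
      case True
      then have "t - 1 \<in> D (perp H1)" using Mt by simp
      then obtain H2 where H2: "tg (t - 1 - 1) H2" "D H2 = D H1 - {t - 1}"
        using descend_top_ex[OF H1(1) t2(2)] by blast
      have "tg (t - 2) H2" using H2(1) by (simp add: numeral_2_eq_2)
      moreover have "D H2 = D H1" using H2(2) t1 by blast
      ultimately have "2 * card (D H1) \<le> t - 2" using B2 unfolding bounded_def by metis
      then show ?thesis using c1 t by simp
    next
      case False
      have "5 \<le> t" if "odd t" using that t by presburger
      then have "nc_strict (t - 1)" using S full_top[OF tg h] False by blast
      moreover obtain a z where "nc (t - 1) H1 a z"
        using nc_ex[OF H1(1) _ t1] False Mt t2(2) by auto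
      ultimately have "2 * card (D H1) < t - 1" by (auto simp: nc_strict_def)
      then show ?thesis using c1 by simp
    qed
  qed
qed

text \<open>The other pairs yield at most \<open>(t - 5) / 2\<close> leading degrees, so
  \<open>big\<close> needs all of \<open>b\<close>, \<open>t - b\<close>, \<open>t - 1\<close>, and
  \<open>a\<close> is \<open>b\<close> or \<open>t - b\<close>. In both cases
  \<open>nc_c_pred\<close> and the recursion make an entry next to the zero pair vanish as well,
  unless that entry lies outside the range 2 to \<open>t - 2\<close> or belongs to the pair.\<close>

lemma single_pair:
  assumes nc: "nc t H a z" and t: "odd t" "5 \<le> t" and b: "2 \<le> b" "2 * b < t"
    and row: "\<And>i. 2 \<le> i \<Longrightarrow> i + 2 \<le> t \<Longrightarrow> i \<noteq> b \<Longrightarrow> i \<noteq> t - b \<Longrightarrow> c i (t - i) \<noteq> 0"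
    and big: "t \<le> 2 * card (D H)"
  shows "{b, t - b, t - 1} \<subseteq> D H \<and> (b = 2 \<and> a = t - 2 \<or> a = b \<and> t = 2 * b + 1)"
proof -
  note tg = nc_tg[OF nc]
  let ?W = "{2..t - 2} - {b, t - b}"
  let ?S = "D H \<inter> ?W"
  have "card ?S + card ?S \<le> card ?W"
  proof (rule card_reflect_disjoint[where m = t])
    show "(\<lambda>i. t - i) ` ?S \<subseteq> ?W" using b by auto
    fix i assume "i \<in> ?S"
    then show "t - i \<notin> ?S" using nc_HH[OF tg nc_t(2)[OF nc], of i] row[of i] by auto
  qed auto
  moreover have "card ?W = t - 5" using b t by (subst card_Diff_subset) auto
  ultimately have S: "2 * card ?S \<le> t - 5" by simp
  let ?C = "D H \<inter> {b, t - b, t - 1}"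
  have D: "D H \<subseteq> ?W \<union> ?C"
  proof
    fix i assume i: "i \<in> D H"
    then have "2 \<le> i" "i \<le> t" "i \<noteq> t" using D_bounds[OF tg] nc_t[OF nc] by auto
    then show "i \<in> ?W \<union> ?C" using i by auto
  qed
  have "card (D H) \<le> card ?S + card ?C" using card_Int_Diff_le[OF finite_D D] by simp
  then have C3: "3 \<le> card ?C" using S big t by presburger
  have sub: "{b, t - b, t - 1} \<subseteq> D H"
  proof (rule ccontr)
    assume "\<not> ?thesis"
    then have "?C \<subset> {b, t - b, t - 1}" by blast
    then have "card ?C < card {b, t - b, t - 1}" by (intro psubset_card_mono) auto
    also have "\<dots> \<le> 3" by (simp add: card_insert_if)
    finally show False using C3 by simp
  qed
  have "a = b \<or> a = t - b" using row[OF nc_a(1)[OF nc] nc_a_le[OF nc]] nc_c'[OF nc] by blast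
  moreover have "t = 2 * b + 1" if ab: "a = b"
  proof (rule ccontr)
    assume ne: "t \<noteq> 2 * b + 1"
    then have b3: "b + 3 \<le> t" using b t by presburger
    have "c (t - 1 - b) b = 0" using nc_c_pred[OF nc] sub ab b3 by simp
    then have "c b (t - 1 - b) = 0" using c_skew[of "t - 1 - b" b] b b3 tg_le[OF tg] by simp
    moreover have "c b (t - 1 - b) = c (b + 1) (t - 1 - b) + c b (t - 1 - b + 1)"
      using b b3 tg_le[OF tg] by (intro c_rec) auto
    moreover have "c b (t - 1 - b + 1) = 0" using nc_c'[OF nc] ab b3 by (simp add: Suc_diff_Suc)
    moreover have "c (b + 1) (t - (b + 1)) \<noteq> 0" using b b3 ne by (intro row) auto
    ultimately show False by simp
  qed
  moreover have "b = 2" if ab: "a = t - b"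
  proof (rule ccontr)
    assume "b \<noteq> 2"
    then have b3: "3 \<le> b" using b by simp
    have "c (t - 1 - a) a = 0" using nc_c_pred[OF nc] sub ab b3 b by simp
    then have "c (b - 1) (t - b) = 0" using ab b by (simp add: diff_diff_right)
    moreover have "c (b - 1) (t - b) = c (b - 1 + 1) (t - b) + c (b - 1) (t - b + 1)"
      using b b3 tg_le[OF tg] by (intro c_rec) auto
    moreover have "c b (t - b) = 0" using nc_c[OF nc] ab b by simp
    moreover have "c (b - 1) (t - (b - 1)) \<noteq> 0" using b b3 by (intro row) auto
    moreover have "t - (b - 1) = t - b + 1" using b by simp
    ultimately show False using b3 by simp
  qed
  ultimately show ?thesis using sub by blast
qed

end

section \<open>The first nonabelian degree\<close>

lemma neg_one_power_twice: "(-1::real) ^ i * ((-1) ^ i * x) = x"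
  by (simp flip: mult.assoc power_mult_distrib)

context graded_filiform
begin

lemma c_rec_row:
  assumes "2 \<le> i" "i + 2 \<le> t" "t < n" shows "c i (Suc t - i) = c i (t - i) - c (Suc i) (t - i)"
proof -
  have "c i (t - i) = c (i + 1) (t - i) + c i (t - i + 1)" using assms by (intro c_rec) auto
  then show ?thesis using assms by (simp add: Suc_diff_le)
qed

lemma fullI:
  assumes "t \<le> n" and r: "\<And>i. 2 \<le> i \<Longrightarrow> 2 * i < t \<Longrightarrow> c i (t - i) \<noteq> 0" shows "full t"
  unfolding full_def
proof (intro allI impI)
  fix i assume i: "2 \<le> i" "i + 2 \<le> t" "2 * i \<noteq> t"
  show "c i (t - i) \<noteq> 0"
  proof (cases "2 * i < t")
    case True then show ?thesis using r i by blast
  next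
    case False
    then have "2 \<le> t - i" "2 * (t - i) < t" "t - (t - i) = i" using i by auto
    then have "c (t - i) i \<noteq> 0" using r[of "t - i"] by simp
    then show ?thesis using c_skew[of i "t - i"] i assms(1) by simp
  qed
qed

end

locale graded_filiform_k = graded_filiform +
  fixes k :: nat
  assumes k5: "5 \<le> k" and kn: "k \<le> n"
    and low: "2 \<le> i \<Longrightarrow> 2 \<le> j \<Longrightarrow> i + j < k \<Longrightarrow> c i j = 0"
    and ck: "c 2 (k - 2) = 1"
begin

lemma row_k: assumes "2 \<le> i" "i + 2 \<le> k" shows "c i (k - i) = (-1) ^ i"
  using assms
proof (induction i rule: dec_induct)
  case base
  then show ?case using ck by simp
next
  case (step i)
  have "c i (Suc (k - 1) - i) = c i (k - 1 - i) - c (Suc i) (k - 1 - i)"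
    using step kn by (intro c_rec_row) auto
  moreover have "c i (k - 1 - i) = 0" using step by (intro low) auto
  ultimately show ?case using step by simp
qed

text \<open>Row \<open>k\<close> alternates in sign, while skew-symmetry reflects it with a minus
  sign.\<close>

lemma k_odd: "odd k"
proof
  assume "even k"
  have "c (k - 2) 2 = - c 2 (k - 2)" using k5 kn by (intro c_skew) auto
  moreover have "c (k - 2) (k - (k - 2)) = (-1) ^ (k - 2)" using k5 by (intro row_k) auto
  moreover have "k - (k - 2) = 2" "even (k - 2)" using k5 \<open>even k\<close> by auto
  ultimately show False using ck by simp
qed

lemma full_k: "full k"
  using row_k kn by (intro fullI) auto

text \<open>Freed of the alternating sign, row \<open>k + 1\<close> is an arithmetic progression;
  its zero is the middle entry \<open>m = (k + 1) / 2\<close>.\<close>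

lemma row_Suc_k:
  assumes n: "k < n" and i: "2 \<le> i" "i < k"
  shows "c i (Suc k - i) = (-1) ^ i * ((real k + 1) / 2 - real i)"
proof -
  define f where "f i = (-1) ^ i * c i (Suc k - i)" for i
  have rel: "f i = f (Suc i) + 1" if "2 \<le> i" "i + 2 \<le> k" for i
    using c_rec_row[OF that n] row_k[OF that]
    by (simp add: f_def right_diff_distrib neg_one_power_twice)
  have f: "f i = f 2 - (real i - 2)" if "2 \<le> i" "i < k" for i
    using that
  proof (induction i rule: dec_induct)
    case (step i)
    then have "f i = f (Suc i) + 1" by (intro rel) auto
    then show ?case using step by simp
  qed simp
  obtain m where m: "Suc k = 2 * m" using k_odd even_Suc[of k] by (blast elim: evenE)
  have "Suc k - m = m" using m by simp
  then have "f m = 0" using c_diag[of m] m n k5 by (simp add: f_def)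
  moreover have "f m = f 2 - (real m - 2)" using m k5 by (intro f) auto
  moreover have "real k + 1 = 2 * real m" using arg_cong[OF m, of real] by simp
  ultimately have "f i = (real k + 1) / 2 - real i" using f[OF i] by simp
  moreover have "c i (Suc k - i) = (-1) ^ i * f i" by (simp add: f_def neg_one_power_twice)
  ultimately show ?thesis by simp
qed

lemma full_Suc_k: assumes n: "k < n" shows "full (Suc k)"
proof (rule fullI)
  show "Suc k \<le> n" using n by simp
  fix i assume i: "2 \<le> i" "2 * i < Suc k"
  then have "c i (Suc k - i) = (-1) ^ i * ((real k + 1) / 2 - real i)" using n by (intro row_Suc_k) auto
  moreover have "2 * real i < real k + 1" using i by linarith
  ultimately show "c i (Suc k - i) \<noteq> 0" by simp
qed

text \<open>The Jacobi identity in degrees 2, 3, \<open>k - 3\<close>: two of its terms contain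
  constants below row \<open>k\<close>. For \<open>k = 5\<close> this fails because
  \<open>2 + 3 = k\<close>, and a parameter survives.\<close>

lemma c_2_k: assumes "7 \<le> k" "k + 2 \<le> n" shows "c 2 k = 0"
proof -
  have "c 3 (k - 3) * c 2 (3 + (k - 3)) + c (k - 3) 2 * c 3 (k - 3 + 2) + c 2 3 * c (k - 3) (2 + 3) = 0"
    using assms by (intro c_jac) auto
  moreover have "c (k - 3) 2 = 0" "c 2 3 = 0" using assms by (auto intro!: low)
  moreover have "c 3 (k - 3) = (-1) ^ 3" using assms by (intro row_k) auto
  moreover have "3 + (k - 3) = k" using assms by simp
  ultimately show ?thesis by simp
qed

text \<open>Summing the progression of \<open>row_Suc_k\<close> from \<open>c 2 k = 0\<close> on
  gives a quadratic polynomial; its roots 2 and \<open>k\<close> form the only zero pair of row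
  \<open>k + 2\<close>.\<close>

lemma row_Suc_Suc_k:
  assumes n: "Suc k < n" and 0: "c 2 k = 0" and i: "2 \<le> i" "i \<le> k"
  shows "c i (Suc (Suc k) - i) = (-1) ^ i * (- ((real i - 2) * (real k - real i) / 2))"
proof -
  define g where "g i = (-1) ^ i * c i (Suc (Suc k) - i)" for i
  have rel: "g i = g (Suc i) + ((real k + 1) / 2 - real i)" if "2 \<le> i" "i < k" for i
  proof -
    have "c i (Suc k - i) = (-1) ^ i * ((real k + 1) / 2 - real i)" using that n by (intro row_Suc_k) auto
    moreover have "c i (Suc (Suc k) - i) = c i (Suc k - i) - c (Suc i) (Suc k - i)"
      using that n by (intro c_rec_row) auto
    ultimately show ?thesis by (simp add: g_def right_diff_distrib neg_one_power_twice)
  qed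
  have "g i = - ((real i - 2) * (real k - real i) / 2)"
    using i
  proof (induction i rule: dec_induct)
    case base
    then show ?case using 0 by (simp add: g_def)
  next
    case (step i)
    then have "g i = g (Suc i) + ((real k + 1) / 2 - real i)" by (intro rel) auto
    then have "g (Suc i) = - ((real i - 2) * (real k - real i) / 2) - ((real k + 1) / 2 - real i)"
      using step by simp
    also have "\<dots> = - ((real (Suc i) - 2) * (real k - real (Suc i)) / 2)"
      by (simp add: field_simps)
    finally show ?case .
  qed
  moreover have "c i (Suc (Suc k) - i) = (-1) ^ i * g i" by (simp add: g_def neg_one_power_twice)
  ultimately show ?thesis by simp
qed

lemma row_Suc_Suc_k_nz:
  assumes n: "Suc k < n" and 0: "c 2 k = 0" and i: "3 \<le> i" "i < k"
  shows "c i (Suc (Suc k) - i) \<noteq> 0"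
proof -
  have "c i (Suc (Suc k) - i) = (-1) ^ i * (- ((real i - 2) * (real k - real i) / 2))"
    using i by (intro row_Suc_Suc_k[OF n 0]) auto
  moreover have "real i - 2 \<noteq> 0" "real k - real i \<noteq> 0" using i by auto
  ultimately show ?thesis by simp
qed

text \<open>The Jacobi identity in degrees 3, 4, \<open>k - 4\<close> gives
  \<open>c 3 k = 0\<close>, hence \<open>c 2 (k + 1) = 0\<close>. The entries of row
  \<open>k + 3\<close>, freed of the sign, then start at 0, never decrease and are positive from
  degree 4 on, although the middle entry must vanish.\<close>

lemma k_ge_9: assumes k: "9 \<le> k" shows "n \<le> k + 2"
proof (rule ccontr)
  assume "\<not> ?thesis"
  then have n: "Suc (Suc k) < n" by simp
  have 2: "c 2 k = 0" using c_2_k k n by simp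
  have "c 4 (k - 4) * c 3 (4 + (k - 4)) + c (k - 4) 3 * c 4 (k - 4 + 3) + c 3 4 * c (k - 4) (3 + 4) = 0"
    using k n by (intro c_jac) auto
  moreover have "c (k - 4) 3 = 0" "c 3 4 = 0" using k by (auto intro!: low)
  moreover have "c 4 (k - 4) = (-1) ^ 4" using k by (intro row_k) auto
  moreover have "4 + (k - 4) = k" using k by simp
  ultimately have "c 3 k = 0" by simp
  moreover have "c 2 k = c (2 + 1) k + c 2 (k + 1)" using k n by (intro c_rec) auto
  ultimately have 3: "c 2 (Suc k) = 0" using 2 by simp
  define h where "h i = (-1) ^ i * c i (Suc (Suc (Suc k)) - i)" for i
  have rel: "h (Suc i) = h i + (real i - 2) * (real k - real i) / 2" if "2 \<le> i" "i \<le> k" for i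
  proof -
    have "c i (Suc (Suc k) - i) = (-1) ^ i * (- ((real i - 2) * (real k - real i) / 2))"
      using that n 2 by (intro row_Suc_Suc_k) auto
    moreover have "c i (Suc (Suc (Suc k)) - i) = c i (Suc (Suc k) - i) - c (Suc i) (Suc (Suc k) - i)"
      using that n by (intro c_rec_row) auto
    ultimately show ?thesis by (simp add: h_def right_diff_distrib neg_one_power_twice)
  qed
  have "h 2 = 0" using 3 by (simp add: h_def)
  then have "h 3 = 0" using rel[of 2] k by (simp add: eval_nat_numeral)
  then have h4: "0 < h 4" using rel[of 3] k by (simp add: eval_nat_numeral)
  have pos: "0 < h i" if "4 \<le> i" "i \<le> k" for i
    using that
  proof (induction i rule: dec_induct)
    case base
    show ?case by (rule h4)
  next
    case (step i)
    then have "h (Suc i) = h i + (real i - 2) * (real k - real i) / 2" by (intro rel) auto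
    moreover have "0 \<le> (real i - 2) * (real k - real i)" using step by simp
    moreover have "0 < h i" using step by simp
    ultimately show ?case by linarith
  qed
  obtain m where m: "Suc k = 2 * m" using k_odd even_Suc[of k] by (blast elim: evenE)
  have "Suc (Suc (Suc k)) - Suc m = Suc m" using m by simp
  then have "h (Suc m) = 0" using c_diag[of "Suc m"] m n by (simp add: h_def)
  then show False using pos[of "Suc m"] m k by simp
qed

lemma k7_rows:
  assumes k: "k = 7" and n: "10 \<le> n"
  shows "c 4 6 = -3" "c 3 7 = 5" "c 2 8 = -5" "c 2 7 = 0" "c 3 6 = 2" "c 2 6 = 2" "c 2 3 = 0"
proof -
  have 2: "c 2 7 = 0" using c_2_k k n by simp
  have 3: "c 3 6 = 2" "c 4 5 = -3" using row_Suc_Suc_k[of 3] row_Suc_Suc_k[of 4] k n 2 by simp_all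
  have "c 4 5 = c 5 5 + c 4 6" "c 3 6 = c 4 6 + c 3 7" "c 2 7 = c 3 7 + c 2 8"
    using c_rec[of 4 5] c_rec[of 3 6] c_rec[of 2 7] n by simp_all
  moreover have "c 5 5 = 0" using c_diag n by simp
  ultimately show "c 4 6 = -3" "c 3 7 = 5" "c 2 8 = -5" using 2 3 by simp_all
  show "c 2 7 = 0" "c 3 6 = 2" by fact+
  show "c 2 6 = 2" using row_Suc_k[of 2] k n by simp
  show "c 2 3 = 0" using low[of 2 3] k by simp
qed

lemma k7_rows':
  assumes k: "k = 7" and n: "11 \<le> n"
  shows "c 2 9 = -5/2" "c 3 8 = -5/2" "c 4 7 = 15/2" "c 5 6 = -21/2"
proof -
  note r = k7_rows[OF k]
  have "c 4 6 = c 5 6 + c 4 7" "c 3 7 = c 4 7 + c 3 8" "c 2 8 = c 3 8 + c 2 9"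
    using c_rec[of 4 6] c_rec[of 3 7] c_rec[of 2 8] n by simp_all
  moreover have "c 3 6 * c 2 9 + c 6 2 * c 3 8 + c 2 3 * c 6 5 = 0" using c_jac[of 2 3 6] n by simp
  moreover have "c 6 2 = - c 2 6" using c_skew[of 2 6] n by simp
  ultimately show "c 2 9 = -5/2" "c 3 8 = -5/2" "c 4 7 = 15/2" "c 5 6 = -21/2" using r n by simp_all
qed

text \<open>In row 12 the Jacobi identity in degrees 2, 3, 7 forces \<open>c 2 10 = 0\<close>, but
  the recursion yields 18.\<close>

lemma k7_n: assumes k: "k = 7" shows "n \<le> 11"
proof (rule ccontr)
  assume "\<not> n \<le> 11"
  then have n: "12 \<le> n" by simp
  note r = k7_rows[OF k] k7_rows'[OF k]
  have "c 5 6 = c 6 6 + c 5 7" "c 4 7 = c 5 7 + c 4 8" "c 3 8 = c 4 8 + c 3 9" "c 2 9 = c 3 9 + c 2 10"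
    using c_rec[of 5 6] c_rec[of 4 7] c_rec[of 3 8] c_rec[of 2 9] n by simp_all
  moreover have "c 6 6 = 0" using c_diag n by simp
  moreover have "c 3 7 * c 2 10 + c 7 2 * c 3 9 + c 2 3 * c 7 5 = 0" using c_jac[of 2 3 7] n by simp
  moreover have "c 7 2 = - c 2 7" using c_skew[of 2 7] n by simp
  ultimately show False using r n by simp
qed

lemma less_half_cases:
  "2 \<le> i \<Longrightarrow> 2 * i < (6::nat) \<Longrightarrow> i = 2"
  "2 \<le> i \<Longrightarrow> 2 * i < (7::nat) \<Longrightarrow> i = 2 \<or> i = 3"
  "2 \<le> i \<Longrightarrow> 2 * i < (8::nat) \<Longrightarrow> i = 2 \<or> i = 3"
  "2 \<le> i \<Longrightarrow> 2 * i < (9::nat) \<Longrightarrow> i = 2 \<or> i = 3 \<or> i = 4"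
  "2 \<le> i \<Longrightarrow> 2 * i < (10::nat) \<Longrightarrow> i = 2 \<or> i = 3 \<or> i = 4"
  "2 \<le> i \<Longrightarrow> 2 * i < (11::nat) \<Longrightarrow> i = 2 \<or> i = 3 \<or> i = 4 \<or> i = 5"
  by arith+

lemma k7_full: assumes k: "k = 7" shows "10 \<le> n \<Longrightarrow> full 10" "11 \<le> n \<Longrightarrow> full 11"
proof -
  assume n: "10 \<le> n"
  show "full 10"
    by (rule fullI[OF n], drule (1) less_half_cases) (use k7_rows[OF k n] in auto)
next
  assume n: "11 \<le> n"
  show "full 11"
    by (rule fullI[OF n], drule (1) less_half_cases) (use k7_rows'[OF k n] in auto)
qed

end

section \<open>First nonabelian degree 5\<close>

locale graded_filiform_5 = graded_filiform_k br n X co c 5 for br :: "'a::real_vector \<Rightarrow> 'a \<Rightarrow> 'a" and n X co c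
begin

text \<open>The single free entries of the odd rows 7, 9 and 11; even rows follow from their
  predecessors.\<close>

abbreviation "s \<equiv> c 3 4"
abbreviation "q \<equiv> c 4 5"
abbreviation "u \<equiv> c 5 6"

lemma c23: "c 2 3 = 1"
  using ck by simp

lemma row6: "6 \<le> n \<Longrightarrow> c 2 4 = 1"
  using c_rec[of 2 3] c_diag[of 3] c23 by simp

lemma row7: "7 \<le> n \<Longrightarrow> c 2 5 = 1 - s"
  using c_rec[of 2 4] row6 by simp

lemma row8: "8 \<le> n \<Longrightarrow> c 3 5 = s" "8 \<le> n \<Longrightarrow> c 2 6 = 1 - 2 * s"
  using c_rec[of 3 4] c_rec[of 2 5] c_diag[of 4] row7 by simp_all

text \<open>Three distinct degrees at least 2 have sum at least 9, so here the first Jacobi identity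
  beyond the recursion appears (degrees 2, 3, 4); it ties \<open>q\<close> to
  \<open>s\<close>.\<close>

lemma row9:
  assumes "9 \<le> n" shows "c 3 6 = s - q" "c 2 7 = 1 - 3 * s + q" "q * (2 + s) = 3 * s\<^sup>2"
proof -
  show 1: "c 3 6 = s - q" using c_rec[of 3 5] row8 assms by simp
  show 2: "c 2 7 = 1 - 3 * s + q" using c_rec[of 2 6] row8 1 assms by simp
  have "c 3 4 * c 2 7 + c 4 2 * c 3 6 + c 2 3 * c 4 5 = 0" using c_jac[of 2 3 4] assms by simp
  moreover have "c 4 2 = - 1" using c_skew[of 2 4] row6 assms by simp
  ultimately show "q * (2 + s) = 3 * s\<^sup>2" using 1 2 c23 by (simp add: algebra_simps power2_eq_square)
qed

lemma row10:
  assumes "10 \<le> n" shows "c 4 6 = q" "c 3 7 = s - 2 * q" "c 2 8 = 1 - 4 * s + 3 * q"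
proof -
  show 1: "c 4 6 = q" using c_rec[of 4 5] c_diag[of 5] assms by simp
  show 2: "c 3 7 = s - 2 * q" using c_rec[of 3 6] row9 1 assms by simp
  show "c 2 8 = 1 - 4 * s + 3 * q" using c_rec[of 2 7] row9 2 assms by simp
qed

lemma row11:
  assumes "11 \<le> n"
  shows "c 4 7 = q - u" "c 3 8 = s - 3 * q + u" "c 2 9 = 1 - 5 * s + 6 * q - u"
    "(s - q) * c 2 9 - (1 - 2 * s) * c 3 8 - u = 0" "q * c 2 9 - (1 - s) * c 4 7 + u = 0"
proof -
  show 1: "c 4 7 = q - u" using c_rec[of 4 6] row10 assms by simp
  show 2: "c 3 8 = s - 3 * q + u" using c_rec[of 3 7] row10 1 assms by simp
  show 3: "c 2 9 = 1 - 5 * s + 6 * q - u" using c_rec[of 2 8] row10 2 assms by simp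
  have "c 3 6 * c 2 9 + c 6 2 * c 3 8 + c 2 3 * c 6 5 = 0" using c_jac[of 2 3 6] assms by simp
  moreover have "c 6 2 = - (1 - 2 * s)" "c 6 5 = - u"
    using c_skew[of 2 6] c_skew[of 5 6] row8 assms by simp_all
  ultimately show "(s - q) * c 2 9 - (1 - 2 * s) * c 3 8 - u = 0"
    using row9(1) c23 assms by (simp add: algebra_simps)
  have "c 4 5 * c 2 9 + c 5 2 * c 4 7 + c 2 4 * c 5 6 = 0" using c_jac[of 2 4 5] assms by simp
  moreover have "c 5 2 = - (1 - s)" using c_skew[of 2 5] row7 assms by simp
  ultimately show "q * c 2 9 - (1 - s) * c 4 7 + u = 0"
    using row6 assms by (simp add: algebra_simps)
qed

lemma row12:
  assumes "12 \<le> n" shows "(s - 2 * q) * (1 - 6 * s + 10 * q - 4 * u) - (1 - 3 * s + q) * (s - 4 * q + 3 * u) - u = 0"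
proof -
  have 1: "c 5 7 = u" using c_rec[of 5 6] c_diag[of 6] assms by simp
  have 2: "c 4 8 = q - 2 * u" using c_rec[of 4 7] row11 1 assms by simp
  have 3: "c 3 9 = s - 4 * q + 3 * u" using c_rec[of 3 8] row11 2 assms by simp
  have 4: "c 2 10 = 1 - 6 * s + 10 * q - 4 * u" using c_rec[of 2 9] row11 3 assms by simp
  have "c 3 7 * c 2 10 + c 7 2 * c 3 9 + c 2 3 * c 7 5 = 0" using c_jac[of 2 3 7] assms by simp
  moreover have "c 7 2 = - (1 - 3 * s + q)" "c 7 5 = - u"
    using c_skew[of 2 7] c_skew[of 5 7] row9 1 assms by simp_all
  ultimately show ?thesis using row10 c23 3 4 assms by (simp add: algebra_simps)
qed

lemma s_neq: "9 \<le> n \<Longrightarrow> s \<noteq> -2"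
  using row9(3) by auto

text \<open>The Jacobi relation in degrees 2, 4, 5 is multiplied by \<open>(2 + s)^2\<close>, after
  which \<open>q\<close> enters only through \<open>q * (2 + s)\<close> and is eliminated by
  \<open>row9\<close>.\<close>

lemma u_eq:
  assumes "11 \<le> n" shows "2 * u * (s + 2) * (s\<^sup>2 - 1) = s ^ 3 * (21 * s - 12)"
proof -
  have E1: "(s - q) * (1 - 5 * s + 6 * q - u) - (1 - 2 * s) * (s - 3 * q + u) - u = 0"
    and E2: "q * (1 - 5 * s + 6 * q - u) - (1 - s) * (q - u) + u = 0" and Q: "q * (2 + s) = 3 * s\<^sup>2"
    using row11[OF assms] row9 assms by simp_all
  have "(2 + s) * (2 + s) * ((q * (1 - 5 * s + 6 * q - u) - (1 - s) * (q - u) + u)) = 0" using E2 by simp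
  then have "(q * (2 + s)) * ((1 - 5 * s) * (2 + s) + 6 * (q * (2 + s)) - u * (2 + s)) - (1 - s) * ((q * (2 + s)) * (2 + s) - u * (2 + s) * (2 + s))
     + u * (2 + s) * (2 + s) = 0"
    by (simp add: algebra_simps)
  then have "3 * s\<^sup>2 * ((1 - 5 * s) * (2 + s) + 18 * s\<^sup>2 - u * (2 + s)) - (1 - s) * (3 * s\<^sup>2 * (2 + s) - u * (2 + s) * (2 + s))
     + u * (2 + s) * (2 + s) = 0"
    unfolding Q by simp
  then have "(2 + s) * 0 = 0 \<and> u * (2 + s) * ((2 - s) * (2 + s) - 3 * s\<^sup>2) = - 3 * s\<^sup>2 * ((1 - 5 * s) * (2 + s) + 18 * s\<^sup>2 - (1 - s) * (2 + s))"
    by (simp add: algebra_simps power2_eq_square)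
  then show ?thesis by (simp add: algebra_simps power2_eq_square power3_eq_cube)
qed

text \<open>Row 12 brings no new parameter, so its Jacobi relation is a condition on
  \<open>s\<close>: eliminating \<open>q\<close> and then \<open>u\<close> leaves
  \<open>9 * s ^ 5 * (10 * s - 1) = 0\<close>.\<close>

lemma s_cases: assumes n: "12 \<le> n" shows "s = 0 \<or> s = 1 / 10"
proof -
  have Q: "q * (2 + s) = 3 * s\<^sup>2" and U: "2 * u * (s + 2) * (s\<^sup>2 - 1) = s ^ 3 * (21 * s - 12)"
    using row9 u_eq n by simp_all
  have "u * (5 * s + 5 * q - 4) = 3 * s\<^sup>2 - 9 * s * q - 2 * q + 16 * q\<^sup>2"
    using row12[OF n] by (simp add: algebra_simps power2_eq_square)
  also have "\<dots> = 8 * q * (2 * q - s)"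
    unfolding Q[symmetric] by (simp add: algebra_simps power2_eq_square)
  finally have "(2 + s) * (2 + s) * (u * (5 * s + 5 * q - 4)) = (2 + s) * (2 + s) * (8 * q * (2 * q - s))"
    by (rule arg_cong)
  moreover have "(2 + s) * (2 + s) * (u * (5 * s + 5 * q - 4)) = u * (2 + s) * (5 * s * (2 + s) + 5 * (q * (2 + s)) - 4 * (2 + s))"
    by (simp add: algebra_simps)
  moreover have "(2 + s) * (2 + s) * (8 * q * (2 * q - s)) = 8 * (q * (2 + s)) * (2 * (q * (2 + s)) - s * (2 + s))"
    by (simp add: algebra_simps)
  ultimately have "u * (2 + s) * (5 * s * (2 + s) + 15 * s\<^sup>2 - 4 * (2 + s)) = 24 * s\<^sup>2 * (6 * s\<^sup>2 - s * (2 + s))"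
    unfolding Q by simp
  then have W: "u * (s + 2) * (10 * s\<^sup>2 + 3 * s - 4) = 12 * s ^ 3 * (5 * s - 2)"
    by (simp add: algebra_simps power2_eq_square power3_eq_cube)
  have "s ^ 3 * (21 * s - 12) * (10 * s\<^sup>2 + 3 * s - 4) = 2 * (s\<^sup>2 - 1) * (u * (s + 2) * (10 * s\<^sup>2 + 3 * s - 4))"
    unfolding U[symmetric] by (simp add: algebra_simps)
  also have "\<dots> = 24 * s ^ 3 * (5 * s - 2) * (s\<^sup>2 - 1)" unfolding W by (simp add: algebra_simps)
  finally have "9 * s ^ 5 * (10 * s - 1) = 0" by (simp add: algebra_simps eval_nat_numeral)
  then show ?thesis by auto
qed

text \<open>This is the algebra with \<open>[X_2, X_i] = X_{i+2}\<close>. When the preceding row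
  vanishes in degrees at least 3, a single zero spreads along the whole row. It is the diagonal
  entry in even degree, \<open>s\<close> in degree 7, and in other odd degrees it comes from
  comparing the recursion, which makes two middle entries opposite, with the Jacobi identity in
  degrees 2, \<open>m - 1\<close>, \<open>m\<close>, which makes them equal.\<close>

lemma m2_rows:
  assumes s0: "7 \<le> n \<Longrightarrow> s = 0"
  shows "(\<forall>i j. 3 \<le> i \<longrightarrow> 3 \<le> j \<longrightarrow> i + j \<le> n \<longrightarrow> c i j = 0) \<and> (\<forall>j. 3 \<le> j \<longrightarrow> j + 2 \<le> n \<longrightarrow> c 2 j = 1)"
proof -
  have "(\<forall>i. 3 \<le> i \<longrightarrow> i + 3 \<le> t \<longrightarrow> c i (t - i) = 0) \<and> (5 \<le> t \<longrightarrow> c 2 (t - 2) = 1)" if "t \<le> n" for t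
    using that
  proof (induction t rule: less_induct)
    case (less t)
    have zero: "c i j = 0" if "3 \<le> i" "3 \<le> j" "i + j < t" for i j
      using less.IH[of "i + j"] less.prems that by (force dest: spec[of _ i])
    have one: "c 2 j = 1" if "3 \<le> j" "j + 2 < t" for j
      using less.IH[of "2 + j"] less.prems that by simp
    have mid: "\<exists>m. 3 \<le> m \<and> m + 3 \<le> t \<and> c m (t - m) = 0" if t: "6 \<le> t"
    proof (cases "even t")
      case True
      then obtain m where m: "t = 2 * m" by (elim evenE)
      then have "c m (t - m) = 0" using c_diag[of m] t less.prems by simp
      then show ?thesis using m t by (intro exI[of _ m]) auto
    next
      case False
      then obtain m where m: "t = 2 * m + 1" by (elim oddE)
      show ?thesis
      proof (cases "t = 7")
        case True
        then show ?thesis using s0 less.prems by (intro exI[of _ 3]) simp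
      next
        case False
        then have m4: "4 \<le> m" using m t by simp
        have e: "t - m = m + 1" "m - 1 + 1 = m" "m - 1 + (m + 1) = 2 * m" using m m4 by simp_all
        have "c (m - 1) m * c 2 (m - 1 + m) + c m 2 * c (m - 1) (m + 2) + c 2 (m - 1) * c m (2 + (m - 1)) = 0"
          using m m4 less.prems by (intro c_jac) auto
        moreover have "c (m - 1) m = 0" using m m4 by (intro zero) auto
        moreover have "c 2 (m - 1) = 1" "c 2 m = 1" using m m4 by (auto intro!: one)
        moreover have "c m 2 = - c 2 m" using m m4 less.prems by (intro c_skew) auto
        moreover have "2 + (m - 1) = m + 1" using m4 by simp
        ultimately have 1: "c m (m + 1) = c (m - 1) (m + 2)" by simp
        have "c (m - 1) (m + 1) = c (m - 1 + 1) (m + 1) + c (m - 1) (m + 1 + 1)"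
          using m m4 less.prems by (intro c_rec) auto
        moreover have "c (m - 1) (m + 1) = 0" using m m4 by (intro zero) auto
        ultimately have "c m (m + 1) + c (m - 1) (m + 2) = 0" unfolding e(2) by simp
        then have "c m (t - m) = 0" using 1 by (simp add: e)
        then show ?thesis using m m4 by (intro exI[of _ m]) auto
      qed
    qed
    have rows: "c i (t - i) = 0" if i: "3 \<le> i" "i + 3 \<le> t" for i
    proof -
      have t6: "6 \<le> t" using i by simp
      obtain m where m: "3 \<le> m" "m + 3 \<le> t" "c m (t - m) = 0" using mid[OF t6] by blast
      have st: "c j (t - j) = 0 \<longleftrightarrow> c (Suc j) (t - Suc j) = 0" if j: "3 \<le> j" "j + 4 \<le> t" for j
      proof -
        have "c j (Suc (t - 1) - j) = c j (t - 1 - j) - c (Suc j) (t - 1 - j)"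
          using j less.prems by (intro c_rec_row) auto
        moreover have "c j (t - 1 - j) = 0" using j by (intro zero) auto
        ultimately show ?thesis using j by simp
      qed
      have "c j (t - j) = 0 \<longleftrightarrow> c 3 (t - 3) = 0" if "3 \<le> j" "j + 3 \<le> t" for j
        using that
      proof (induction j rule: dec_induct)
        case (step j)
        then show ?case using st[of j] by simp
      qed simp
      then show ?thesis using m i by blast
    qed
    have "c 2 (t - 2) = 1" if t: "5 \<le> t"
    proof (cases "t = 5 \<or> t = 6")
      case True
      then show ?thesis using c23 row6 less.prems by auto
    next
      case False
      then have "c 2 (Suc (t - 1) - 2) = c 2 (t - 1 - 2) - c (Suc 2) (t - 1 - 2)"
        using t less.prems by (intro c_rec_row) auto
      moreover have "c 2 (t - 1 - 2) = 1" using False t by (intro one) auto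
      moreover have "c 3 (t - 3) = 0" using False t by (intro rows) auto
      ultimately show ?thesis using t by (simp add: eval_nat_numeral)
    qed
    then show ?case using rows by blast
  qed
  note * = this
  have "c i j = 0" if "3 \<le> i" "3 \<le> j" "i + j \<le> n" for i j
    using *[of "i + j"] that by (force dest: spec[of _ i])
  moreover have "c 2 j = 1" if "3 \<le> j" "j + 2 \<le> n" for j
    using *[of "2 + j"] that by simp
  ultimately show ?thesis by blast
qed

end

text \<open>In the Witt algebra with \<open>[e_i, e_j] = (j - i) e_{i+j}\<close> put
  \<open>X_1 = e_1\<close> and \<open>X_i = 6 (i - 2)! e_i\<close> for \<open>i \<ge> 2\<close>;
  then \<open>ad X_1\<close> is a shift. The factor 6 gives \<open>witt 2 3 = 1\<close>, and
  \<open>witt 3 4 = 1/10\<close>.\<close>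

definition witt :: "nat \<Rightarrow> nat \<Rightarrow> real" where
  "witt i j = 6 * (real j - real i) * fact (i - 2) * fact (j - 2) / fact (i + j - 2)"

lemma witt_plus: "witt (a + 2) (b + 2) = 6 * (real b - real a) * fact a * fact b / fact (a + b + 2)"
  by (simp add: witt_def)

lemma witt_rec:
  assumes "2 \<le> i" "2 \<le> j" shows "witt i j = witt (Suc i) j + witt i (Suc j)"
proof -
  obtain a b where ab: "i = a + 2" "j = b + 2" using assms by (metis add.commute le_Suc_ex)
  define f :: real where "f = fact (a + b + 2)"
  have f: "f \<noteq> 0" by (simp add: f_def)
  have f': "fact (a + b + 3) = (real a + real b + 3) * f"
    by (simp add: f_def eval_nat_numeral algebra_simps)
  have 1: "witt i j = 6 * (real b - real a) * fact a * fact b / f"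
    using witt_plus[of a b] by (simp add: ab f_def)
  have 2: "witt (Suc i) j = 6 * (real b - real a - 1) * ((real a + 1) * fact a) * fact b / ((real a + real b + 3) * f)"
    using witt_plus[of "Suc a" b] f' by (simp add: ab eval_nat_numeral algebra_simps)
  have 3: "witt i (Suc j) = 6 * (real b + 1 - real a) * fact a * ((real b + 1) * fact b) / ((real a + real b + 3) * f)"
    using witt_plus[of a "Suc b"] f' by (simp add: ab eval_nat_numeral algebra_simps)
  have g: "real a + real b + 3 \<noteq> 0" by (simp add: add_nonneg_eq_0_iff)
  define A B :: real where "A = real a" and "B = real b"
  have "6 * (B - A) * x * y / f = 6 * (B - A - 1) * ((A + 1) * x) * y / ((A + B + 3) * f)
      + 6 * (B + 1 - A) * x * ((B + 1) * y) / ((A + B + 3) * f)" for x y :: real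
  proof -
    have "A + B + 3 \<noteq> 0" using g by (simp add: A_def B_def)
    then show ?thesis using f by (simp add: divide_simps) (simp add: algebra_simps)
  qed
  then show ?thesis unfolding 1 2 3 A_def B_def .
qed

lemma witt_pos: "i < j \<Longrightarrow> 0 < witt i j"
  by (simp add: witt_def)

lemma witt_jac:
  assumes "2 \<le> m"
  shows "witt 3 m * witt 2 (m + 3) - witt 2 m * witt 3 (m + 2) - witt 5 m = 0"
proof -
  obtain a where a: "m = a + 2" using assms by (metis add.commute le_Suc_ex)
  define A x :: real where "A = real a" and "x = fact a"
  have x: "x \<noteq> 0" by (simp add: x_def)
  have A: "A + 1 \<noteq> 0" "A + 2 \<noteq> 0" "A + 3 \<noteq> 0" "A + 4 \<noteq> 0" "A + 5 \<noteq> 0" by (simp_all add: A_def add_nonneg_eq_0_iff)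
  have f: "fact a = x" "fact (a + 2) = (A + 2) * (A + 1) * x" "fact (a + 3) = (A + 3) * (A + 2) * (A + 1) * x"
    "fact (a + 5) = (A + 5) * (A + 4) * (A + 3) * (A + 2) * (A + 1) * x"
    by (simp_all add: A_def x_def eval_nat_numeral algebra_simps)
  have e: "m - 2 = a" "3 + m - 2 = a + 3" "2 + (m + 3) - 2 = a + 5" "m + 3 - 2 = a + 3" "2 + m - 2 = a + 2"
    "3 + (m + 2) - 2 = a + 5" "m + 2 - 2 = a + 2" "5 + m - 2 = a + 5" and rm: "real m = A + 2"
    by (simp_all add: a A_def)
  have 1: "witt 3 m = 6 * (A - 1) * x / ((A + 3) * (A + 2) * (A + 1) * x)"
    unfolding witt_def e f rm by simp
  have 2: "witt 2 (m + 3) = 6 * (A + 3) * ((A + 3) * (A + 2) * (A + 1) * x) / ((A + 5) * (A + 4) * (A + 3) * (A + 2) * (A + 1) * x)"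
    unfolding witt_def e f of_nat_add rm by simp
  have 3: "witt 2 m = 6 * A * x / ((A + 2) * (A + 1) * x)"
    unfolding witt_def e f rm by simp
  have 4: "witt 3 (m + 2) = 6 * (A + 1) * ((A + 2) * (A + 1) * x) / ((A + 5) * (A + 4) * (A + 3) * (A + 2) * (A + 1) * x)"
    unfolding witt_def e f of_nat_add rm by simp
  have 5: "witt 5 m = 6 * (A - 3) * 6 * x / ((A + 5) * (A + 4) * (A + 3) * (A + 2) * (A + 1) * x)"
    unfolding witt_def e f rm by (simp add: fact_numeral)
  show ?thesis unfolding 1 2 3 4 5 using A x
    by (simp add: divide_simps) (simp add: algebra_simps)
qed

section \<open>Zero entries of the rows 7 to 11 and the Witt algebra\<close>

context graded_filiform_5
begin

text \<open>Multiplied by the nonzero \<open>2 + s\<close>, every entry becomes a polynomial in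
  \<open>s\<close> whose roots can be read off.\<close>

lemma nonzero_rows:
  assumes s0: "s \<noteq> 0"
  shows "9 \<le> n \<Longrightarrow> q \<noteq> 0" "9 \<le> n \<Longrightarrow> c 3 6 = 0 \<longleftrightarrow> s = 1" "9 \<le> n \<Longrightarrow> c 2 7 = 0 \<longleftrightarrow> s = 2 / 5"
    "10 \<le> n \<Longrightarrow> c 3 7 = 0 \<longleftrightarrow> s = 2 / 5" "10 \<le> n \<Longrightarrow> c 2 8 = 0 \<longleftrightarrow> s = 1 \<or> s = 2 / 5"
proof -
  have *: "x = 0 \<longleftrightarrow> x * (2 + s) = 0" if "9 \<le> n" for x using s_neq[OF that] by (auto simp: add_eq_0_iff)
  assume n: "9 \<le> n"
  have Q: "q * (2 + s) = 3 * s\<^sup>2" using row9 n by simp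
  show "q \<noteq> 0" using Q s0 by auto
  have "c 3 6 * (2 + s) = s * (2 + s) - q * (2 + s)" unfolding row9(1)[OF n] by (simp add: algebra_simps)
  also have "\<dots> = 2 * s * (1 - s)" unfolding Q by (simp add: algebra_simps power2_eq_square)
  finally show "c 3 6 = 0 \<longleftrightarrow> s = 1" using *[OF n, of "c 3 6"] s0 by simp
  have "c 2 7 * (2 + s) = (1 - 3 * s) * (2 + s) + q * (2 + s)" unfolding row9(2)[OF n] by (simp add: algebra_simps)
  also have "\<dots> = 2 - 5 * s" unfolding Q by (simp add: algebra_simps power2_eq_square)
  finally show "c 2 7 = 0 \<longleftrightarrow> s = 2 / 5" using *[OF n, of "c 2 7"] by auto
next
  have *: "x = 0 \<longleftrightarrow> x * (2 + s) = 0" if "9 \<le> n" for x using s_neq[OF that] by (auto simp: add_eq_0_iff)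
  assume n: "10 \<le> n"
  have Q: "q * (2 + s) = 3 * s\<^sup>2" using row9 n by simp
  have "c 3 7 * (2 + s) = s * (2 + s) - 2 * (q * (2 + s))" unfolding row10(2)[OF n] by (simp add: algebra_simps)
  also have "\<dots> = s * (2 - 5 * s)" unfolding Q by (simp add: algebra_simps power2_eq_square)
  finally show "c 3 7 = 0 \<longleftrightarrow> s = 2 / 5" using *[of "c 3 7"] n s0 by auto
  have "c 2 8 * (2 + s) = (1 - 4 * s) * (2 + s) + 3 * (q * (2 + s))" unfolding row10(3)[OF n] by (simp add: algebra_simps)
  also have "\<dots> = (1 - s) * (2 - 5 * s)" unfolding Q by (simp add: algebra_simps power2_eq_square)
  finally show "c 2 8 = 0 \<longleftrightarrow> s = 1 \<or> s = 2 / 5" using *[of "c 2 8"] n by auto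
qed

lemma full7: "7 \<le> n \<Longrightarrow> s \<noteq> 0 \<Longrightarrow> s \<noteq> 1 \<Longrightarrow> full 7"
  by (rule fullI, simp, drule (1) less_half_cases) (use row7 in auto)

lemma full8: "8 \<le> n \<Longrightarrow> s \<noteq> 0 \<Longrightarrow> s \<noteq> 1 / 2 \<Longrightarrow> full 8"
  by (rule fullI, simp, drule (1) less_half_cases) (use row8 in auto)

lemma full9: "9 \<le> n \<Longrightarrow> s \<noteq> 0 \<Longrightarrow> s \<noteq> 1 \<Longrightarrow> s \<noteq> 2 / 5 \<Longrightarrow> full 9"
  by (rule fullI, simp, drule (1) less_half_cases) (use nonzero_rows in auto)

lemma full10: "10 \<le> n \<Longrightarrow> s \<noteq> 0 \<Longrightarrow> s \<noteq> 1 \<Longrightarrow> s \<noteq> 2 / 5 \<Longrightarrow> full 10"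
  by (rule fullI, simp, drule (1) less_half_cases) (use nonzero_rows row10(1) in auto)

text \<open>At \<open>s = 1\<close> the equation \<open>u_eq\<close> would read 0 = 9.\<close>

lemma s_neq_1: "11 \<le> n \<Longrightarrow> s \<noteq> 1"
  using u_eq by auto

text \<open>Together these say that row 11 has at most one zero pair, as \<open>single_pair\<close>
  requires.\<close>

lemma row11_nz:
  assumes n: "11 \<le> n" and s0: "s \<noteq> 0"
  shows "c 4 7 \<noteq> 0" "\<not> (c 2 9 = 0 \<and> c 3 8 = 0 \<and> s \<noteq> 2 / 5)" "\<not> (c 2 9 = 0 \<and> u = 0)" "\<not> (c 3 8 = 0 \<and> u = 0)"
    "s = 2 / 5 \<Longrightarrow> full 11" "u = 0 \<Longrightarrow> s = 4 / 7"
proof -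
  note r = row11[OF n]
  have q0: "q \<noteq> 0" using nonzero_rows(1) n s0 by simp
  have s1: "s \<noteq> 1" by (rule s_neq_1[OF n])
  have Q: "q * (2 + s) = 3 * s\<^sup>2" using row9 n by simp
  have U: "2 * u * (s + 2) * (s\<^sup>2 - 1) = s ^ 3 * (21 * s - 12)" by (rule u_eq[OF n])
  show "c 4 7 \<noteq> 0"
  proof
    assume "c 4 7 = 0"
    then have "q * c 2 9 + q = 0" "u = q" using r(1,5) by simp_all
    then have "q * (c 2 9 + 1) = 0" by (simp add: algebra_simps)
    then have "c 2 9 = -1" using q0 by simp
    then have "2 - 5 * s + 5 * q = 0" using r(3) \<open>u = q\<close> by simp
    then have "(2 - 5 * s) * (2 + s) + 5 * (q * (2 + s)) = 0" by (metis (no_types, lifting) distrib_right mult.assoc mult_zero_left)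
    then have "10 * (s - 2/5)\<^sup>2 + 12/5 = 0" unfolding Q by (simp add: power2_eq_square algebra_simps)
    moreover have "0 \<le> 10 * (s - 2/5)\<^sup>2" by simp
    ultimately show False by linarith
  qed
  show "\<not> (c 2 9 = 0 \<and> c 3 8 = 0 \<and> s \<noteq> 2 / 5)"
  proof
    assume a: "c 2 9 = 0 \<and> c 3 8 = 0 \<and> s \<noteq> 2 / 5"
    have "c 2 8 = c 3 8 + c 2 9" using c_rec[of 2 8] n by simp
    then show False using a nonzero_rows(5) s0 s1 n by simp
  qed
  show *: "\<not> (c 2 9 = 0 \<and> u = 0)" using r(1,5) q0 s1 by auto
  show "\<not> (c 3 8 = 0 \<and> u = 0)"
  proof
    assume a: "c 3 8 = 0 \<and> u = 0"
    then have "(s - q) * c 2 9 = 0" using r(4) by simp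
    moreover have "s - q \<noteq> 0" using nonzero_rows(2) row9(1) s0 s1 n by auto
    ultimately show False using * a by simp
  qed
  show "s = 4 / 7" if "u = 0" using U that s0 by auto
  assume s25: "s = 2 / 5"
  have q': "q = 1 / 5" using Q unfolding s25 by (simp add: power2_eq_square)
  have u': "u = 2 / 35" using U unfolding s25 by (simp add: power2_eq_square power3_eq_cube)
  show "full 11"
    by (rule fullI[OF n], drule (1) less_half_cases) (use r(1-3) s25 q' u' in auto)
qed

text \<open>The deviation \<open>d\<close> from the Witt constants alternates along a row once the
  preceding row agrees, so one zero suffices. Even rows have the diagonal, rows 5 and 7 the
  normalisation and \<open>s\<close>, and in later odd rows the Jacobi identities in degrees 2, 3,
  \<open>t - 5\<close> of both families, subtracted, leave \<open>d 2\<close> times a positive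
  factor.\<close>

lemma c_witt:
  assumes s: "s = 1 / 10" and ij: "2 \<le> i" "2 \<le> j" "i + j \<le> n" shows "c i j = witt i j"
proof -
  have "\<forall>i. 2 \<le> i \<longrightarrow> i + 2 \<le> t \<longrightarrow> c i (t - i) = witt i (t - i)" if "t \<le> n" for t
    using that
  proof (induction t rule: less_induct)
    case (less t)
    have IH: "c i j = witt i j" if "2 \<le> i" "2 \<le> j" "i + j < t" for i j
      using less.IH[of "i + j"] less.prems that by (force dest: spec[of _ i])
    define d where "d i = c i (t - i) - witt i (t - i)" for i
    have alt: "d (Suc i) = - d i" if i: "2 \<le> i" "i + 3 \<le> t" for i
    proof -
      have "c i (Suc (t - 1) - i) = c i (t - 1 - i) - c (Suc i) (t - 1 - i)"
        using i less.prems by (intro c_rec_row) auto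
      moreover have "c i (t - 1 - i) = witt i (t - 1 - i)" using i by (intro IH) auto
      moreover have "witt i (t - 1 - i) = witt (Suc i) (t - 1 - i) + witt i (Suc (t - 1 - i))"
        using i by (intro witt_rec) auto
      moreover have "Suc (t - 1) - i = t - i" "t - 1 - i = t - Suc i" "Suc (t - 1 - i) = t - i" using i by auto
      ultimately show ?thesis by (simp add: d_def)
    qed
    have all: "d i = 0 \<longleftrightarrow> d 2 = 0" if "2 \<le> i" "i + 2 \<le> t" for i
      using that
    proof (induction i rule: dec_induct)
      case (step i)
      then show ?case using alt[of i] by simp
    qed simp
    have "d 2 = 0" if t: "4 \<le> t"
    proof (cases "even t")
      case True
      then obtain m where m: "t = 2 * m" by (elim evenE)
      then have "d m = 0" using c_diag[of m] t less.prems by (simp add: d_def witt_def)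
      then show ?thesis using all[of m] m t by simp
    next
      case False
      then have "t = 5 \<or> t = 7 \<or> 9 \<le> t" using t by presburger
      then consider "t = 5" | "t = 7" | "9 \<le> t" by blast
      then show ?thesis
      proof cases
        case 1
        then show ?thesis using c23 by (simp add: d_def witt_def eval_nat_numeral)
      next
        case 2
        then have "d 3 = 0" using s by (simp add: d_def witt_def eval_nat_numeral)
        then show ?thesis using all[of 3] 2 by simp
      next
        case 3
        define m where "m = t - 5"
        have m: "t = m + 5" "4 \<le> m" using 3 by (simp_all add: m_def)
        have "c 3 m * c 2 (3 + m) + c m 2 * c 3 (m + 2) + c 2 3 * c m (2 + 3) = 0"
          using m less.prems by (intro c_jac) auto
        moreover have "c m 2 = - c 2 m" "c m (2 + 3) = - c 5 m" using m less.prems c_skew[of 2 m] c_skew[of 5 m] by simp_all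
        moreover have "c 3 m = witt 3 m" "c 2 m = witt 2 m" using m by (auto intro!: IH)
        ultimately have "witt 3 m * c 2 (m + 3) - witt 2 m * c 3 (m + 2) - c 5 m = 0"
          using c23 by (simp add: add.commute)
        moreover have "c 2 (m + 3) = d 2 + witt 2 (m + 3)" "c 3 (m + 2) = d 3 + witt 3 (m + 2)" "c 5 m = d 5 + witt 5 m"
        proof -
          have "t - 2 = m + 3" "t - 3 = m + 2" "t - 5 = m" by (simp_all add: m(1))
          then show "c 2 (m + 3) = d 2 + witt 2 (m + 3)" "c 3 (m + 2) = d 3 + witt 3 (m + 2)" "c 5 m = d 5 + witt 5 m"
            unfolding d_def by simp_all
        qed
        moreover have "d 3 = - d 2" "d 4 = - d 3" "d 5 = - d 4"
          using alt[of 2] alt[of 3] alt[of 4] m by (simp_all add: eval_nat_numeral)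
        ultimately have "witt 3 m * (d 2 + witt 2 (m + 3)) - witt 2 m * (- d 2 + witt 3 (m + 2)) - (- d 2 + witt 5 m) = 0"
          by simp
        moreover have "witt 3 m * (d 2 + witt 2 (m + 3)) - witt 2 m * (- d 2 + witt 3 (m + 2)) - (- d 2 + witt 5 m)
            = d 2 * (witt 3 m + witt 2 m + 1) + (witt 3 m * witt 2 (m + 3) - witt 2 m * witt 3 (m + 2) - witt 5 m)"
          by (simp add: algebra_simps)
        ultimately have "d 2 * (witt 3 m + witt 2 m + 1) = 0"
          using witt_jac[of m] m by linarith
        moreover have "0 < witt 3 m" "0 < witt 2 m" using m by (auto intro!: witt_pos)
        ultimately show ?thesis by (simp add: add_eq_0_iff)
      qed
    qed
    then show ?case using all by (auto simp: d_def)
  qed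
  from this[of "i + j"] show ?thesis using ij by (force dest: spec[of _ i])
qed

lemma full_witt: assumes "s = 1 / 10" "t \<le> n" shows "full t"
proof (rule fullI[OF assms(2)])
  fix i assume i: "2 \<le> i" "2 * i < t"
  then have "c i (t - i) = witt i (t - i)" using assms by (intro c_witt) auto
  moreover have "0 < witt i (t - i)" using i by (intro witt_pos) auto
  ultimately show "c i (t - i) \<noteq> 0" by simp
qed

end

section \<open>Splitting off a tangential plane in the three top degrees\<close>

context graded_filiform_ip
begin

text \<open>\<open>z\<close>, a tangential vector of degree \<open>t - 1\<close> and
  \<open>X t\<close> span \<open>F (t - 2)\<close> modulo \<open>F (t + 1)\<close>; the combination
  is regrouped into a tangential vector and a multiple of the normal vector
  \<open>X t - z\<close>.\<close>

lemma nc_decomp: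
  assumes nc: "nc t H (t - 2) z" and x1: "x1 \<in> H" "lead (t - 1) x1" and w: "w \<in> F (t - 2)"
  obtains \<alpha> \<beta> \<gamma> where "w - ((\<alpha> + \<gamma>) *\<^sub>R z + \<beta> *\<^sub>R x1) - \<gamma> *\<^sub>R (X t - z) \<in> F (Suc t)"
proof -
  have S: "Suc (t - 2) = t - 1" "Suc (t - 1) = t" using nc_a[OF nc] by auto
  obtain \<alpha> where a: "w - \<alpha> *\<^sub>R z \<in> F (t - 1)" using reduce[OF nc_lead[OF nc] w] S by metis
  obtain \<beta> where b: "w - \<alpha> *\<^sub>R z - \<beta> *\<^sub>R x1 \<in> F t" using reduce[OF x1(2) a] S by metis
  obtain \<gamma> where "w - \<alpha> *\<^sub>R z - \<beta> *\<^sub>R x1 - \<gamma> *\<^sub>R X t \<in> F (Suc t)"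
    using reduce_X[OF b nc_t(1)[OF nc] tg_le[OF nc_tg[OF nc]]] by blast
  moreover have "w - \<alpha> *\<^sub>R z - \<beta> *\<^sub>R x1 - \<gamma> *\<^sub>R X t = w - ((\<alpha> + \<gamma>) *\<^sub>R z + \<beta> *\<^sub>R x1) - \<gamma> *\<^sub>R (X t - z)"
    by (simp add: algebra_simps)
  ultimately show thesis using that by metis
qed

text \<open>
  When the tangential part of \<open>X t\<close> has leading degree \<open>t - 2\<close> and \<open>t - 1\<close> is a leading degree of
  \<open>H\<close>, the ideal \<open>F (t - 2)\<close> does split, with a two-dimensional tangential part on which only
  elements of leading degree \<open>1\<close> act nontrivially.
\<close>

lemma nc_plane_br:
  assumes nc: "nc t H (t - 2) z" and t1: "t - 1 \<in> D H"
    and y: "y \<in> perp H" "y \<in> F 2" and x: "x \<in> H" and w: "br y x \<in> F (t - 2)"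
  obtains r where "br y x - r *\<^sub>R (X t - z) \<in> F (Suc t)"
proof -
  note tg = nc_tg[OF nc] and z = nc_z[OF nc]
  have t4: "4 \<le> t" using nc_a[OF nc] by simp
  obtain x1 where x1: "x1 \<in> H" "lead (t - 1) x1" using t1 by (rule D_obtain)
  obtain \<alpha> \<beta> \<gamma> where abc: "br y x - ((\<alpha> + \<gamma>) *\<^sub>R z + \<beta> *\<^sub>R x1) - \<gamma> *\<^sub>R (X t - z) \<in> F (Suc t)"
    using nc_decomp[OF nc x1 w] .
  define p where "p = (\<alpha> + \<gamma>) *\<^sub>R z + \<beta> *\<^sub>R x1"
  have ipw: "ip (br y x) h = ip p h" if h: "h \<in> H" for h
  proof -
    have "ip (br y x - p - \<gamma> *\<^sub>R (X t - z)) h = 0" using tg_perp[OF tg abc] perpD h by (simp add: p_def)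
    moreover have "ip (X t - z) h = 0" using perpD[OF z(2) h] .
    ultimately show ?thesis
      by (simp add: bilinear_lsub[OF ip_bil, of "br y x - p"] bilinear_lsub[OF ip_bil, of "br y x"] bilinear_lmul[OF ip_bil])
  qed
  have "br y x1 \<in> F (Suc t)" using br_F'[OF y(2) leadD(1)[OF x1(2)]] t4 by simp
  then have "ip (br y x1) x = 0" using tg_perp[OF tg] perpD x by blast
  then have 1: "ip p x1 = 0" using tg_skew[OF tg y(1) x x1(1)] ipw[OF x1(1)] by simp
  have "br y z \<in> F t" using br_F'[OF y(2) leadD(1)[OF nc_lead[OF nc]]] by simp
  then have "br y z \<in> F (Suc t)" by (rule nc_F[OF nc])
  then have "ip (br y z) x = 0" using tg_perp[OF tg] perpD x by blast
  then have 2: "ip p z = 0" using tg_skew[OF tg y(1) x z(1)] ipw[OF z(1)] by simp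
  have "ip p p = (\<alpha> + \<gamma>) * ip p z + \<beta> * ip p x1"
    by (subst (2) p_def) (simp add: bilinear_radd[OF ip_bil] bilinear_rmul[OF ip_bil])
  then have "p = 0" using 1 2 by (intro ip_eq_0) simp
  then show thesis using that abc by (simp add: p_def)
qed

text \<open>By \<open>nc_plane_br\<close> the bracket is a multiple of \<open>X t - z\<close>, whose
  leading degree \<open>t - 2\<close> lies below that of the bracket; so the multiple is
  zero.\<close>

lemma nc_plane_HM:
  assumes nc: "nc t H (t - 2) z" and t1: "t - 1 \<in> D H"
    and i: "i \<in> D H" and j: "j \<in> M t H" and ij: "t - 1 \<le> i + j" "i + j \<le> t"
  shows "c j i = 0"
proof (rule ccontr)
  assume c: "c j i \<noteq> 0"
  obtain x y where x: "x \<in> H" "lead i x" and y: "y \<in> perp H" "lead j y" and j2: "2 \<le> j"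
    using i j by (auto simp: M_def elim!: D_obtain)
  have yF: "y \<in> F 2" using F_mono[OF j2 leadD(1)[OF y(2)]] .
  have l: "lead (j + i) (br y x)"
    using lead_br[OF y(2) x(2) _ c] ij tg_le[OF nc_tg[OF nc]] by simp
  have w: "br y x \<in> F (t - 1)" using F_mono[OF _ leadD(1)[OF l]] ij by simp
  then have "br y x \<in> F (t - 2)" using F_mono[of "t - 2" "t - 1"] by simp
  then obtain r where r: "br y x - r *\<^sub>R (X t - z) \<in> F (Suc t)"
    using nc_plane_br[OF nc t1 y(1) yF x(1)] by blast
  have "r = 0"
  proof -
    have "co (t - 2) (br y x) = 0" "co (t - 2) (br y x - r *\<^sub>R (X t - z)) = 0"
      using w r nc_a[OF nc] by (auto simp: F_def)
    then have "r * co (t - 2) (X t - z) = 0"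
      by (simp add: linear_diff[OF lin_co, of "t - 2" "br y x"] linear_scale[OF lin_co])
    then show ?thesis using nc_lead_perp[OF nc] by (simp add: lead_def)
  qed
  then have "Suc t \<le> j + i" using r lead_F[OF l] by simp
  then show False using ij by simp
qed

text \<open>Three levels are removed at the cost of the two tangential degrees \<open>t - 2\<close>
  and \<open>t - 1\<close>.\<close>

lemma nc_plane_descend:
  assumes nc: "nc t H (t - 2) z" and t1: "t - 1 \<in> D H"
  obtains H' where "tg (t - 3) H'" "D H' = D H \<inter> {..<t - 2}" "M (t - 3) H' = M t H \<inter> {..<t - 2}"
proof -
  note tg = nc_tg[OF nc] and z = nc_z[OF nc]
  obtain x1 where x1: "x1 \<in> H" "lead (t - 1) x1" using t1 by (rule D_obtain)
  have compat: "\<exists>h\<in>H. h \<in> F (t - 2) \<and> v - h \<in> perp H" if v: "v \<in> F (t - 2)" for v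
  proof -
    obtain \<alpha> \<beta> \<gamma> where abc: "v - ((\<alpha> + \<gamma>) *\<^sub>R z + \<beta> *\<^sub>R x1) - \<gamma> *\<^sub>R (X t - z) \<in> F (Suc t)"
      using nc_decomp[OF nc x1 v] .
    define p where "p = (\<alpha> + \<gamma>) *\<^sub>R z + \<beta> *\<^sub>R x1"
    have "p \<in> H" using z x1 tg_closed[OF tg] by (simp add: p_def)
    moreover have "x1 \<in> F (t - 2)" using F_mono[OF _ leadD(1)[OF x1(2)]] by simp
    then have "p \<in> F (t - 2)" using leadD(1)[OF nc_lead[OF nc]] F_closed by (simp add: p_def)
    moreover have "v - p \<in> perp H"
    proof -
      have "(v - p - \<gamma> *\<^sub>R (X t - z)) + \<gamma> *\<^sub>R (X t - z) \<in> perp H"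
        using tg_perp[OF tg abc] z(2) perp_closed by (simp only: p_def)
      then show ?thesis by simp
    qed
    ultimately show ?thesis by blast
  qed
  have j: "2 \<le> t - 2" "t - 2 \<le> t" using nc_a[OF nc] by auto
  have S: "t - 2 - 1 = t - 3" by simp
  show thesis
    by (rule descend[OF tg j compat]) (auto intro: that simp: S)
qed

end

section \<open>Tangential and normal degrees at the levels k and k + 1\<close>

locale graded_filiform_k_ip = graded_filiform_k br n X co c k + graded_filiform_ip br n X co c ip
  for br :: "'a::real_vector \<Rightarrow> 'a \<Rightarrow> 'a" and n X co c k ip
begin

lemma level_k_perp:
  assumes tg: "tg k H" and k: "k \<in> D (perp H)" shows "2 * card (D H) + 1 \<le> k"
proof -
  have kD: "k \<notin> D H" by (rule D_disjoint_top[OF tg k])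
  have "D H \<subseteq> {2..k - 2} \<union> {k - 1}"
  proof
    fix i assume "i \<in> D H"
    then have "2 \<le> i" "i \<le> k" "i \<noteq> k" using D_bounds[OF tg] kD by auto
    then show "i \<in> {2..k - 2} \<union> {k - 1}" by auto
  qed
  then have "card (D H) \<le> card (D H \<inter> {2..k - 2}) + 1"
    using card_Int_Diff_le[OF finite_D, of H "{2..k - 2}" "{k - 1}"] by simp
  moreover have "2 * card (D H \<inter> {2..k - 2}) \<le> k - 3" using full_pairs[OF tg kD full_k] k_odd by simp
  ultimately show ?thesis using k5 by linarith
qed

text \<open>The nonsplit case of a full row needs an even degree.\<close>

lemma level_k_or:
  assumes tg: "tg k H" shows "k \<in> D H \<or> k \<in> D (perp H)"
proof (rule ccontr)
  assume "\<not> ?thesis"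
  then obtain a z where "nc k H a z" using nc_ex[OF tg] k5 by auto
  then show False using full_nc(1)[OF _ full_k] k5 k_odd by blast
qed

lemma br_low: "v \<in> F 2 \<Longrightarrow> w \<in> F 2 \<Longrightarrow> br v w \<in> F k"
  by (rule br_F_row[of v 2 w 2]) (auto intro: low)

lemma row_k_nz: "2 \<le> i \<Longrightarrow> i + 2 \<le> k \<Longrightarrow> c i (k - i) \<noteq> 0"
  by (simp add: row_k)

text \<open>By \<open>HM\<close> a tangential and a normal degree are never partners in row
  \<open>k\<close>; the count of \<open>tg_card\<close> then leaves no slack, so the normal degrees
  in \<open>{2..k - 2}\<close> are exactly the reflections of the nontangential ones.\<close>

lemma level_k_tangent_M:
  assumes tg: "tg k H" and k: "k \<in> D H" and i: "2 \<le> i" "i + 2 \<le> k"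
  shows "i \<in> M k H \<longleftrightarrow> k - i \<notin> D H" "k - 1 \<in> M k H" "k - 1 \<notin> D H"
    "card (D H) = card (D H \<inter> {2..k - 2}) + 1" "card (D H) + card (M k H \<inter> {2..k - 2}) + 2 = k"
proof -
  let ?A = "D H \<inter> {2..k - 2}" and ?M = "M k H \<inter> {2..k - 2}" and ?r = "\<lambda>i. k - i"
  show k1: "k - 1 \<notin> D H" using consec[OF tg k] k5 by simp
  have kM: "k \<notin> M k H" using D_disjoint_top[OF tg] k by (auto simp: M_def)
  have no: "k - i \<notin> M k H" if "i \<in> ?A" for i
  proof
    assume "k - i \<in> M k H"
    then have "c (k - i) i = 0" using HM[OF tg k, of i "k - i"] that by (auto simp: M_def)
    moreover have "k - (k - i) = i" "2 \<le> k - i" "k - i + 2 \<le> k" using that k5 by auto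
    ultimately show False using row_k_nz[of "k - i"] by simp
  qed
  have D: "D H = insert k ?A"
  proof
    show "D H \<subseteq> insert k ?A"
    proof
      fix i assume i: "i \<in> D H"
      then have "2 \<le> i" "i \<le> k" "i \<noteq> k - 1" using D_bounds[OF tg] k1 by auto
      then show "i \<in> insert k ?A" using i by auto
    qed
  qed (use k in auto)
  have "k \<notin> ?A" using k5 by auto
  then show cD: "card (D H) = card ?A + 1" using finite_D[of H] by (subst D) simp
  have tot: "card (D H) + card (M k H) = k - 1" using tg_card[OF tg] k5 by simp
  have W: "card ?M + card ?A \<le> card {2..k - 2}"
    by (rule card_reflect_disjoint[where m = k]) (use no in auto)
  have Msub: "M k H \<subseteq> insert (k - 1) ?M"
  proof
    fix i assume i: "i \<in> M k H"
    then have "2 \<le> i" "i \<le> k" "i \<noteq> k" using kM by (auto simp: M_def)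
    then show "i \<in> insert (k - 1) ?M" using i by auto
  qed
  show "k - 1 \<in> M k H"
  proof (rule ccontr)
    assume "k - 1 \<notin> M k H"
    then have "M k H = ?M" using Msub by blast
    then show False using tot cD W k5 by simp
  qed
  then have "M k H = insert (k - 1) ?M" using Msub by blast
  moreover have "k - 1 \<notin> ?M" using k5 by auto
  ultimately have cM: "card (M k H) = card ?M + 1"
    using finite_Int[of "M k H" "{2..k-2}"] by (metis card_insert_disjoint finite_Int finite_atLeastAtMost Suc_eq_plus1)
  then show "card (D H) + card ?M + 2 = k" using tot k5 by simp
  have "?M \<union> ?r ` ?A = {2..k - 2}"
  proof (rule card_subset_eq)
    show "?M \<union> ?r ` ?A \<subseteq> {2..k - 2}" by auto
    have "inj_on ?r ?A" by (rule inj_onI) auto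
    then have "card (?r ` ?A) = card ?A" by (rule card_image)
    moreover have "?M \<inter> ?r ` ?A = {}" using no by blast
    ultimately have "card (?M \<union> ?r ` ?A) = card ?M + card ?A"
      using finite_D[of H] by (subst card_Un_disjoint) auto
    moreover have "card {2..k - 2} = k - 3" using k5 by simp
    ultimately show "card (?M \<union> ?r ` ?A) = card {2..k - 2}" using cM cD tot k5 by linarith
  qed simp
  then have "i \<in> ?M \<or> i \<in> ?r ` ?A" using i by auto
  then have or: "i \<in> M k H \<or> k - i \<in> D H" using i by auto
  have "k - (k - i) = i" using i by simp
  moreover have "2 \<le> k - i" "k - i \<le> k - 2" using i by linarith+
  ultimately have "i \<notin> M k H" if "k - i \<in> D H" using no[of "k - i"] that by simp
  then show "i \<in> M k H \<longleftrightarrow> k - i \<notin> D H" using or by blast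
qed

text \<open>At least two normal degrees must lie in \<open>{2..k - 2}\<close>. With none, two
  consecutive tangential degrees at the top of level \<open>k - 2\<close> contradict
  \<open>consec\<close>. With a single one, \<open>j\<close>, a normal vector of degree
  \<open>j\<close> would commute with all of \<open>F 2\<close> modulo \<open>F (k + 1)\<close>,
  against \<open>c j (k - j) \<noteq> 0\<close>.\<close>

lemma level_k_tangent:
  assumes tg: "tg k H" and k: "k \<in> D H" shows "card (D H) + 4 \<le> k"
proof (rule ccontr)
  assume big: "\<not> ?thesis"
  have i22: "2 \<le> (2::nat)" "2 + 2 \<le> k" using k5 by auto
  note L = level_k_tangent_M[OF tg k]
  note L' = L(2-5)[OF i22]
  have iff: "i \<in> M k H \<longleftrightarrow> k - i \<notin> D H" if "2 \<le> i" "i + 2 \<le> k" for i using L(1)[OF that] .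
  let ?M = "M k H \<inter> {2..k - 2}"
  have c1: "card ?M \<le> 1" using L'(4) big by simp
  obtain H1 where H1: "tg (k - 1) H1" "D H1 = D H - {k}" "M (k - 1) H1 = M k H - {k}"
    using descend_top_ex[OF tg] k k5 by auto
  have k1: "k - 1 \<in> D (perp H1)"
  proof -
    have "k - 1 \<in> M (k - 1) H1" unfolding H1(3) using L'(1) k5 by auto
    then show ?thesis by (simp add: M_def)
  qed
  have k12: "2 \<le> k - 1" using k5 by linarith
  show False
  proof (cases "?M = {}")
    case True
    obtain H2 where H2: "tg (k - 1 - 1) H2" "D H2 = D H1 - {k - 1}"
      using descend_top_ex[OF H1(1) k12] k1 by blast
    have D: "i \<in> D H" if "2 \<le> i" "i + 2 \<le> k" for i
    proof -
      have e: "k - (k - i) = i" "2 \<le> k - i" "k - i \<le> k - 2" "k - i + 2 \<le> k" using that by linarith+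
      then have "k - i \<in> {2..k - 2}" by simp
      then have "k - i \<notin> M k H" using True by blast
      then show ?thesis using iff[of "k - i"] e by simp
    qed
    have e: "k - 1 - 1 = k - 2" by simp
    have "k - 2 \<in> D H" by (rule D) (use k5 in linarith)+
    moreover have "k - 2 - 1 \<in> D H" by (rule D) (use k5 in linarith)+
    moreover have "k - 2 \<noteq> k" "k - 2 \<noteq> k - 1" "k - 2 - 1 \<noteq> k" "k - 2 - 1 \<noteq> k - 1" "2 < k - 2"
      using k5 by linarith+
    ultimately have "k - 2 \<in> D H2" "k - 2 - 1 \<in> D H2" "2 < k - 2" unfolding H2(2) H1(2) by blast+
    then show False using consec[OF H2(1)[unfolded e]] by blast
  next
    case False
    then obtain j where j: "j \<in> ?M" by blast
    then have "card {j} \<le> card ?M" by (intro card_mono) auto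
    then have "card {j} = card ?M" using c1 by simp
    then have "{j} = ?M" using j by (intro card_subset_eq) auto
    then have Mj: "?M = {j}" by simp
    obtain y where y: "y \<in> perp H" "lead j y" using j by (auto simp: M_def elim!: D_obtain)
    obtain y' where y': "y' \<in> perp H" "lead (k - 1) y'" using L'(1) by (auto simp: M_def elim!: D_obtain)
    have j2: "2 \<le> j" "j + 2 \<le> k" using j by auto
    have yF: "y \<in> F 2" using F_mono[OF j2(1) leadD(1)[OF y(2)]] .
    \<comment> \<open>\<open>y\<close> commutes with tangential vectors by \<open>HM_vec\<close>.
      Normal vectors of \<open>F 2\<close> are multiples of \<open>y\<close> up to
      \<open>F (k - 1)\<close>, which \<open>y\<close> sends into \<open>F (k + 1)\<close>.\<close>
    have yv: "br y v \<in> F (Suc k)" if v: "v \<in> F 2" for v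
    proof -
      obtain p where p: "p \<in> H" "v - p \<in> perp H" using ex_proj[OF tg_sub[OF tg]] by blast
      have pF: "p \<in> F 2" by (rule tg_F2[OF tg p(1)])
      have 1: "br y p \<in> F (Suc k)" by (rule HM_vec[OF tg k p(1) y(1) br_low[OF yF pF]])
      define w where "w = v - p"
      have w: "w \<in> perp H" "w \<in> F 2" using p v pF F_closed(4) by (auto simp: w_def)
      have 2: "br y w \<in> F (Suc k)"
      proof -
        have step: "\<exists>\<alpha>. w - \<alpha> *\<^sub>R y \<in> F (k - 1)"
        proof (cases "\<exists>\<alpha>. w - \<alpha> *\<^sub>R y \<in> F (k - 1)")
          case False
          have 0: "w \<in> F j"
          proof (rule ccontr)
            assume "w \<notin> F j"
            then obtain i where i: "lead i w" "i < j" by (rule ex_lead_not_F)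
            then have "i \<in> ?M" using D_I[OF w(1) i(1)] lead_F[OF i(1) w(2)] j2 by (auto simp: M_def)
            then show False using Mj i by auto
          qed
          obtain \<alpha> where a: "w - \<alpha> *\<^sub>R y \<in> F (Suc j)" using reduce[OF y(2) 0] by blast
          have "w - \<alpha> *\<^sub>R y \<notin> F (k - 1)" using False by blast
          then obtain i where i: "lead i (w - \<alpha> *\<^sub>R y)" "i < k - 1" by (rule ex_lead_not_F)
          have "w - \<alpha> *\<^sub>R y \<in> perp H" using w y perp_closed by blast
          then have "i \<in> ?M" using D_I[OF _ i(1)] lead_F[OF i(1) a] i(2) j2 by (auto simp: M_def)
          then show ?thesis using Mj lead_F[OF i(1) a] by auto
        qed
        then obtain \<alpha> where a: "w - \<alpha> *\<^sub>R y \<in> F (k - 1)" by blast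
        have "br y (w - \<alpha> *\<^sub>R y) \<in> F (Suc k)" using br_F'[OF yF a] k5 by simp
        then show ?thesis by (simp add: bilinear_rsub[OF bil] bilinear_rmul[OF bil] br_self)
      qed
      have "br y p + br y w \<in> F (Suc k)" by (rule F_closed(2)[OF 1 2])
      then show ?thesis by (simp add: w_def bilinear_rsub[OF bil])
    qed
    have "lead (k - j) (X (k - j))" using lead_X kn j2 by simp
    moreover have "j + (k - j) = k" using j2 by simp
    ultimately have l: "lead k (br y (X (k - j)))"
      using lead_br[OF y(2), of "k - j" "X (k - j)"] row_k_nz[OF j2] kn by simp
    moreover have "br y (X (k - j)) \<in> F (Suc k)" by (rule yv) (use j2 in \<open>auto intro: X_F\<close>)
    ultimately show False using lead_F by fastforce
  qed
qed

text \<open>A tangential degree \<open>k + 1\<close> forces degree \<open>k\<close> to be normal,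
  and the sharper bound \<open>level_k_perp\<close> pays for it.\<close>

lemma bounded_Suc_k: assumes n: "k < n" shows "bounded (Suc k)"
  unfolding bounded_def
proof (intro allI impI)
  fix H assume tg: "tg (Suc k) H"
  show "2 * card (D H) \<le> Suc k"
  proof (cases "Suc k \<in> D H")
    case False
    then show ?thesis using full_not_top[OF tg _ _ full_Suc_k[OF n]] k5 by simp
  next
    case True
    then obtain H1 where H1: "tg (Suc k - 1) H1" "D H1 = D H - {Suc k}"
      using descend_top_ex[OF tg] k5 by auto
    have tg1: "tg k H1" using H1 by simp
    have "k \<notin> D H1" using consec[OF tg True] k5 H1 by simp
    then have "k \<in> D (perp H1)" using level_k_or[OF tg1] by blast
    then have "2 * card (D H1) + 1 \<le> k" by (rule level_k_perp[OF tg1])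
    moreover have "card (D H) = card (D H1) + 1" using card_Suc_Diff1[OF finite_D True] H1(2) by simp
    ultimately show ?thesis by simp
  qed
qed

end

section \<open>Pencils of skew forms\<close>

text \<open>
  Two skew forms on \<open>F 2\<close> vanishing on \<open>F k\<close>, where \<open>e\<close> pairs the degrees \<open>i\<close> and \<open>k + 1 - i\<close> and \<open>f\<close>
  pairs the degrees \<open>i\<close> and \<open>k + 2 - i\<close> up to terms of higher degree. Every form of the pencil
  spanned by \<open>e\<close> and \<open>f\<close> has a one-dimensional radical modulo \<open>F k\<close>, so the pencil admits no
  nontrivial orthogonal decomposition.
\<close>

locale form_pencil = graded_filiform_k br n X co c k
  for br :: "'a::real_vector \<Rightarrow> 'a \<Rightarrow> 'a" and n X co c k +
  fixes e f :: "'a \<Rightarrow> 'a \<Rightarrow> real" and m :: nat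
  assumes e_bil: "bilinear e" and f_bil: "bilinear f"
    and e_skew: "e x y = - e y x" and f_skew: "f x y = - f y x"
    and m: "Suc k = 2 * m" "3 \<le> m"
    and e_zero: "v \<in> F i \<Longrightarrow> w \<in> F j \<Longrightarrow> 2 \<le> i \<Longrightarrow> 2 \<le> j \<Longrightarrow> k + 2 \<le> i + j \<Longrightarrow> e v w = 0"
    and e_mid: "v \<in> F m \<Longrightarrow> w \<in> F m \<Longrightarrow> e v w = 0"
    and e_nz: "lead i v \<Longrightarrow> lead j w \<Longrightarrow> 2 \<le> i \<Longrightarrow> 2 \<le> j \<Longrightarrow> i + j = Suc k \<Longrightarrow> i \<noteq> m \<Longrightarrow> e v w \<noteq> 0"
    and f_zero: "v \<in> F i \<Longrightarrow> w \<in> F j \<Longrightarrow> 2 \<le> i \<Longrightarrow> 2 \<le> j \<Longrightarrow> k + 3 \<le> i + j \<Longrightarrow> f v w = 0"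
    and f_Fk: "v \<in> F 2 \<Longrightarrow> w \<in> F k \<Longrightarrow> f v w = 0"
    and f_nz: "lead i v \<Longrightarrow> lead j w \<Longrightarrow> 3 \<le> i \<Longrightarrow> 3 \<le> j \<Longrightarrow> i + j = k + 2 \<Longrightarrow> f v w \<noteq> 0"
begin

text \<open>Degree \<open>l\<close> of \<open>g\<close> is cleared with \<open>X i\<close>,
  \<open>i = k + 1 - l\<close>, the partner of \<open>X l\<close> under \<open>e\<close>. Degree
  \<open>m\<close> is its own partner and \<open>e\<close> vanishes there; this is where
  \<open>u0\<close>, a kernel vector of \<open>e\<close> annihilated by \<open>g\<close>, is
  needed.\<close>

lemma e_solve:
  assumes g: "linear g" and l: "2 \<le> l" "l \<le> k" and g0: "\<And>y. y \<in> F l \<Longrightarrow> g y = 0"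
    and u0: "l \<le> m \<or> (lead m u0 \<and> (\<forall>y\<in>F 2. e u0 y = 0) \<and> g u0 = 0)"
  shows "\<exists>u\<in>F (k + 2 - l). \<forall>y\<in>F 2. e u y = g y"
  using l g g0 u0
proof (induction l arbitrary: g rule: dec_induct)
  case base
  then show ?case by (intro bexI[of _ 0]) (auto simp: bilinear_lzero[OF e_bil] F_closed)
next
  case (step l)
  have lk: "l < k" "l < n" "l \<le> n" using step.prems kn by auto
  have lX: "lead l (X l)" using step lk by (intro lead_X) auto
  show ?case
  proof (cases "l = m")
    case True
    have u0: "lead m u0" "g u0 = 0" using step.prems(4) True by auto
    have 0: "g y = 0" if y: "y \<in> F l" for y
    proof -
      obtain \<alpha> where "y - \<alpha> *\<^sub>R u0 \<in> F (Suc l)" using reduce[OF u0(1)] y True by blast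
      then have "g (y - \<alpha> *\<^sub>R u0) = 0" by (rule step.prems(3))
      then show ?thesis using u0(2) by (simp add: linear_diff[OF step.prems(2)] linear_scale[OF step.prems(2)])
    qed
    have "\<exists>u\<in>F (k + 2 - l). \<forall>y\<in>F 2. e u y = g y"
      by (rule step.IH) (use step.prems(2) 0 lk True in auto)
    then obtain u where u: "u \<in> F (k + 2 - l)" "\<forall>y\<in>F 2. e u y = g y" by blast
    have "u \<in> F (k + 2 - Suc l)" by (rule F_mono[OF _ u(1)]) simp
    then show ?thesis using u by blast
  next
    case False
    define i where "i = Suc k - l"
    have i: "i + l = Suc k" "2 \<le> i" "i \<noteq> m" "i \<le> n" "k + 2 - Suc l = i" using step.hyps lk kn False m by (auto simp: i_def)
    have lXi: "lead i (X i)" using i by (intro lead_X) auto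
    have nz: "e (X i) (X l) \<noteq> 0" by (rule e_nz[OF lXi lX i(2) step.hyps(1) i(1) i(3)])
    define \<mu> where "\<mu> = g (X l) / e (X i) (X l)"
    define g' where "g' y = g y - e (\<mu> *\<^sub>R X i) y" for y
    have lin: "linear (e x)" for x using e_bil by (simp add: bilinear_def)
    have g': "linear g'" unfolding g'_def using step.prems(2) lin by (rule linear_compose_sub)
    have 0: "g' y = 0" if y: "y \<in> F l" for y
    proof -
      obtain \<alpha> where a: "y - \<alpha> *\<^sub>R X l \<in> F (Suc l)" using reduce[OF lX y] by blast
      then have "g (y - \<alpha> *\<^sub>R X l) = 0" by (rule step.prems(3))
      moreover have "e (\<mu> *\<^sub>R X i) (y - \<alpha> *\<^sub>R X l) = 0"
        using F_closed(3)[OF leadD(1)[OF lXi]] a i step.hyps by (intro e_zero[of _ i _ "Suc l"]) auto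
      ultimately have "g' (y - \<alpha> *\<^sub>R X l) = 0" by (simp add: g'_def)
      moreover have "g' (X l) = 0" using nz by (simp add: g'_def \<mu>_def bilinear_lmul[OF e_bil])
      ultimately show ?thesis by (simp add: linear_diff[OF g'] linear_scale[OF g'])
    qed
    have "l \<le> m \<or> (lead m u0 \<and> (\<forall>y\<in>F 2. e u0 y = 0) \<and> g' u0 = 0)"
    proof (cases "l \<le> m")
      case False
      then have u0: "lead m u0" "\<forall>y\<in>F 2. e u0 y = 0" "g u0 = 0" using step.prems(4) by auto
      have "\<mu> *\<^sub>R X i \<in> F 2" using X_F[of 2 i] i F_closed(3) by blast
      then have "e (\<mu> *\<^sub>R X i) u0 = 0" using u0(2) e_skew[of "\<mu> *\<^sub>R X i" u0] by simp
      then show ?thesis using u0 by (simp add: g'_def)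
    qed simp
    then have "\<exists>u\<in>F (k + 2 - l). \<forall>y\<in>F 2. e u y = g' y" using step.IH[OF _ g' 0] lk by auto
    then obtain u where u: "u \<in> F (k + 2 - l)" "\<forall>y\<in>F 2. e u y = g' y" by blast
    have "u \<in> F i" by (rule F_mono[OF _ u(1)]) (use i in simp)
    then have "u + \<mu> *\<^sub>R X i \<in> F i" using F_closed(2,3) leadD(1)[OF lXi] by blast
    moreover have "\<forall>y\<in>F 2. e (u + \<mu> *\<^sub>R X i) y = g y" using u(2) by (simp add: g'_def bilinear_ladd[OF e_bil])
    ultimately show ?thesis unfolding i(5) by blast
  qed
qed

text \<open>\<open>e (X m)\<close> vanishes on \<open>F m\<close>, so \<open>e_solve\<close> with
  \<open>l = m\<close> needs no \<open>u0\<close> and corrects \<open>X m\<close> by terms of higher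
  degree.\<close>

lemma e_kernel_ex: obtains u where "lead m u" "\<forall>y\<in>F 2. e u y = 0"
proof -
  have mn: "m \<le> k" "2 \<le> m" using m by auto
  have lX: "lead m (X m)" using mn kn by (intro lead_X) auto
  have lin: "linear (\<lambda>y. - e (X m) y)"
    using e_bil by (intro linear_compose_neg) (simp add: bilinear_def)
  have "\<exists>u\<in>F (k + 2 - m). \<forall>y\<in>F 2. e u y = - e (X m) y"
    by (rule e_solve[OF lin mn(2,1)]) (use e_mid[OF leadD(1)[OF lX]] in auto)
  then obtain u where u: "u \<in> F (k + 2 - m)" "\<forall>y\<in>F 2. e u y = - e (X m) y" by blast
  have "k + 2 - m = Suc m" using m by simp
  then have "X m - (X m + u) \<in> F (Suc m)" using u(1) F_closed(5) by simp
  then have "lead m (X m + u)" by (rule lead_diff[OF lX])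
  moreover have "\<forall>y\<in>F 2. e (X m + u) y = 0" using u(2) by (simp add: bilinear_ladd[OF e_bil])
  ultimately show thesis using that by blast
qed

lemma e_kernel_lead:
  assumes u: "u \<in> F 2" "u \<notin> F k" "\<forall>y\<in>F 2. e u y = 0" shows "lead m u"
proof -
  obtain i where i: "lead i u" "i < k" using ex_lead_not_F[OF u(2)] .
  have i2: "2 \<le> i" by (rule lead_F[OF i(1) u(1)])
  have "i = m"
  proof (rule ccontr)
    assume "i \<noteq> m"
    moreover have lX: "lead (Suc k - i) (X (Suc k - i))" using i i2 kn by (intro lead_X) auto
    ultimately have "e u (X (Suc k - i)) \<noteq> 0" using i i2 by (intro e_nz[OF i(1) lX]) auto
    moreover have "X (Suc k - i) \<in> F 2" using i by (intro X_F) auto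
    ultimately show False using u(3) by blast
  qed
  then show ?thesis using i by simp
qed

text \<open>A Kronecker chain of the pencil: \<open>us 0 = u0\<close>, and
  \<open>e (us (j + 1))\<close> equals \<open>f (us j)\<close> on \<open>F 2\<close>. It stays in
  \<open>K\<close>, has the consecutive leading degrees \<open>m\<close>, \<open>m - 1\<close>, ...,
  2 and is isotropic for \<open>e\<close>. Subtracting chain vectors moves \<open>y\<close> into
  \<open>F (m + 1)\<close>, where \<open>e\<close> pairs every degree below \<open>k\<close> with a
  chain vector; since \<open>y\<close> is orthogonal to \<open>K\<close>, nothing is left below
  degree \<open>k\<close>.\<close>

lemma split_absorb:
  assumes K: "subspace K" "K \<subseteq> F 2" "K' \<subseteq> F 2"
    and sum: "\<And>y. y \<in> F 2 \<Longrightarrow> \<exists>a\<in>K. y - a \<in> K'"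
    and orth: "\<And>x y. x \<in> K \<Longrightarrow> y \<in> K' \<Longrightarrow> e x y = 0 \<and> f x y = 0"
    and u0: "u0 \<in> K" "lead m u0" "\<forall>y\<in>F 2. e u0 y = 0"
    and y: "y \<in> K'"
  shows "\<exists>a\<in>K. y - a \<in> F k"
proof -
  define good where "good i us \<longleftrightarrow> (\<forall>j\<le>i. us j \<in> K \<and> lead (m - j) (us j)) \<and> us 0 = u0 \<and>
     (\<forall>j<i. \<forall>y\<in>F 2. e (us (Suc j)) y = f (us j) y)" for i us
  \<comment> \<open>Skew-symmetry shifts one index up and the other down until the two meet or
    become neighbours.\<close>
  have iso: "e (us j) (us l) = 0" if good: "good i us" and jl: "j \<le> l" "l \<le> i" for i us j l
    using jl
  proof (induction "l - j" arbitrary: j l rule: less_induct)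
    case less
    have F2: "us l \<in> F 2" if "l \<le> i" for l using good that K(2) by (auto simp: good_def)
    consider "l = j" | "l = Suc j" | "j + 2 \<le> l" using less.prems by linarith
    then show ?case
    proof cases
      case 1
      then show ?thesis using e_skew[of "us j" "us j"] by simp
    next
      case 2
      then have "e (us (Suc j)) (us j) = f (us j) (us j)" using good F2 less.prems by (simp add: good_def)
      then show ?thesis using 2 e_skew[of "us j" "us (Suc j)"] f_skew[of "us j" "us j"] by simp
    next
      case 3
      then obtain l' where l: "l = Suc l'" "Suc j \<le> l'" by (cases l) auto
      have "e (us (Suc l')) (us j) = f (us l') (us j)" "e (us (Suc j)) (us l') = f (us j) (us l')"
        using good F2 less.prems l by (simp_all add: good_def)
      moreover have "e (us (Suc j)) (us l') = 0" using l less.prems by (intro less.hyps) auto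
      ultimately show ?thesis using l e_skew[of "us j" "us (Suc l')"] f_skew[of "us j" "us l'"] by simp
    qed
  qed
  have "\<exists>us. good i us" if "i \<le> m - 2" for i
    using that
  proof (induction i)
    case 0
    then show ?case using u0 by (intro exI[of _ "\<lambda>_. u0"]) (simp add: good_def)
  next
    case (Suc i)
    then obtain us where us: "good i us" by auto
    have im: "i + 3 \<le> m" using Suc.prems by linarith
    define x where "x = us i"
    have x: "x \<in> K" "lead (m - i) x" using us by (auto simp: good_def x_def)
    have lin: "linear (f x)" using f_bil by (simp add: bilinear_def)
    \<comment> \<open>The solvability condition of \<open>e_solve\<close>: \<open>f x\<close> must
      annihilate the kernel vector.\<close>
    have "f x u0 = 0"
    proof (cases i)
      case 0
      then show ?thesis using us f_skew[of u0 u0] by (simp add: good_def x_def)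
    next
      case (Suc i')
      then have "e (us 1) (us i) = 0" using iso[OF us, of 1 i] by simp
      moreover have "e (us 1) (us i) = f (us 0) (us i)" using us Suc x K(2) by (auto simp: good_def x_def)
      ultimately show ?thesis using us f_skew[of u0 x] by (simp add: good_def x_def)
    qed
    then have "\<exists>u\<in>F (k + 2 - k). \<forall>y\<in>F 2. e u y = f x y"
      using x K(2) k5 u0 by (intro e_solve[OF lin]) (auto intro: f_Fk)
    then obtain u where u: "u \<in> F 2" "\<forall>y\<in>F 2. e u y = f x y" by auto
    \<comment> \<open>The \<open>K\<close> component of the solution is again a solution, because
      \<open>e\<close> and \<open>f\<close> both respect the decomposition.\<close>
    obtain a where a: "a \<in> K" "u - a \<in> K'" using sum u(1) by blast
    have ea: "e a y = f x y" if y: "y \<in> F 2" for y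
    proof -
      obtain b where b: "b \<in> K" "y - b \<in> K'" using sum y by blast
      have "e a (y - b) = 0" "f x (y - b) = 0" using orth a b x by auto
      moreover have "e (u - a) b = 0" using orth[OF b(1) a(2)] e_skew[of "u - a" b] by simp
      moreover have "e u b = f x b" using u b K(2) by auto
      ultimately show ?thesis
        by (simp add: bilinear_rsub[OF e_bil] bilinear_rsub[OF f_bil] bilinear_lsub[OF e_bil])
    qed
    \<comment> \<open>\<open>f\<close> pairs \<open>X l\<close> with the leading term of
      \<open>x\<close>; comparison with \<open>e\<close> locates the leading degree of
      \<open>a\<close> at \<open>k + 1 - l = m - (i + 1)\<close>.\<close>
    define l where "l = Suc m + i"
    have l: "l + (m - i) = k + 2" "3 \<le> l" "l < k" "m < l" using im m by (auto simp: l_def)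
    have lX: "lead l (X l)" using l kn by (intro lead_X) auto
    have XF: "X l \<in> F 2" using l by (intro X_F) auto
    have nz: "e a (X l) \<noteq> 0" using f_nz[OF x(2) lX] l im ea[OF XF] by (simp add: add.commute)
    have aF: "a \<in> F 2" using a K by auto
    have "a \<notin> F k"
    proof
      assume "a \<in> F k"
      then have "e a (X l) = 0" using k5 l X_F[of 2 l] by (intro e_zero[of _ k _ 2]) auto
      then show False using nz by simp
    qed
    then obtain j where j: "lead j a" "j < k" by (rule ex_lead_not_F)
    have j2: "2 \<le> j" by (rule lead_F[OF j(1) aF])
    have jm: "j \<noteq> m"
    proof
      assume "j = m"
      then have "e a (X l) = 0" using leadD(1)[OF j(1)] X_F[of m l] l by (intro e_mid) auto
      then show False using nz by simp
    qed
    have "j + l \<le> Suc k"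
    proof (rule ccontr)
      assume "\<not> ?thesis"
      then have "e a (X l) = 0" using leadD(1)[OF j(1)] X_F[of l l] l j2 by (intro e_zero[of _ j _ l]) auto
      then show False using nz by simp
    qed
    moreover have "Suc k \<le> j + l"
    proof (rule ccontr)
      assume a1: "\<not> ?thesis"
      have lX': "lead (Suc k - j) (X (Suc k - j))" using j j2 kn by (intro lead_X) auto
      have "e a (X (Suc k - j)) \<noteq> 0" using j j2 jm by (intro e_nz[OF j(1) lX']) auto
      moreover have "e a (X (Suc k - j)) = f x (X (Suc k - j))" using j by (intro ea X_F) auto
      moreover have "f x (X (Suc k - j)) = 0"
        using leadD(1)[OF x(2)] leadD(1)[OF lX'] a1 l j j2 im by (intro f_zero[of _ "m - i" _ "Suc k - j"]) auto
      ultimately show False by simp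
    qed
    ultimately have "j = m - Suc i" using l im by linarith
    then have "good (Suc i) (us(Suc i := a))"
      using us a j ea by (auto simp: good_def less_Suc_eq le_Suc_eq x_def)
    then show ?case by blast
  qed
  then obtain us where us: "good (m - 2) us" by blast
  have us_l: "us l \<in> K" "lead (m - l) (us l)" if "l \<le> m - 2" for l using us that by (auto simp: good_def)
  have iso': "e (us j) (us l) = 0" if "j \<le> m - 2" "l \<le> m - 2" for j l
    using iso[OF us, of j l] iso[OF us, of l j] e_skew[of "us j" "us l"] that by (cases "j \<le> l") auto
  have "\<exists>a\<in>K. (\<forall>l\<le>m - 2. e (us l) a = 0) \<and> y - a \<in> F j" if "2 \<le> j" "j \<le> Suc m" for j
    using that
  proof (induction j rule: dec_induct)
    case base
    have "y \<in> F 2" using y K by auto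
    then show ?case using subspace_0[OF K(1)] by (intro bexI[of _ 0]) (auto simp: bilinear_rzero[OF e_bil])
  next
    case (step j)
    then obtain a where a: "a \<in> K" "\<forall>l\<le>m - 2. e (us l) a = 0" "y - a \<in> F j" by auto
    define l where "l = m - j"
    have l: "l \<le> m - 2" "m - l = j" using step by (auto simp: l_def)
    obtain \<alpha> where al: "y - a - \<alpha> *\<^sub>R us l \<in> F (Suc j)" using reduce[OF us_l(2)[OF l(1)]] a(3) l(2) by metis
    have "a + \<alpha> *\<^sub>R us l \<in> K" using a us_l[OF l(1)] K(1) by (simp add: subspace_add subspace_scale)
    moreover have "\<forall>i\<le>m - 2. e (us i) (a + \<alpha> *\<^sub>R us l) = 0"
      using a iso' l by (simp add: bilinear_radd[OF e_bil] bilinear_rmul[OF e_bil])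
    moreover have "y - (a + \<alpha> *\<^sub>R us l) \<in> F (Suc j)" using al by (simp add: diff_diff_add)
    ultimately show ?case by blast
  qed
  from this[of "Suc m"] obtain a where a: "a \<in> K" "\<forall>l\<le>m - 2. e (us l) a = 0" "y - a \<in> F (Suc m)"
    using m by auto
  have "y - a \<in> F k"
  proof (rule ccontr)
    assume "y - a \<notin> F k"
    then obtain j where j: "lead j (y - a)" "j < k" by (rule ex_lead_not_F)
    have jm: "Suc m \<le> j" by (rule lead_F[OF j(1) a(3)])
    define l where "l = j - m"
    have l: "l \<le> m - 2" "m - l + j = Suc k" "2 \<le> m - l" "m - l \<noteq> m" using j jm m by (auto simp: l_def)
    have "e (us l) (y - a) \<noteq> 0" using l jm m by (intro e_nz[OF us_l(2)[OF l(1)] j(1)]) auto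
    moreover have "e (us l) y = 0" using orth us_l l y by blast
    moreover have "e (us l) a = 0" using a l by blast
    ultimately show False by (simp add: bilinear_rsub[OF e_bil])
  qed
  then show ?thesis using a by blast
qed

end

context graded_filiform_k_ip
begin

text \<open>For normal \<open>y\<close> in \<open>F 2\<close> and tangential \<open>x\<close>,
  \<open>br y x\<close> is a multiple of \<open>X (k + 2) - z\<close> modulo
  \<open>F (k + 3)\<close> by \<open>nc_plane_br\<close>. So \<open>H\<close> and the normal part
  \<open>N\<close> of \<open>F 2\<close> are orthogonal for two forms \<open>e\<close>,
  \<open>f\<close>, and the one that carries a kernel vector of \<open>e\<close> absorbs the other
  modulo \<open>F k\<close>.\<close>

lemma no_plane:
  assumes n: "k + 2 \<le> n" and c2k: "c 2 k = 0" and nc: "nc (k + 2) H k z"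
    and D: "k + 1 \<in> D H" "2 \<in> D H"
  shows False
proof -
  let ?t = "k + 2"
  note tg = nc_tg[OF nc] and z = nc_z[OF nc]
  have nc': "nc ?t H (?t - 2) z" using nc by simp
  have t1: "?t - 1 \<in> D H" using D by simp
  obtain m where m: "Suc k = 2 * m" using k_odd even_Suc[of k] by (blast elim: evenE)
  define w where "w = X ?t - z"
  have lw: "lead k w" using nc_lead_perp[OF nc] by (simp add: w_def)
  \<comment> \<open>These coefficients make \<open>e\<close> and \<open>f\<close> vanish on pairs
    whose bracket is a multiple of \<open>w\<close>; the correcting term \<open>co k\<close> is zero
    on degrees with sum above \<open>k\<close>, so the pairings survive.\<close>
  define r1 r2 where "r1 = co (k + 1) w / co k w" and "r2 = co (k + 2) w / co k w"
  define e where "e x y = co (k + 1) (br x y) - r1 * co k (br x y)" for x y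
  define f where "f x y = co (k + 2) (br x y) - r2 * co k (br x y)" for x y
  have bl: "bilinear (\<lambda>x y. co i (br x y) - r * co j (br x y))" for i j r
    unfolding bilinear_def
    by (intro conjI allI linearI) (simp_all add: bilinear_ladd[OF bil] bilinear_radd[OF bil]
        bilinear_lmul[OF bil] bilinear_rmul[OF bil] linear_add[OF lin_co] linear_scale[OF lin_co] algebra_simps)
  have sk: "co i (br x y) = - co i (br y x)" for i x y
    using br_skew[of x y] by (simp add: linear_neg[OF lin_co])
  have brF: "co k (br v v') = 0" if "v \<in> F i" "v' \<in> F j" "k < i + j" for v v' i j
    using br_F[OF that(1,2)] that(3) by (auto simp: F_def)
  have brF1: "co (k + 1) (br v v') = 0" if "v \<in> F i" "v' \<in> F j" "k + 1 < i + j" for v v' i j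
    using br_F[OF that(1,2)] that(3) by (auto simp: F_def)
  have brF2: "co (k + 2) (br v v') = 0" if "v \<in> F i" "v' \<in> F j" "k + 2 < i + j" for v v' i j
    using br_F[OF that(1,2)] that(3) by (auto simp: F_def)
  interpret form_pencil br n X co c k e f m
  proof
    show "bilinear e" "bilinear f" using bl unfolding e_def[abs_def] f_def[abs_def] by blast+
    show "e x y = - e y x" for x y using sk[of _ x y] by (simp add: e_def)
    show "f x y = - f y x" for x y using sk[of _ x y] by (simp add: f_def)
    show "Suc k = 2 * m" by (rule m)
    show "3 \<le> m" using m k5 by simp
    show "e v v' = 0" if "v \<in> F i" "v' \<in> F j" "2 \<le> i" "2 \<le> j" "k + 2 \<le> i + j" for v v' i j
      using brF[OF that(1,2)] brF1[OF that(1,2)] that by (simp add: e_def)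
    show "e v v' = 0" if "v \<in> F m" "v' \<in> F m" for v v'
    proof -
      have "co (m + m) (br v v') = c m m * co m v * co m v'"
        using that m n k5 by (intro co_br_lead) auto
      moreover have "c m m = 0" using m n k5 by (intro c_diag) auto
      moreover have "m + m = k + 1" using m by simp
      ultimately show ?thesis using brF[OF that] m by (simp add: e_def)
    qed
    show "e v v' \<noteq> 0" if "lead i v" "lead j v'" "2 \<le> i" "2 \<le> j" "i + j = Suc k" "i \<noteq> m" for v v' i j
    proof -
      have "co (i + j) (br v v') = c i j * co i v * co j v'"
        using that n by (intro co_br_lead leadD(1)) auto
      moreover have "c i (Suc k - i) \<noteq> 0" using that m n by (intro fullD[OF full_Suc_k]) auto
      moreover have "Suc k - i = j" using that by simp
      moreover have "co k (br v v') = 0" using that by (intro brF[OF leadD(1)[OF that(1)] leadD(1)[OF that(2)]]) auto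
      ultimately show ?thesis using that by (simp add: e_def lead_def)
    qed
    show "f v v' = 0" if "v \<in> F i" "v' \<in> F j" "2 \<le> i" "2 \<le> j" "k + 3 \<le> i + j" for v v' i j
      using brF[OF that(1,2)] brF2[OF that(1,2)] that by (simp add: f_def)
    show "f v v' = 0" if "v \<in> F 2" "v' \<in> F k" for v v'
    proof -
      have "co (2 + k) (br v v') = c 2 k * co 2 v * co k v'" using that n k5 by (intro co_br_lead) auto
      then show ?thesis using c2k brF[OF that] by (simp add: f_def add.commute)
    qed
    show "f v v' \<noteq> 0" if "lead i v" "lead j v'" "3 \<le> i" "3 \<le> j" "i + j = k + 2" for v v' i j
    proof -
      have "co (i + j) (br v v') = c i j * co i v * co j v'"
        using that n by (intro co_br_lead leadD(1)) auto
      moreover have "c i (Suc (Suc k) - i) \<noteq> 0" using that n by (intro row_Suc_Suc_k_nz c2k) auto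
      moreover have "Suc (Suc k) - i = j" using that by simp
      moreover have "co k (br v v') = 0" using that by (intro brF[OF leadD(1)[OF that(1)] leadD(1)[OF that(2)]]) auto
      ultimately show ?thesis using that by (simp add: f_def lead_def)
    qed
  qed
  define N where "N = perp H \<inter> F 2"
  have N: "subspace N" unfolding N_def using subspace_perp subspace_F by (rule subspace_inter)
  have HF: "H \<subseteq> F 2" using tg_F2[OF tg] by blast
  have sum: "\<exists>a\<in>H. y - a \<in> N" if y: "y \<in> F 2" for y
  proof -
    obtain p where p: "p \<in> H" "y - p \<in> perp H" using ex_proj[OF tg_sub[OF tg]] by blast
    have "y - p \<in> F 2" by (rule F_closed(4)[OF y]) (use p HF in blast)
    then show ?thesis using p unfolding N_def by blast
  qed
  have sum': "\<exists>a\<in>N. y - a \<in> H" if y: "y \<in> F 2" for y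
  proof -
    obtain p where p: "p \<in> H" "y - p \<in> N" using sum[OF y] by blast
    then show ?thesis by (intro bexI[of _ "y - p"]) auto
  qed
  have orth: "e y x = 0 \<and> f y x = 0" if x: "x \<in> H" and y: "y \<in> N" for x y
  proof -
    have "br y x \<in> F (?t - 2)" using br_low[of y x] x y HF by (auto simp: N_def)
    then obtain r where r: "br y x - r *\<^sub>R w \<in> F (Suc ?t)"
      using nc_plane_br[OF nc' t1 _ _ x, of y] y by (auto simp: N_def w_def)
    have "co i (br y x) = r * co i w" if "i \<le> k + 2" for i
    proof -
      have "co i (br y x - r *\<^sub>R w) = 0" using r that by (auto simp: F_def)
      then show ?thesis by (simp add: linear_diff[OF lin_co] linear_scale[OF lin_co])
    qed
    then show ?thesis using lw by (simp add: e_def f_def r1_def r2_def lead_def)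
  qed
  have orth': "e x y = 0 \<and> f x y = 0" if x: "x \<in> H" and y: "y \<in> N" for x y
    using orth[OF that] e_skew[of x y] f_skew[of x y] by simp
  obtain x1 where x1: "x1 \<in> H" "lead (?t - 1) x1" using t1 by (rule D_obtain)
  have proj_k: "\<exists>h\<in>H. h \<in> F k \<and> v - h \<in> perp H" if v: "v \<in> F k" for v
  proof -
    have "v \<in> F (?t - 2)" using v by simp
    then obtain \<alpha> \<beta> \<gamma> where abc: "v - ((\<alpha> + \<gamma>) *\<^sub>R z + \<beta> *\<^sub>R x1) - \<gamma> *\<^sub>R (X ?t - z) \<in> F (Suc ?t)"
      using nc_decomp[OF nc' x1] by blast
    define p where "p = (\<alpha> + \<gamma>) *\<^sub>R z + \<beta> *\<^sub>R x1"
    have "p \<in> H" using z x1 tg_closed[OF tg] by (simp add: p_def)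
    moreover have "x1 \<in> F k" using F_mono[OF _ leadD(1)[OF x1(2)]] by simp
    then have "p \<in> F k" using leadD(1)[OF nc_lead[OF nc]] F_closed by (simp add: p_def)
    moreover have "(v - p - \<gamma> *\<^sub>R (X ?t - z)) + \<gamma> *\<^sub>R (X ?t - z) \<in> perp H"
      using tg_perp[OF tg abc] z(2) perp_closed by (simp only: p_def)
    then have "v - p \<in> perp H" by simp
    ultimately show ?thesis by blast
  qed
  obtain u where u: "lead m u" "\<forall>y\<in>F 2. e u y = 0" by (rule e_kernel_ex)
  have m3: "3 \<le> m" "m < k" using m k5 by auto
  have uF: "u \<in> F 2" using F_mono[OF _ leadD(1)[OF u(1)]] m3 by simp
  obtain p where p: "p \<in> H" "u - p \<in> N" using sum[OF uF] by blast
  have ker: "e p y = 0 \<and> e (u - p) y = 0" if y: "y \<in> F 2" for y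
  proof -
    obtain b where b: "b \<in> H" "y - b \<in> N" using sum[OF y] by blast
    have "e p (y - b) = 0" "e (u - p) b = 0" using orth' orth p b by auto
    moreover have "e u b = 0" "e u y = 0" using u(2) b HF y by auto
    ultimately show ?thesis by (simp add: bilinear_rsub[OF e_bil] bilinear_lsub[OF e_bil])
  qed
  have "u \<notin> F k" using lead_F[OF u(1)] m3 by fastforce
  then have "p \<notin> F k \<or> u - p \<notin> F k" using F_closed(2)[of p k "u - p"] by auto
  then show False
  proof
    assume "p \<notin> F k"
    then have lp: "lead m p" using e_kernel_lead[of p] p HF ker by blast
    have NF: "y \<in> F k" if y: "y \<in> N" for y
    proof -
      obtain a where a: "a \<in> H" "y - a \<in> F k"
        using split_absorb[OF tg_sub[OF tg] HF _ sum orth' p(1) lp _ y] ker by (auto simp: N_def)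
      obtain h where h: "h \<in> H" "h \<in> F k" "y - a - h \<in> perp H" using proj_k[OF a(2)] by blast
      have "a + h \<in> H" using a h tg_closed[OF tg] by blast
      moreover have "y - (y - a - h) \<in> perp H"
        by (rule perp_closed(4)[OF _ h(3)]) (use y in \<open>simp add: N_def\<close>)
      then have "a + h \<in> perp H" by (simp add: algebra_simps)
      ultimately have "a + h = 0" by (rule perp_int)
      then have "a = - h" by (simp add: eq_neg_iff_add_eq_0)
      then have "y = (y - a) - h" by simp
      then show ?thesis using a(2) h(2) F_closed(4) by metis
    qed
    obtain H' where H': "tg (?t - 3) H'" "D H' = D H \<inter> {..<?t - 2}" "M (?t - 3) H' = M ?t H \<inter> {..<?t - 2}"
      by (rule nc_plane_descend[OF nc' t1])
    \<comment> \<open>If \<open>H\<close> absorbs \<open>N\<close>, all of \<open>{2..k - 1}\<close>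
      is tangential; but 3 and \<open>k - 1\<close> are paired in row \<open>k + 2\<close>.\<close>
    have "M ?t H \<inter> {..<k} = {}"
    proof -
      have "i \<notin> M ?t H" if "i < k" for i
      proof
        assume "i \<in> M ?t H"
        then obtain y where y: "y \<in> perp H" "lead i y" "2 \<le> i" by (auto simp: M_def elim!: D_obtain)
        then have "y \<in> N" using F_mono[OF y(3) leadD(1)[OF y(2)]] by (simp add: N_def)
        then show False using NF lead_F[OF y(2)] that by fastforce
      qed
      then show ?thesis by blast
    qed
    moreover have e: "?t - 3 = k - 1" by simp
    ultimately have "card (D H') = k - 2" using tg_card[OF H'(1)] H'(3) k5 by simp
    moreover have "D H' \<subseteq> {2..k - 1}" using tg_D[OF H'(1)] e by simp
    moreover have "card {2..k - 1} = k - 2" using k5 by simp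
    ultimately have "D H' = {2..k - 1}" by (intro card_subset_eq) auto
    moreover have "3 \<in> {2..k - 1}" "k - 1 \<in> {2..k - 1}" using k5 by auto
    ultimately have "3 \<in> D H" "k - 1 \<in> D H" using H'(2) by blast+
    moreover have "?t - 3 = k - 1" by simp
    ultimately have "c 3 (?t - 3) = 0" using nc_HH[OF tg nc_t(2)[OF nc], of 3] by simp
    then show False using row_Suc_Suc_k_nz[OF _ c2k, of 3] n k5 by simp
  next
    \<comment> \<open>If \<open>N\<close> absorbs \<open>H\<close>, the vector of leading degree 2
      in \<open>H\<close> would lie in \<open>F k\<close>.\<close>
    assume "u - p \<notin> F k"
    then have lp: "lead m (u - p)" using e_kernel_lead[of "u - p"] p ker by (auto simp: N_def)
    obtain y where y: "y \<in> H" "lead 2 y" using D(2) by (rule D_obtain)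
    have NF: "N \<subseteq> F 2" by (auto simp: N_def)
    obtain a where a: "a \<in> N" "y - a \<in> F k"
      using split_absorb[OF N NF HF sum' orth p(2) lp _ y(1)] ker by blast
    obtain h where h: "h \<in> H" "h \<in> F k" "y - a - h \<in> perp H" using proj_k[OF a(2)] by blast
    have "(y - a - h) + a \<in> perp H"
      by (rule perp_closed(2)[OF h(3)]) (use a in \<open>simp add: N_def\<close>)
    then have "y - h \<in> perp H" by simp
    moreover have "y - h \<in> H" using y h tg_closed[OF tg] by blast
    ultimately have "y - h = 0" using perp_int by blast
    then have "y \<in> F k" using h by simp
    then show False using lead_F[OF y(2)] k5 by fastforce
  qed
qed

end

section \<open>The bound for first nonabelian degree at least 7\<close>

context graded_filiform_k_ip
begin

lemma nc_strict_Suc_Suc_k: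
  assumes n: "k + 2 \<le> n" and c2k: "c 2 k = 0" shows "nc_strict (k + 2)"
  unfolding nc_strict_def
proof (intro allI impI)
  fix H a z assume nc: "nc (k + 2) H a z"
  show "2 * card (D H) < k + 2"
  proof (rule ccontr)
    assume "\<not> ?thesis"
    then have big: "k + 2 \<le> 2 * card (D H)" by simp
    have row: "c i (k + 2 - i) \<noteq> 0" if "2 \<le> i" "i + 2 \<le> k + 2" "i \<noteq> 2" "i \<noteq> k + 2 - 2" for i
      using row_Suc_Suc_k_nz[OF _ c2k, of i] that n by simp
    have "{2, k + 2 - 2, k + 2 - 1} \<subseteq> D H \<and> (2 = (2::nat) \<and> a = k + 2 - 2 \<or> a = 2 \<and> k + 2 = 2 * 2 + 1)"
      by (rule single_pair[OF nc _ _ _ _ row big]) (use k_odd k5 in auto)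
    then have "a = k" "k + 1 \<in> D H" "2 \<in> D H" using k5 by auto
    then show False using no_plane[OF n c2k] nc by blast
  qed
qed

text \<open>The critical case has \<open>k + 2\<close> and \<open>k\<close> tangential and
  \<open>k + 1\<close> normal. For \<open>k = 5\<close>, \<open>level_k_tangent\<close> is enough;
  otherwise all tangential degrees up to \<open>k - 2\<close> turn out to be even, which halves
  their number.\<close>

lemma bounded_Suc_Suc_k:
  assumes n: "k + 2 \<le> n" and N: "nc_bounded (k + 2)" shows "bounded (k + 2)"
  unfolding bounded_def
proof (intro allI impI)
  fix H assume tg: "tg (k + 2) H"
  have t2: "2 \<le> k + 2" "2 \<le> k + 1" and e: "k + 2 - 1 = k + 1" "k + 1 - 1 = k" using k5 by auto
  consider (h) "k + 2 \<in> D H" | (m) "k + 2 \<in> D (perp H)" | (n) "k + 2 \<notin> D H" "k + 2 \<notin> D (perp H)" by blast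
  then show "2 * card (D H) \<le> k + 2"
  proof cases
    case m
    obtain H1 where H1: "tg (Suc k) H1" "D H1 = D H - {k + 2}"
      using descend_top_ex[OF tg t2(1)] m by auto
    then have "D H1 = D H" using D_disjoint_top[OF tg m] by blast
    then show ?thesis using bounded_Suc_k H1(1) n unfolding bounded_def by fastforce
  next
    case n
    then obtain a z where "nc (k + 2) H a z" using nc_ex[OF tg _ n] by auto
    then show ?thesis using N by (auto simp: nc_bounded_def)
  next
    case h
    obtain H1 where H1: "tg (k + 1) H1" "D H1 = D H - {k + 2}" "M (k + 1) H1 = M (k + 2) H - {k + 2}"
      using descend_top_ex[OF tg t2(1)] h unfolding e by blast
    have c1: "card (D H) = card (D H1) + 1" using card_Suc_Diff1[OF finite_D h] H1(2) by simp
    have t1: "k + 1 \<notin> D H1" using consec[OF tg h] H1 k5 by simp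
    show ?thesis
    proof (cases "k + 1 \<in> D (perp H1)")
      case False
      obtain a z where nc: "nc (Suc k) H1 a z" using nc_ex[OF H1(1) _ t1 False] by auto
      have "2 * card (D H1) + 2 \<le> Suc k" using full_nc(2)[OF nc full_Suc_k] n k5 by simp
      then show ?thesis using c1 by simp
    next
      case True
      obtain H2 where H2: "tg k H2" "D H2 = D H1 - {k + 1}" "M k H2 = M (k + 1) H1 - {k + 1}"
        using descend_top_ex[OF H1(1) t2(2)] True unfolding e by blast
      have D2: "D H2 = D H - {k + 2}" using H2 H1 t1 by blast
      have c2: "card (D H) = card (D H2) + 1" using card_Suc_Diff1[OF finite_D h] D2 by simp
      show ?thesis
      proof (cases "k \<in> D H2")
        case False
        then have "2 * card (D H2) + 1 \<le> k" using level_k_or[OF H2(1)] level_k_perp[OF H2(1)] by blast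
        then show ?thesis using c2 by simp
      next
        case True
        show ?thesis
        proof (cases "k = 5")
          case k: True
          have "card (D H2) + 4 \<le> k" by (rule level_k_tangent[OF H2(1) True])
          then show ?thesis using c2 k by simp
        next
          case False
          then have k7: "7 \<le> k" using k5 k_odd by presburger
          have c2k: "c 2 k = 0" using c_2_k k7 n by simp
          have i22: "2 \<le> (2::nat)" "2 + 2 \<le> k" using k5 by auto
          note L = level_k_tangent_M[OF H2(1) True]
          note L' = L(2-5)[OF i22]
          let ?A = "D H2 \<inter> {2..k - 2}"
          have Msub: "j \<in> D (perp H)" if "j \<in> M k H2" for j using that unfolding H2(3) H1(3) by (blast intro: M_fin(3))
          have no: "j \<notin> M k H2" if "i \<in> ?A" "i + j = k + 2" "3 \<le> j" "3 \<le> i" for i j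
          proof
            assume "j \<in> M k H2"
            then have "c j i = 0" using HM[OF tg h, of i j] Msub that D2 by blast
            moreover have "c j (Suc (Suc k) - j) \<noteq> 0" using that n k5 by (intro row_Suc_Suc_k_nz[OF _ c2k]) auto
            moreover have "Suc (Suc k) - j = i" using that by simp
            ultimately show False by simp
          qed
          \<comment> \<open>An odd tangential \<open>i\<close> has a reflection
            \<open>k + 2 - i\<close> that is not normal, so \<open>i - 2\<close> is tangential by
            row \<open>k\<close>; the descent stops at 3, whose reflection \<open>k - 1\<close> is
            normal.\<close>
          have "even i" if "i \<in> ?A" for i
            using that
          proof (induction i rule: less_induct)
            case (less i)
            show ?case
            proof (rule ccontr)
              assume odd: "odd i"
              have i: "2 \<le> i" "i + 2 \<le> k" using less.prems k5 by auto
              then have i3: "3 \<le> i" using odd by presburger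
              show False
              proof (cases "i = 3")
                case True
                then show False using no[OF less.prems, of "k - 1"] L'(1) k5 by simp
              next
                case False
                then have i4: "4 \<le> i" using i3 by simp
                define j where "j = k + 2 - i"
                have j: "i + j = k + 2" "2 \<le> j" "j + 2 \<le> k" "3 \<le> j" "k - j = i - 2" using i i4 by (auto simp: j_def)
                have "j \<notin> M k H2" by (rule no[OF less.prems j(1) j(4) i3])
                then have "i - 2 \<in> D H2" using L(1)[OF j(2,3)] j(5) by simp
                then have "i - 2 \<in> ?A" using i i4 by auto
                then have "even (i - 2)" by (intro less.IH) (use i4 in auto)
                then show False using odd i4 by presburger
              qed
            qed
          qed
          then have "?A \<subseteq> (\<lambda>x. 2 * x) ` {1..(k - 3) div 2}"
          proof (intro subsetI)
            fix i assume i: "i \<in> ?A" and ev: "\<And>i. i \<in> ?A \<Longrightarrow> even i"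
            obtain x where x: "i = 2 * x" using ev[OF i] by (elim evenE)
            have "2 \<le> i" "i \<le> k - 2" using i by auto
            then have "1 \<le> x" "x \<le> (k - 3) div 2" using x k_odd k5 by presburger+
            then have "x \<in> {1..(k - 3) div 2}" by simp
            then show "i \<in> (\<lambda>x. 2 * x) ` {1..(k - 3) div 2}" using x by blast
          qed
          then have "card ?A \<le> card ((\<lambda>x. 2 * x) ` {1..(k - 3) div 2})" by (intro card_mono) auto
          also have "\<dots> \<le> (k - 3) div 2" using card_image_le[of "{1..(k - 3) div 2}" "\<lambda>x. 2 * x"] by simp
          finally have "2 * card ?A + 3 \<le> k" using k5 by linarith
          then show ?thesis using L'(3) c2 by simp
        qed
      qed
    qed
  qed
qed

lemma bounded_k_ge_7: assumes k: "7 \<le> k" and t: "k < t" "t \<le> n" shows "bounded t"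
proof -
  have B1: "bounded (Suc k)" using t by (intro bounded_Suc_k) simp
  have S2: "nc_strict (k + 2)" if "k + 2 \<le> n" using that c_2_k k by (intro nc_strict_Suc_Suc_k) auto
  then have B2: "bounded (k + 2)" if "k + 2 \<le> n" using that by (intro bounded_Suc_Suc_k nc_strict_bounded) auto
  consider "t = Suc k" | "t = k + 2" | "k + 3 \<le> t" using t by linarith
  then show ?thesis
  proof cases
    case 3
    then have "\<not> 9 \<le> k" using k_ge_9 t by auto
    then have k7: "k = 7" using k k_odd by presburger
    then have t11: "t = 10 \<or> t = 11" using k7_n t 3 by linarith
    have n10: "10 \<le> n" using t11 t by auto
    have 8: "bounded 8" and 9: "bounded 9" "nc_strict 9" using B1 B2 S2 k7 n10 by (simp_all add: eval_nat_numeral)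
    have S10: "nc_strict 10" using k7_full(1)[OF k7 n10] by (rule full_strict) simp
    have 10: "bounded 10"
      by (rule bounded_step) (use 8 9 S10 nc_strict_bounded in auto)
    have "bounded 11" if n11: "11 \<le> n"
    proof -
      have S11: "nc_strict 11" using k7_full(2)[OF k7 n11] by (rule full_strict) simp
      show ?thesis
        by (rule bounded_step) (use 9 10 S10 S11 nc_strict_bounded in auto)
    qed
    then show ?thesis using 10 t11 t by auto
  qed (use B1 B2 t in auto)
qed

end

section \<open>Three consecutive tangential degrees below the top\<close>

context graded_filiform_ip
begin

text \<open>For a normal \<open>y\<close> of degree 1 the form \<open>ip (br y u) v\<close> is skew
  on the three-dimensional span of \<open>z\<close>, \<open>x1\<close>, \<open>x2\<close> and so has
  a nonzero radical vector \<open>e\<close>. Then \<open>br y e\<close> has no tangential part and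
  lies in \<open>F (t + 1)\<close>, although \<open>ad y\<close> raises the leading degree of
  \<open>e\<close>, which is below \<open>t\<close>, by exactly one.\<close>

lemma nc_no_triple:
  assumes nc: "nc t H (t - 3) z" and D: "t - 2 \<in> D H" "t - 1 \<in> D H" shows False
proof -
  note tg = nc_tg[OF nc] and z = nc_z[OF nc]
  have t5: "5 \<le> t" using nc_a[OF nc] by simp
  have S: "Suc (t - 3) = t - 2" "Suc (t - 2) = t - 1" "Suc (t - 1) = t" using t5 by auto
  obtain x1 where x1: "x1 \<in> H" "lead (t - 2) x1" using D(1) by (rule D_obtain)
  obtain x2 where x2: "x2 \<in> H" "lead (t - 1) x2" using D(2) by (rule D_obtain)
  obtain y where y: "y \<in> perp H" "lead 1 y" using one_in_perp[OF tg] by blast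
  have lz: "lead (t - 3) z" by (rule nc_lead[OF nc])
  have indep: "a = 0 \<and> b = 0 \<and> g = 0" if s: "a *\<^sub>R z + b *\<^sub>R x1 + g *\<^sub>R x2 = 0" for a b g
  proof -
    have c0: "co i (a *\<^sub>R z + b *\<^sub>R x1 + g *\<^sub>R x2) = 0" for i unfolding s by (rule linear_0[OF lin_co])
    have e: "co i (a *\<^sub>R z + b *\<^sub>R x1 + g *\<^sub>R x2) = a * co i z + b * co i x1 + g * co i x2" for i
      by (simp add: linear_add[OF lin_co] linear_scale[OF lin_co])
    have "co (t - 3) x1 = 0" "co (t - 3) x2 = 0" "co (t - 2) x2 = 0"
      using x1(2) x2(2) t5 by (auto simp: lead_def F_def)
    then have "a = 0" using c0[of "t - 3"] e[of "t - 3"] lz by (simp add: lead_def)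
    then have "b = 0" using c0[of "t - 2"] e[of "t - 2"] x1(2) \<open>co (t - 2) x2 = 0\<close> by (simp add: lead_def)
    then have "g = 0" using c0[of "t - 1"] e[of "t - 1"] x2(2) \<open>a = 0\<close> by (simp add: lead_def)
    then show ?thesis using \<open>a = 0\<close> \<open>b = 0\<close> by simp
  qed
  define A where "A u v = ip (br y u) v" for u v
  have sk: "A u v = - A v u" if "u \<in> H" "v \<in> H" for u v
    unfolding A_def by (rule tg_skew[OF tg y(1) that])
  have A0: "A u u = 0" if "u \<in> H" for u using sk[OF that that] by simp
  have Alin: "A (a *\<^sub>R z + b *\<^sub>R x1 + g *\<^sub>R x2) v = a * A z v + b * A x1 v + g * A x2 v" for a b g v
    unfolding A_def bilinear_radd[OF bil] bilinear_rmul[OF bil] bilinear_ladd[OF ip_bil] bilinear_lmul[OF ip_bil] by simp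
  \<comment> \<open>The radical of a nonzero skew 3 by 3 matrix is spanned by the vector of its
    three entries; the zero matrix is treated apart.\<close>
  have "\<exists>a b g. (a, b, g) \<noteq> (0, 0, 0) \<and> (\<forall>v\<in>{z, x1, x2}. a * A z v + b * A x1 v + g * A x2 v = 0)"
  proof (cases "(A x1 x2, A x2 z, A z x1) = (0, 0, 0)")
    case True
    then have "\<forall>v\<in>{z, x1, x2}. 1 * A z v + 0 * A x1 v + 0 * A x2 v = 0"
      using A0[OF z(1)] sk[OF z(1) x2(1)] by simp
    then show ?thesis by (metis zero_neq_one Pair_inject)
  next
    case False
    have "\<forall>v\<in>{z, x1, x2}. A x1 x2 * A z v + A x2 z * A x1 v + A z x1 * A x2 v = 0"
      using A0[OF z(1)] A0[OF x1(1)] A0[OF x2(1)] sk[OF z(1) x2(1)] sk[OF x1(1) z(1)] sk[OF x2(1) x1(1)] by simp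
    then show ?thesis using False by blast
  qed
  then obtain a b g where abg: "(a, b, g) \<noteq> (0, 0, 0)" "\<forall>v\<in>{z, x1, x2}. a * A z v + b * A x1 v + g * A x2 v = 0"
    by blast
  define e where "e = a *\<^sub>R z + b *\<^sub>R x1 + g *\<^sub>R x2"
  have eA: "ip (br y e) v = 0" if "v \<in> {z, x1, x2}" for v
    using bspec[OF abg(2) that] Alin[of a b g v] by (simp add: A_def e_def)
  have eF: "e \<in> F (t - 3)"
    using leadD(1)[OF lz] F_mono[OF _ leadD(1)[OF x1(2)]] F_mono[OF _ leadD(1)[OF x2(2)]] F_closed
    by (simp add: e_def)
  have "br y e \<in> F (t - 2)" using br_F'[OF leadD(1)[OF y(2)] eF] t5 by simp
  then obtain \<beta> where b: "br y e - \<beta> *\<^sub>R x1 \<in> F (t - 1)" using reduce[OF x1(2)] S by metis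
  obtain \<gamma> where c: "br y e - \<beta> *\<^sub>R x1 - \<gamma> *\<^sub>R x2 \<in> F t" using reduce[OF x2(2) b] S by metis
  obtain \<delta> where d: "br y e - \<beta> *\<^sub>R x1 - \<gamma> *\<^sub>R x2 - \<delta> *\<^sub>R X t \<in> F (Suc t)"
    using reduce_X[OF c nc_t(1)[OF nc] tg_le[OF tg]] by blast
  define p where "p = \<delta> *\<^sub>R z + \<beta> *\<^sub>R x1 + \<gamma> *\<^sub>R x2"
  have "ip p v = 0" if v: "v \<in> {z, x1, x2}" for v
  proof -
    have vH: "v \<in> H" using v z x1 x2 by auto
    have "ip (br y e - \<beta> *\<^sub>R x1 - \<gamma> *\<^sub>R x2 - \<delta> *\<^sub>R X t) v = 0" using tg_perp[OF tg d] perpD vH by blast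
    then have "ip (br y e) v - \<beta> * ip x1 v - \<gamma> * ip x2 v - \<delta> * ip (X t) v = 0"
      by (simp add: bilinear_lsub[OF ip_bil] bilinear_lmul[OF ip_bil])
    then show ?thesis using eA[OF v] nc_ip[OF nc vH]
      by (simp add: p_def bilinear_ladd[OF ip_bil] bilinear_lmul[OF ip_bil])
  qed
  then have "\<delta> * ip p z + \<beta> * ip p x1 + \<gamma> * ip p x2 = 0" by simp
  then have "ip p p = 0"
    by (subst (2) p_def) (simp add: bilinear_radd[OF ip_bil] bilinear_rmul[OF ip_bil])
  then have "\<delta> = 0 \<and> \<beta> = 0 \<and> \<gamma> = 0" by (intro indep) (simp add: ip_eq_0 flip: p_def)
  then have ye: "br y e \<in> F (Suc t)" using d by simp
  have "e \<noteq> 0" using indep[of a b g] abg(1) by (auto simp: e_def)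
  then obtain i where i: "lead i e" "t - 3 \<le> i" by (rule ex_lead[OF _ eF])
  have eH: "e \<in> H" by (simp add: e_def z(1) x1(1) x2(1) tg_closed[OF tg])
  have "i \<le> t" "i \<noteq> t" using D_bounds(2)[OF tg D_I[OF eH i(1)]] nc_t(2)[OF nc] D_I[OF eH i(1)] by auto
  then have it: "1 + i \<le> t" by simp
  have "c 1 i = 1" using it i t5 tg_le[OF tg] by (intro c1) auto
  then have "lead (1 + i) (br y e)" using lead_br[OF y(2) i(1)] it tg_le[OF tg] by simp
  then show False using lead_F[OF _ ye] it by fastforce
qed

end

section \<open>The bound for first nonabelian degree 5\<close>

lemma card_sum_of_bool: "finite B \<Longrightarrow> A \<subseteq> B \<Longrightarrow> card A = (\<Sum>i\<in>B. of_bool (i \<in> A))"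
  by (simp add: sum_of_bool_eq Int_absorb1)

lemma sum_numeral_range:
  fixes f :: "nat \<Rightarrow> nat"
  shows "(\<Sum>i=2..6. f i) = f 2 + f 3 + f 4 + f 5 + f 6"
    "(\<Sum>i=2..8. f i) = f 2 + f 3 + f 4 + f 5 + f 6 + f 7 + f 8"
    "(\<Sum>i=2..7. f i) = f 2 + f 3 + f 4 + f 5 + f 6 + f 7"
    "(\<Sum>i=2..9. f i) = f 2 + f 3 + f 4 + f 5 + f 6 + f 7 + f 8 + f 9"
    "(\<Sum>i=2..10. f i) = f 2 + f 3 + f 4 + f 5 + f 6 + f 7 + f 8 + f 9 + f 10"
  by (simp_all add: sum.atLeast_Suc_atMost eval_nat_numeral)

lemma of_bool_cases: "(of_bool P :: nat) = 0 \<or> (of_bool P :: nat) = 1" "of_bool P \<le> (1::nat)"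
  by simp_all

lemma of_bool_eq_Suc_0 [simp]: "(of_bool P :: nat) = Suc 0 \<longleftrightarrow> P"
  by (cases P) simp_all

context graded_filiform_ip
begin

abbreviation "ind H i \<equiv> (of_bool (i \<in> D H) :: nat)"

lemma card_D_nc: assumes nc: "nc t H a z" and t: "t = Suc m" shows "card (D H) = (\<Sum>i=2..m. ind H i)"
proof (rule card_sum_of_bool)
  show "D H \<subseteq> {2..m}"
  proof
    fix i assume i: "i \<in> D H"
    then have "2 \<le> i" "i \<le> t" "i \<noteq> t" using D_bounds[OF nc_tg[OF nc]] nc_t(2)[OF nc] by auto
    then show "i \<in> {2..m}" using t by simp
  qed
qed simp

lemma ind_HH: "tg t H \<Longrightarrow> i + j \<le> t \<Longrightarrow> c i j \<noteq> 0 \<Longrightarrow> ind H i + ind H j \<le> 1 + ind H (i + j)"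
  using HH[of t H i j] by (auto simp: of_bool_def)

lemma ind_top: "nc t H a z \<Longrightarrow> i + j = t \<Longrightarrow> c i j \<noteq> 0 \<Longrightarrow> ind H i + ind H j \<le> 1"
  using ind_HH[OF nc_tg, of t H a z i j] nc_t(2)[of t H a z] by simp

lemma ind_row: "nc t H a z \<Longrightarrow> a + j \<le> t \<Longrightarrow> c a j \<noteq> 0 \<Longrightarrow> ind H j = 0"
  using nc_row[of t H a z j] by auto

lemma ind_plane:
  "nc t H (t - 2) z \<Longrightarrow> t - 1 \<in> D H \<Longrightarrow> t - 1 \<le> i + j \<Longrightarrow> i + j \<le> t \<Longrightarrow> c j i \<noteq> 0 \<Longrightarrow>
    ind H i + of_bool (j \<in> M t H) \<le> (1::nat)"
  using nc_plane_HM[of t H z i j] by (auto simp: of_bool_def)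

end

locale graded_filiform_5_ip = graded_filiform_5 br n X co c + graded_filiform_k_ip br n X co c 5 ip
  for br :: "'a::real_vector \<Rightarrow> 'a \<Rightarrow> 'a" and n X co c ip
begin

lemma c_nz_sym: "c i j \<noteq> 0 \<Longrightarrow> 1 \<le> i \<Longrightarrow> 1 \<le> j \<Longrightarrow> i + j \<le> n \<Longrightarrow> c j i \<noteq> 0"
  using c_skew[of i j] by simp

lemma bounded_6: "6 \<le> n \<Longrightarrow> bounded 6"
  using bounded_Suc_k by simp

lemma level_5: assumes "tg 5 H" shows "card (D H) \<le> 2"
  using level_k_or[OF assms] level_k_perp[OF assms] level_k_tangent[OF assms] by linarith

lemma row_6_7:
  "6 \<le> n \<Longrightarrow> c 2 4 \<noteq> 0" "c 2 3 \<noteq> 0"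
  using row6 c23 by auto

lemma nc_card_plane:
  assumes nc: "nc t H (t - 2) z" and D: "t - 1 \<in> D H"
  obtains H' where "tg (t - 3) H'" "card (D H) = card (D H') + 2" "D H' = D H \<inter> {..<t - 2}"
    "M (t - 3) H' = M t H \<inter> {..<t - 2}"
proof -
  obtain H' where H': "tg (t - 3) H'" "D H' = D H \<inter> {..<t - 2}" "M (t - 3) H' = M t H \<inter> {..<t - 2}"
    by (rule nc_plane_descend[OF nc D])
  have t: "4 \<le> t" using nc_a(1)[OF nc] by simp
  have "D H = (D H \<inter> {..<t - 2}) \<union> {t - 2, t - 1}"
  proof (intro equalityI subsetI)
    fix i assume i: "i \<in> D H"
    then have "i \<le> t" "i \<noteq> t" using D_bounds(2)[OF nc_tg[OF nc] i] nc_t(2)[OF nc] by auto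
    then have "i < t - 2 \<or> i = t - 2 \<or> i = t - 1" by linarith
    then show "i \<in> (D H \<inter> {..<t - 2}) \<union> {t - 2, t - 1}" using i by blast
  next
    fix i assume "i \<in> (D H \<inter> {..<t - 2}) \<union> {t - 2, t - 1}"
    then show "i \<in> D H" using D nc_aH[OF nc] by blast
  qed
  then have "card (D H) = card ((D H \<inter> {..<t - 2}) \<union> {t - 2, t - 1})" by (rule arg_cong)
  also have "\<dots> = card (D H \<inter> {..<t - 2}) + card {t - 2, t - 1}"
    using finite_D[of H] t by (intro card_Un_disjoint) auto
  also have "card {t - 2, t - 1} = 2" using t by simp
  finally have "card (D H) = card (D H') + 2" unfolding H'(2) .
  then show thesis by (rule that[OF H'(1) _ H'(2,3)])
qed

text \<open>At \<open>s = 1/2\<close> the only zero pair of row 8 is 2, 6. A violation forces 2, 4,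
  6, 7 to be tangential and \<open>a = 6\<close>; splitting off the plane then leads to level 5,
  where at most two degrees are tangential.\<close>

lemma nc_bounded_8:
  assumes n: "8 \<le> n" and s: "s = 1 / 2" shows "nc_bounded 8"
  unfolding nc_bounded_def
proof (intro allI impI, rule ccontr)
  fix H a z assume nc: "nc 8 H a z" and "\<not> 2 * card (D H) \<le> 8"
  then have big: "5 \<le> card (D H)" by simp
  have r: "c 2 4 = 1" "c 3 5 = 1 / 2" "c 2 6 = 0" using row6 row8 s n by simp_all
  have 35: "ind H 3 + ind H 5 \<le> 1" using ind_top[OF nc, of 3 5] r by simp
  have cd: "card (D H) = ind H 2 + ind H 3 + ind H 4 + ind H 5 + ind H 6 + ind H 7"
    using card_D_nc[OF nc, of 7] sum_numeral_range by simp
  note b = of_bool_cases(2)[of "2 \<in> D H"] of_bool_cases(2)[of "4 \<in> D H"] of_bool_cases(2)[of "6 \<in> D H"] of_bool_cases(2)[of "7 \<in> D H"]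
  have 1: "ind H 2 = 1" "ind H 4 = 1" "ind H 6 = 1" "ind H 7 = 1" using big 35 cd b by linarith+
  have "a \<le> 6" "2 \<le> a" using nc_a_le[OF nc] nc_a[OF nc] by auto
  then have "a = 2 \<or> a = 3 \<or> a = 4 \<or> a = 5 \<or> a = 6" by linarith
  moreover have "a \<noteq> 3" using nc_c'[OF nc] r by auto
  moreover have "a \<noteq> 5" using nc_c[OF nc] r by auto
  moreover have "a \<noteq> 2" using ind_row[OF nc, of 4] r 1 by auto
  moreover have "a \<noteq> 4" using ind_row[OF nc, of 2] c_skew[of 2 4] r 1 n by auto
  ultimately have a: "a = 6" by blast
  have "nc 8 H (8 - 2) z" "8 - 1 \<in> D H" using nc a 1 by simp_all
  then obtain H' where "tg (8 - 3) H'" "card (D H) = card (D H') + 2" by (rule nc_card_plane)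
  then show False using level_5[of H'] big by simp
qed

text \<open>The exceptional values are \<open>s = 1\<close> with zero pair 3, 6, excluded by
  \<open>single_pair\<close>, and \<open>s = 2/5\<close> with zero pair 2, 7. There
  \<open>a = 7\<close>, and after descending to level 6 the constraints from
  \<open>ind_plane\<close>, closure and row 9 are contradictory.\<close>

lemma nc_strict_9:
  assumes n: "9 \<le> n" and s0: "s \<noteq> 0" shows "nc_strict 9"
proof -
  note nz = nonzero_rows[OF s0]
  have q0: "q \<noteq> 0" using nz n by simp
  consider "s = 1" | "s = 2 / 5" | "full 9" using full9 n s0 by blast
  then show ?thesis
  proof cases
    case 1
    show ?thesis
      unfolding nc_strict_def
    proof (intro allI impI, rule ccontr)
      fix H a z assume nc: "nc 9 H a z" and "\<not> 2 * card (D H) < 9"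
      then have big: "9 \<le> 2 * card (D H)" by simp
      have c27: "c 2 7 \<noteq> 0" using nz(3) n 1 by simp
      have row: "c i (9 - i) \<noteq> 0" if "2 \<le> i" "i + 2 \<le> 9" "i \<noteq> 3" "i \<noteq> 9 - 3" for i
      proof -
        have "i = 2 \<or> i = 4 \<or> i = 5 \<or> i = 7" using that by arith
        then show ?thesis using c27 q0 c_nz_sym[OF c27] c_nz_sym[OF q0] n by auto
      qed
      have "{3, 9 - 3, 9 - 1} \<subseteq> D H \<and> (3 = (2::nat) \<and> a = 9 - 2 \<or> a = 3 \<and> 9 = 2 * 3 + (1::nat))"
        by (rule single_pair[OF nc _ _ _ _ row big]) simp_all
      then show False by simp
    qed
  next
    case 3
    then show ?thesis by (rule full_strict) simp
  next
    case 2
    show ?thesis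
      unfolding nc_strict_def
    proof (intro allI impI, rule ccontr)
      fix H a z assume nc: "nc 9 H a z" and "\<not> 2 * card (D H) < 9"
      then have big: "9 \<le> 2 * card (D H)" by simp
      have c36: "c 3 6 \<noteq> 0" using nz(2) n 2 by simp
      have row: "c i (9 - i) \<noteq> 0" if "2 \<le> i" "i + 2 \<le> 9" "i \<noteq> 2" "i \<noteq> 9 - 2" for i
      proof -
        have "i = 3 \<or> i = 4 \<or> i = 5 \<or> i = 6" using that by arith
        then show ?thesis using c36 q0 c_nz_sym[OF c36] c_nz_sym[OF q0] n by auto
      qed
      have "{2, 9 - 2, 9 - 1} \<subseteq> D H \<and> (2 = (2::nat) \<and> a = 9 - 2 \<or> a = 2 \<and> 9 = 2 * 2 + (1::nat))"
        by (rule single_pair[OF nc _ _ _ _ row big]) simp_all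
      then have "{2, 7, 8} \<subseteq> D H \<and> a = 7" by simp
      then have D: "2 \<in> D H" "7 \<in> D H" "8 \<in> D H" and nc': "nc 9 H (9 - 2) z" and D8: "9 - 1 \<in> D H" using nc by auto
      obtain H' where H': "tg (9 - 3) H'" "card (D H) = card (D H') + 2" "D H' = D H \<inter> {..<9 - 2}" "M (9 - 3) H' = M 9 H \<inter> {..<9 - 2}"
        by (rule nc_card_plane[OF nc' D8])
      define m where "m i = (of_bool (i \<in> M 9 H) :: nat)" for i
      have DM: "D H' \<subseteq> {2..6}" "M (9 - 3) H' \<subseteq> {2..6}" using tg_D[OF H'(1)] by (auto simp: M_def)
      have cH': "card (D H') = ind H 2 + ind H 3 + ind H 4 + ind H 5 + ind H 6"
        using card_sum_of_bool[OF _ DM(1)] sum_numeral_range(1) H'(3) by simp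
      have cM': "card (M (9 - 3) H') = m 2 + m 3 + m 4 + m 5 + m 6"
        using card_sum_of_bool[OF _ DM(2)] sum_numeral_range(1) H'(4) by (simp add: m_def)
      have tot: "card (D H') + card (M (9 - 3) H') = 5" using tg_card[OF H'(1)] by simp
      have r: "c 2 6 \<noteq> 0" "c 3 5 \<noteq> 0" using row8 2 n by auto
      have r': "c 6 2 \<noteq> 0" "c 5 3 \<noteq> 0" "c 6 3 \<noteq> 0" "c 5 4 \<noteq> 0" using r c36 q0 c_nz_sym n by auto
      have pl: "ind H i + m j \<le> 1" if "8 \<le> i + j" "i + j \<le> 9" "c j i \<noteq> 0" for i j
        using ind_plane[OF nc' D8, of i j] that by (simp add: m_def)
      note pls = pl[of 2 6] pl[of 6 2] pl[of 3 5] pl[of 5 3] pl[of 3 6] pl[of 6 3] pl[of 4 5] pl[of 5 4]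
      have P: "ind H 2 + m 6 \<le> 1" "ind H 6 + m 2 \<le> 1" "ind H 3 + m 5 \<le> 1" "ind H 5 + m 3 \<le> 1"
        "ind H 3 + m 6 \<le> 1" "ind H 6 + m 3 \<le> 1" "ind H 4 + m 5 \<le> 1" "ind H 5 + m 4 \<le> 1"
        using pls r r' c36 q0 by simp_all
      have cl: "ind H 2 + ind H 3 \<le> 1 + ind H 5" "ind H 2 + ind H 4 \<le> 1 + ind H 6"
        using ind_HH[OF nc_tg[OF nc], of 2 3] ind_HH[OF nc_tg[OF nc], of 2 4] row_6_7 n by simp_all
      have tp: "ind H 3 + ind H 6 \<le> 1" "ind H 4 + ind H 5 \<le> 1"
        using ind_top[OF nc, of 3 6] ind_top[OF nc, of 4 5] c36 q0 by simp_all
      have 2: "ind H 2 = 1" using D by simp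
      have m1: "m i \<le> 1" for i by (simp add: m_def)
      note facts = P cl tp 2 m1[of 2] m1[of 3] m1[of 4] m1[of 5] m1[of 6] big H'(2) tot[unfolded cH' cM'] cH'
      show False
        using of_bool_cases(1)[of "3 \<in> D H"] of_bool_cases(1)[of "4 \<in> D H"] of_bool_cases(1)[of "5 \<in> D H"] of_bool_cases(1)[of "6 \<in> D H"]
        by (elim disjE; use facts in linarith)
    qed
  qed
qed

text \<open>The exceptional values are \<open>s = 1\<close>, where \<open>c 2 8\<close> vanishes,
  and \<open>s = 2/5\<close>, where also \<open>c 3 7\<close> does. Each possible \<open>a\<close>
  is excluded: 8 by splitting off the plane and the bound at level 7, and for \<open>s = 2/5\<close>
  the value 7 by \<open>nc_no_triple\<close>.\<close>

lemma nc_bounded_10: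
  assumes n: "10 \<le> n" and s0: "s \<noteq> 0" and B7: "bounded 7" shows "nc_bounded 10"
proof -
  note nz = nonzero_rows[OF s0]
  have q0: "q \<noteq> 0" "c 4 6 \<noteq> 0" using nz row10 n by simp_all
  have c6: "c 2 4 \<noteq> 0" "c 4 2 \<noteq> 0" "c 3 2 \<noteq> 0" using row_6_7 c_nz_sym n by auto
  have a_le: "a \<le> 8" "2 \<le> a" if "nc 10 H a z" for H a z using nc_a_le[OF that] nc_a[OF that] by auto
  have cd: "card (D H) = ind H 2 + ind H 3 + ind H 4 + ind H 5 + ind H 6 + ind H 7 + ind H 8 + ind H 9" if "nc 10 H a z" for H a z
    using card_D_nc[OF that, of 9] sum_numeral_range by simp
  have plane: "ind H 9 = 0 \<or> card (D H) \<le> 5" if nc: "nc 10 H 8 z" for H z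
  proof (cases "9 \<in> D H")
    case True
    then have "nc 10 H (10 - 2) z" "10 - 1 \<in> D H" using nc by simp_all
    then obtain H' where H': "tg (10 - 3) H'" "card (D H) = card (D H') + 2" by (rule nc_card_plane)
    then have "2 * card (D H') \<le> 7" using B7 by (simp add: bounded_def)
    then show ?thesis using H'(2) by simp
  qed simp
  have top46: "ind H 4 + ind H 6 \<le> 1" if "nc 10 H a z" for H a z using ind_top[OF that, of 4 6] q0 by simp
  have c45: "c 5 4 \<noteq> 0" using c_nz_sym[OF q0(1)] n by simp
  note b = of_bool_cases(2)
  consider "s = 1" | "s = 2 / 5" | "full 10" using full10 n s0 by blast
  then show ?thesis
  proof cases
    case 3
    then show ?thesis by (intro nc_strict_bounded full_strict) auto
  next
    case 1
    have c37: "c 3 7 \<noteq> 0" "c 7 3 \<noteq> 0" using nz(4) n 1 c_nz_sym[of 3 7] by auto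
    have c27: "c 2 7 \<noteq> 0" using nz(3) n 1 by simp
    show ?thesis
      unfolding nc_bounded_def
    proof (intro allI impI, rule ccontr)
      fix H a z assume nc: "nc 10 H a z" and "\<not> 2 * card (D H) \<le> 10"
      then have big: "6 \<le> card (D H)" by simp
      have tp: "ind H 3 + ind H 7 \<le> 1" using ind_top[OF nc, of 3 7] c37 by simp
      note bs = b[of "2 \<in> D H"] b[of "5 \<in> D H"] b[of "8 \<in> D H"] b[of "9 \<in> D H"]
      have D: "ind H 2 = 1" "ind H 5 = 1" "ind H 8 = 1" "ind H 9 = 1" "ind H 3 + ind H 7 = 1"
        using big cd[OF nc] tp top46[OF nc] bs by linarith+
      have "a = 2 \<or> a = 3 \<or> a = 4 \<or> a = 5 \<or> a = 6 \<or> a = 7 \<or> a = 8" using a_le[OF nc] by linarith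
      moreover have "a \<noteq> 3" "a \<noteq> 7" "a \<noteq> 4" "a \<noteq> 6" using nc_c'[OF nc] c37 q0 c_nz_sym[OF q0(2)] n by auto
      moreover have "a \<noteq> 2"
        using ind_row[OF nc, of 3] ind_row[OF nc, of 7] c27 row_6_7 D(5) by auto
      moreover have "a \<noteq> 5"
        using nc_c_pred[OF nc] D(4) q0 by auto
      ultimately have "a = 8" by blast
      then show False using plane[of H z] nc D big by simp
    qed
  next
    case 2
    have r: "c 2 5 \<noteq> 0" "c 2 6 \<noteq> 0" "c 3 4 \<noteq> 0" "c 3 5 \<noteq> 0" "c 3 6 \<noteq> 0"
      using row7 row8 nz(2) 2 n by auto
    have r': "c 5 2 \<noteq> 0" "c 5 3 \<noteq> 0" using r c_nz_sym n by auto
    show ?thesis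
      unfolding nc_bounded_def
    proof (intro allI impI, rule ccontr)
      fix H a z assume nc: "nc 10 H a z" and "\<not> 2 * card (D H) \<le> 10"
      then have big: "6 \<le> card (D H)" by simp
      note tg = nc_tg[OF nc]
      have cl: "ind H 2 + ind H 4 \<le> 1 + ind H 6" "ind H 2 + ind H 6 \<le> 1 + ind H 8" "ind H 3 + ind H 6 \<le> 1 + ind H 9"
        using ind_HH[OF tg, of 2 4] ind_HH[OF tg, of 2 6] ind_HH[OF tg, of 3 6] r c6 by simp_all
      note bs = b[of "2 \<in> D H"] b[of "3 \<in> D H"] b[of "4 \<in> D H"] b[of "5 \<in> D H"] b[of "6 \<in> D H"] b[of "7 \<in> D H"] b[of "8 \<in> D H"] b[of "9 \<in> D H"]
      note facts = big cd[OF nc] top46[OF nc] cl bs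
      have 98: "ind H 9 = 1 \<and> ind H 8 = 1"
        using of_bool_cases(1)[of "9 \<in> D H"] of_bool_cases(1)[of "8 \<in> D H"] of_bool_cases(1)[of "4 \<in> D H"] of_bool_cases(1)[of "6 \<in> D H"]
        by (elim disjE; use facts in linarith)
      have "a = 2 \<or> a = 3 \<or> a = 4 \<or> a = 5 \<or> a = 6 \<or> a = 7 \<or> a = 8" using a_le[OF nc] by linarith
      moreover have "a \<noteq> 4" "a \<noteq> 6" using nc_c'[OF nc] q0 c_nz_sym[OF q0(2)] n by auto
      moreover have "a \<noteq> 2"
      proof
        assume "a = 2"
        then have "ind H 3 = 0" "ind H 4 = 0" "ind H 5 = 0" "ind H 6 = 0"
          using ind_row[OF nc, of 3] ind_row[OF nc, of 4] ind_row[OF nc, of 5] ind_row[OF nc, of 6] r c6 row_6_7 by simp_all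
        then show False using facts by linarith
      qed
      moreover have "a \<noteq> 3"
      proof
        assume "a = 3"
        then have "ind H 2 = 0" "ind H 4 = 0" "ind H 5 = 0" "ind H 6 = 0"
          using ind_row[OF nc, of 2] ind_row[OF nc, of 4] ind_row[OF nc, of 5] ind_row[OF nc, of 6] r c6 by simp_all
        then show False using facts by linarith
      qed
      moreover have "a \<noteq> 5"
      proof
        assume "a = 5"
        then have "ind H 2 = 0" "ind H 3 = 0" "ind H 4 = 0"
          using ind_row[OF nc, of 2] ind_row[OF nc, of 3] ind_row[OF nc, of 4] r' c45 by simp_all
        then show False using facts by linarith
      qed
      moreover have "a \<noteq> 8" using plane[of H z] nc 98 big by auto
      moreover have "a \<noteq> 7"
        using nc_no_triple[of 10 H z] nc 98 by auto
      ultimately show False by blast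
    qed
  qed
qed

end

context graded_filiform_ip
begin

lemma card_direct_sum_le:
  assumes U: "subspace U" and W: "subspace W" and UW: "\<And>x. x \<in> U \<Longrightarrow> x \<in> W \<Longrightarrow> x = 0"
    and F: "U \<subseteq> F j" "W \<subseteq> F j" and j: "1 \<le> j"
  shows "card (D U) + card (D W) \<le> n + 1 - j"
proof -
  obtain B1 where B1: "B1 \<subseteq> U" "independent B1" "U \<subseteq> span B1" "card B1 = dim U"
    using basis_exists[of U] by metis
  obtain B2 where B2: "B2 \<subseteq> W" "independent B2" "W \<subseteq> span B2" "card B2 = dim W"
    using basis_exists[of W] by metis
  have f: "finite B1" "finite B2" using finite_independent B1 B2 by auto
  have sp: "span B1 \<subseteq> U" "span B2 \<subseteq> W" using span_minimal[OF B1(1) U] span_minimal[OF B2(1) W] by auto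
  have disj: "B1 \<inter> B2 = {}"
  proof -
    have "x \<notin> B2" if "x \<in> B1" for x
    proof
      assume "x \<in> B2"
      then have "x = 0" using that UW B1(1) B2(1) by blast
      then show False using that B1(2) dependent_zero by blast
    qed
    then show ?thesis by blast
  qed
  have ind: "independent (B1 \<union> B2)"
  proof
    assume "dependent (B1 \<union> B2)"
    then obtain g where g: "\<exists>v\<in>B1 \<union> B2. g v \<noteq> 0" "(\<Sum>v\<in>B1 \<union> B2. g v *\<^sub>R v) = 0"
      using f by (auto simp: dependent_finite)
    have s: "(\<Sum>v\<in>B1. g v *\<^sub>R v) + (\<Sum>v\<in>B2. g v *\<^sub>R v) = 0"
      using g(2) f disj by (simp add: sum.union_disjoint)
    have m: "(\<Sum>v\<in>B1. g v *\<^sub>R v) \<in> span B1" "(\<Sum>v\<in>B2. g v *\<^sub>R v) \<in> span B2"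
      by (intro span_sum span_scale span_base; assumption)+
    have e: "(\<Sum>v\<in>B1. g v *\<^sub>R v) = - (\<Sum>v\<in>B2. g v *\<^sub>R v)"
      using s by (simp add: eq_neg_iff_add_eq_0)
    have "(\<Sum>v\<in>B1. g v *\<^sub>R v) \<in> W" unfolding e using m(2) sp(2) subspace_neg[OF W] by blast
    then have z1: "(\<Sum>v\<in>B1. g v *\<^sub>R v) = 0" using UW m(1) sp(1) by blast
    then have z2: "(\<Sum>v\<in>B2. g v *\<^sub>R v) = 0" using s by simp
    show False using g(1) z1 z2 B1(2) B2(2) f by (auto simp: dependent_finite)
  qed
  have "B1 \<union> B2 \<subseteq> F j" using B1(1) B2(1) F by blast
  then have "D (span (B1 \<union> B2)) \<subseteq> {j..n}"
  proof -
    assume "B1 \<union> B2 \<subseteq> F j"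
    then have sub: "span (B1 \<union> B2) \<subseteq> F j" by (rule span_minimal[OF _ subspace_F])
    show ?thesis
    proof
      fix i assume "i \<in> D (span (B1 \<union> B2))"
      then obtain v where v: "v \<in> span (B1 \<union> B2)" "lead i v" by (rule D_obtain)
      then show "i \<in> {j..n}" using lead_F[OF v(2)] sub lead_range[OF v(2)] by auto
    qed
  qed
  then have "card (D (span (B1 \<union> B2))) \<le> card {j..n}" by (intro card_mono) auto
  moreover have "card (D (span (B1 \<union> B2))) = card (B1 \<union> B2)"
    using dim_eq_card_D[OF subspace_span[of "B1 \<union> B2"]] dim_span[of "B1 \<union> B2"] dim_eq_card_independent[OF ind] by simp
  moreover have "card (B1 \<union> B2) = dim U + dim W" using B1 B2 f disj by (simp add: card_Un_disjoint)
  ultimately show ?thesis using dim_eq_card_D[OF U] dim_eq_card_D[OF W] by simp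
qed

lemma co_ad1: assumes "w \<in> F 2" "l \<le> n" shows "co l (br (X 1) w) = (if 3 \<le> l then co (l - 1) w else 0)"
proof (cases "3 \<le> l")
  case False
  then have "co l (br (X 1) w) = 0" using br_F[OF X_F[of 1 1] assms(1)] by (auto simp: F_def)
  then show ?thesis using False by simp
next
  case True
  have "co l (br (X 1) w) = (\<Sum>a=1..n. \<Sum>b=1..n. if a + b = l then co a (X 1) * co b w * c a b else 0)"
    using True assms by (intro co_br) auto
  also have "\<dots> = (\<Sum>a=1..n. if a = 1 then co (l - 1) w else 0)"
  proof (rule sum.cong[OF refl])
    fix a assume a: "a \<in> {1..n}"
    show "(\<Sum>b=1..n. if a + b = l then co a (X 1) * co b w * c a b else 0) = (if a = 1 then co (l - 1) w else 0)"
    proof (cases "a = 1")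
      case True': True
      have "(\<Sum>b=1..n. if a + b = l then co a (X 1) * co b w * c a b else 0) = (\<Sum>b=1..n. if b = l - 1 then co (l - 1) w else 0)"
      proof (rule sum.cong[OF refl])
        fix b assume "b \<in> {1..n}"
        show "(if a + b = l then co a (X 1) * co b w * c a b else 0) = (if b = l - 1 then co (l - 1) w else 0)"
        proof (cases "b = l - 1")
          case b: True
          have "c 1 (l - 1) = 1" using True assms by (intro c1) auto
          then show ?thesis using b True' True n3 by (simp add: co_X)
        next
          case False
          then have "a + b \<noteq> l" using True' by auto
          then show ?thesis using False by simp
        qed
      qed
      also have "\<dots> = co (l - 1) w"
      proof -
        have "l - 1 \<in> {1..n}" using True assms by auto
        then show ?thesis by simp
      qed
      finally show ?thesis using True' by simp
    next
      case False
      then have "co a (X 1) = 0" by (simp add: co_X)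
      then show ?thesis using False by (simp add: sum.neutral)
    qed
  qed
  also have "\<dots> = co (l - 1) w" using n3 by simp
  finally show ?thesis using True by simp
qed

end

section \<open>Degree 11, the case s = 0, and the induction for k = 5\<close>

context graded_filiform_5_ip
begin

text \<open>By \<open>row11_nz\<close> at most one pair vanishes. \<open>single_pair\<close> rules
  out 3, 8; the pair 2, 9 leads to a plane and contradictory constraints at level 8; the pair 5, 6
  with \<open>a = 5\<close> needs a metric argument.\<close>

lemma nc_strict_11:
  assumes n: "11 \<le> n" and s0: "s \<noteq> 0" shows "nc_strict 11"
proof -
  note nz = row11_nz[OF n s0]
  note nz' = nonzero_rows[OF s0]
  have s1: "s \<noteq> 1" by (rule s_neq_1[OF n])
  have q0: "q \<noteq> 0" "c 4 6 \<noteq> 0" using nz' row10 n by simp_all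
  have c24: "c 2 4 \<noteq> 0" using row_6_7 n by simp
  have c5: "c 5 3 \<noteq> 0" "c 5 4 \<noteq> 0" using c_nz_sym[of 3 5] c_nz_sym[of 4 5] row8 s0 q0 n by auto
  consider "s = 2 / 5" | "full 11" | (29) "s \<noteq> 2 / 5" "c 2 9 = 0" | (38) "s \<noteq> 2 / 5" "c 3 8 = 0" | (56) "s \<noteq> 2 / 5" "u = 0"
  proof -
    have "full 11" if "c 2 9 \<noteq> 0" "c 3 8 \<noteq> 0" "u \<noteq> 0"
      by (rule fullI[OF n], drule (1) less_half_cases) (use nz that in auto)
    then show ?thesis using that by blast
  qed
  then show ?thesis
  proof cases
    case 1
    then show ?thesis using nz(5) by (intro full_strict) auto
  next
    case 2
    then show ?thesis by (intro full_strict) auto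
  next
    case 38
    have r: "c 2 9 \<noteq> 0" "c 4 7 \<noteq> 0" "u \<noteq> 0" using 38 nz by auto
    show ?thesis
      unfolding nc_strict_def
    proof (intro allI impI, rule ccontr)
      fix H a z assume nc: "nc 11 H a z" and "\<not> 2 * card (D H) < 11"
      then have big: "11 \<le> 2 * card (D H)" by simp
      have row: "c i (11 - i) \<noteq> 0" if "2 \<le> i" "i + 2 \<le> 11" "i \<noteq> 3" "i \<noteq> 11 - 3" for i
      proof -
        have "i = 2 \<or> i = 4 \<or> i = 5 \<or> i = 6 \<or> i = 7 \<or> i = 9" using that by arith
        then show ?thesis using r c_nz_sym[OF r(1)] c_nz_sym[OF r(2)] c_nz_sym[OF r(3)] n by auto
      qed
      have "{3, 11 - 3, 11 - 1} \<subseteq> D H \<and> (3 = (2::nat) \<and> a = 11 - 2 \<or> a = 3 \<and> 11 = 2 * 3 + (1::nat))"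
        by (rule single_pair[OF nc _ _ _ _ row big]) simp_all
      then show False by simp
    qed
  next
    case 56
    have r: "c 2 9 \<noteq> 0" "c 4 7 \<noteq> 0" "c 3 8 \<noteq> 0" using 56 nz by auto
    have s47: "s = 4 / 7" using nz(6) 56 by simp
    have c25: "c 5 2 \<noteq> 0" using c_nz_sym[of 2 5] row7 s1 n by auto
    show ?thesis
      unfolding nc_strict_def
    proof (intro allI impI, rule ccontr)
      fix H a z assume nc: "nc 11 H a z" and "\<not> 2 * card (D H) < 11"
      then have big: "11 \<le> 2 * card (D H)" by simp
      note tg = nc_tg[OF nc] and z = nc_z[OF nc]
      have row: "c i (11 - i) \<noteq> 0" if "2 \<le> i" "i + 2 \<le> 11" "i \<noteq> 5" "i \<noteq> 11 - 5" for i
      proof -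
        have "i = 2 \<or> i = 3 \<or> i = 4 \<or> i = 7 \<or> i = 8 \<or> i = 9" using that by arith
        then show ?thesis using r c_nz_sym[OF r(1)] c_nz_sym[OF r(2)] c_nz_sym[OF r(3)] n by auto
      qed
      have "{5, 11 - 5, 11 - 1} \<subseteq> D H \<and> (5 = (2::nat) \<and> a = 11 - 2 \<or> a = 5 \<and> 11 = 2 * 5 + (1::nat))"
        by (rule single_pair[OF nc _ _ _ _ row big]) simp_all
      then have a: "a = 5" by simp
      have low: "ind H 2 = 0" "ind H 3 = 0" "ind H 4 = 0"
        using ind_row[OF nc, of 2] ind_row[OF nc, of 3] ind_row[OF nc, of 4] a c25 c5 by simp_all
      have cd: "card (D H) = ind H 2 + ind H 3 + ind H 4 + ind H 5 + ind H 6 + ind H 7 + ind H 8 + ind H 9 + ind H 10"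
        using card_D_nc[OF nc, of 10] sum_numeral_range by simp
      note bs = of_bool_cases(2)[of "5 \<in> D H"] of_bool_cases(2)[of "6 \<in> D H"] of_bool_cases(2)[of "7 \<in> D H"]
        of_bool_cases(2)[of "8 \<in> D H"] of_bool_cases(2)[of "9 \<in> D H"] of_bool_cases(2)[of "10 \<in> D H"]
      have "ind H 6 = 1" "ind H 7 = 1" "ind H 10 = 1" using big cd low bs by linarith+
      then have D: "6 \<in> D H" "7 \<in> D H" "10 \<in> D H" by simp_all
      have HF: "h \<in> F 5" if h: "h \<in> H" for h
      proof (rule ccontr)
        assume "h \<notin> F 5"
        then obtain i where i: "lead i h" "i < 5" by (rule ex_lead_not_F)
        have iD: "i \<in> D H" by (rule D_I[OF h i(1)])
        then have "2 \<le> i" using D_bounds[OF tg] by blast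
        then have "i = 2 \<or> i = 3 \<or> i = 4" using i by linarith
        then show False using iD low by auto
      qed
      \<comment> \<open>\<open>H\<close> lies in \<open>F 5\<close>, so the normal part of
        \<open>X 4\<close> has leading degree 4. It sends degree 10 into \<open>F 12\<close>, so its
        brackets with \<open>H\<close> are orthogonal to \<open>x\<close>; applied to
        \<open>x7\<close> this gives \<open>ip z x = 0\<close>, applied to \<open>x6\<close> then
        \<open>ip x x = 0\<close>.\<close>
      obtain p where p: "p \<in> H" "X 4 - p \<in> perp H" using ex_proj[OF tg_sub[OF tg]] by blast
      define y where "y = X 4 - p"
      have "X 4 - y \<in> F (Suc 4)" using HF[OF p(1)] by (simp add: y_def eval_nat_numeral)
      then have y: "y \<in> perp H" "lead 4 y" using p lead_diff[OF lead_X[of 4]] n by (auto simp: y_def)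
      obtain x6 where x6: "x6 \<in> H" "lead 6 x6" using D(1) by (rule D_obtain)
      obtain x7 where x7: "x7 \<in> H" "lead 7 x7" using D(2) by (rule D_obtain)
      obtain x where x: "x \<in> H" "lead 10 x" using D(3) by (rule D_obtain)
      have "br y x \<in> F (Suc 11)" using br_F'[OF leadD(1)[OF y(2)] leadD(1)[OF x(2)]] by simp
      then have 0: "ip (br y h) x = 0" if "h \<in> H" for h
        using tg_perp[OF tg] perpD that tg_skew[OF tg y(1) that x(1)] by fastforce
      have l7: "lead (4 + 7) (br y x7)" by (rule lead_br[OF y(2) x7(2)]) (use n r in auto)
      obtain \<gamma> where g: "br y x7 - \<gamma> *\<^sub>R X 11 \<in> F (Suc 11)"
        using reduce_X[of "br y x7" 11] leadD(1)[OF l7] n by auto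
      have "\<gamma> \<noteq> 0" using g lead_F[OF l7] by fastforce
      moreover have "ip (br y x7 - \<gamma> *\<^sub>R X 11) x = 0" using tg_perp[OF tg g] perpD x by blast
      then have "\<gamma> * ip z x = 0" using 0[OF x7(1)] nc_ip[OF nc x(1)]
        by (simp add: bilinear_lsub[OF ip_bil] bilinear_lmul[OF ip_bil])
      ultimately have zx: "ip z x = 0" by simp
      have l6: "lead (4 + 6) (br y x6)" by (rule lead_br[OF y(2) x6(2)]) (use n q0 in auto)
      have "br y x6 \<in> F 10" using leadD(1)[OF l6] by simp
      then obtain \<alpha> where al: "br y x6 - \<alpha> *\<^sub>R x \<in> F (Suc 10)" using reduce[OF x(2)] by blast
      then obtain \<beta> where b: "br y x6 - \<alpha> *\<^sub>R x - \<beta> *\<^sub>R X 11 \<in> F (Suc 11)"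
        using reduce_X[of "br y x6 - \<alpha> *\<^sub>R x" 11] n by auto
      have "\<alpha> \<noteq> 0" using al lead_F[OF l6] by fastforce
      moreover have "ip (br y x6 - \<alpha> *\<^sub>R x - \<beta> *\<^sub>R X 11) x = 0" using tg_perp[OF tg b] perpD x by blast
      then have "\<alpha> * ip x x = 0" using 0[OF x6(1)] nc_ip[OF nc x(1)] zx
        by (simp add: bilinear_lsub[OF ip_bil] bilinear_lmul[OF ip_bil])
      ultimately show False using ip_pos[OF lead_nz[OF x(2)]] by simp
    qed
  next
    case 29
    have r: "c 3 8 \<noteq> 0" "c 4 7 \<noteq> 0" "u \<noteq> 0" using 29 nz by auto
    have r10: "c 2 8 \<noteq> 0" "c 3 7 \<noteq> 0" using nz' 29 s1 n by auto
    have rs: "c 8 3 \<noteq> 0" "c 7 4 \<noteq> 0" "c 6 5 \<noteq> 0" "c 8 2 \<noteq> 0" "c 7 3 \<noteq> 0" "c 6 4 \<noteq> 0"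
      using r r10 q0 c_nz_sym n by auto
    show ?thesis
      unfolding nc_strict_def
    proof (intro allI impI, rule ccontr)
      fix H a z assume nc: "nc 11 H a z" and "\<not> 2 * card (D H) < 11"
      then have big: "11 \<le> 2 * card (D H)" by simp
      have row: "c i (11 - i) \<noteq> 0" if "2 \<le> i" "i + 2 \<le> 11" "i \<noteq> 2" "i \<noteq> 11 - 2" for i
      proof -
        have "i = 3 \<or> i = 4 \<or> i = 5 \<or> i = 6 \<or> i = 7 \<or> i = 8" using that by arith
        then show ?thesis using r rs by auto
      qed
      have "{2, 11 - 2, 11 - 1} \<subseteq> D H \<and> (2 = (2::nat) \<and> a = 11 - 2 \<or> a = 2 \<and> 11 = 2 * 2 + (1::nat))"
        by (rule single_pair[OF nc _ _ _ _ row big]) simp_all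
      then have D: "2 \<in> D H" and nc': "nc 11 H (11 - 2) z" and D10: "11 - 1 \<in> D H" using nc by auto
      obtain H' where H': "tg (11 - 3) H'" "card (D H) = card (D H') + 2" "D H' = D H \<inter> {..<11 - 2}" "M (11 - 3) H' = M 11 H \<inter> {..<11 - 2}"
        by (rule nc_card_plane[OF nc' D10])
      define m where "m i = (of_bool (i \<in> M 11 H) :: nat)" for i
      have DM: "D H' \<subseteq> {2..8}" "M (11 - 3) H' \<subseteq> {2..8}" using tg_D[OF H'(1)] by (auto simp: M_def)
      have cH': "card (D H') = ind H 2 + ind H 3 + ind H 4 + ind H 5 + ind H 6 + ind H 7 + ind H 8"
        using card_sum_of_bool[OF _ DM(1)] sum_numeral_range(2) H'(3) by simp
      have cM': "card (M (11 - 3) H') = m 2 + m 3 + m 4 + m 5 + m 6 + m 7 + m 8"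
        using card_sum_of_bool[OF _ DM(2)] sum_numeral_range(2) H'(4) by (simp add: m_def)
      have tot: "card (D H') + card (M (11 - 3) H') = 7" using tg_card[OF H'(1)] by simp
      have pl: "ind H i + m j \<le> 1" if "10 \<le> i + j" "i + j \<le> 11" "c j i \<noteq> 0" for i j
        using ind_plane[OF nc' D10, of i j] that by (simp add: m_def)
      note pls = pl[of 2 8] pl[of 8 2] pl[of 3 7] pl[of 7 3] pl[of 4 6] pl[of 6 4] pl[of 3 8] pl[of 8 3] pl[of 4 7] pl[of 7 4] pl[of 5 6] pl[of 6 5]
      have P: "ind H 2 + m 8 \<le> 1" "ind H 8 + m 2 \<le> 1" "ind H 3 + m 7 \<le> 1" "ind H 7 + m 3 \<le> 1" "ind H 4 + m 6 \<le> 1" "ind H 6 + m 4 \<le> 1"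
        "ind H 3 + m 8 \<le> 1" "ind H 8 + m 3 \<le> 1" "ind H 4 + m 7 \<le> 1" "ind H 7 + m 4 \<le> 1" "ind H 5 + m 6 \<le> 1" "ind H 6 + m 5 \<le> 1"
        using pls r r10 rs q0 by simp_all
      have cl: "ind H 2 + ind H 4 \<le> 1 + ind H 6"
        using ind_HH[OF nc_tg[OF nc], of 2 4] c24 by simp
      have tp: "ind H 3 + ind H 8 \<le> 1" "ind H 4 + ind H 7 \<le> 1" "ind H 5 + ind H 6 \<le> 1"
        using ind_top[OF nc, of 3 8] ind_top[OF nc, of 4 7] ind_top[OF nc, of 5 6] r by simp_all
      have 2: "ind H 2 = 1" using D by simp
      have m1: "m i \<le> 1" for i by (simp add: m_def)
      note facts = P cl tp 2 m1[of 2] m1[of 3] m1[of 4] m1[of 5] m1[of 6] m1[of 7] m1[of 8] big H'(2) tot[unfolded cH' cM'] cH'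
      show False
        using of_bool_cases(1)[of "3 \<in> D H"] of_bool_cases(1)[of "4 \<in> D H"] of_bool_cases(1)[of "5 \<in> D H"]
          of_bool_cases(1)[of "6 \<in> D H"] of_bool_cases(1)[of "7 \<in> D H"] of_bool_cases(1)[of "8 \<in> D H"]
        by (elim disjE; use facts in linarith)
    qed
  qed
qed

text \<open>
  For \<open>s = 0\<close> one has \<open>ad X\<^sub>2 = (ad X\<^sub>1)\<^sup>2\<close> on \<open>F 3\<close>; both operators compress to skew ones, while the
  square of a nonzero skew operator is negative.
\<close>

lemma nc_strict_m2:
  assumes t: "7 \<le> t" "t \<le> n" and s0: "s = 0" shows "nc_strict t"
  unfolding nc_strict_def
proof (intro allI impI, rule ccontr)
  fix H a z assume nc: "nc t H a z" and "\<not> 2 * card (D H) < t"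
  then have big: "t \<le> 2 * card (D H)" by simp
  note tg = nc_tg[OF nc]
  have z33: "c i j = 0" if "3 \<le> i" "3 \<le> j" "i + j \<le> n" for i j using m2_rows s0 that by blast
  have one: "c 2 j = 1" if "3 \<le> j" "j + 2 \<le> n" for j using m2_rows s0 that by blast
  have a: "a \<noteq> 2" "a \<noteq> t - 2"
    using nc_c'[OF nc] nc_c[OF nc] one[of "t - 2"] t by auto
  have a3: "3 \<le> a" "a + 2 \<le> t" using a nc_a_le[OF nc] nc_a[OF nc] by auto
  have "2 \<notin> D H"
  proof
    assume "2 \<in> D H"
    then have "c a 2 = 0" using nc_row[OF nc] a3 by simp
    then show False using one[of a] c_skew[of 2 a] a3 t by simp
  qed
  then have HF: "h \<in> F 3" if "h \<in> H" for h
  proof (rule_tac ccontr)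
    assume 2: "2 \<notin> D H" and "h \<notin> F 3"
    then obtain i where i: "lead i h" "i < 3" using ex_lead_not_F by blast
    have "i \<in> D H" by (rule D_I[OF that i(1)])
    moreover have "2 \<le> i" using calculation D_bounds[OF tg] by blast
    ultimately show False using 2 i by (metis le_antisym less_Suc_eq_le numeral_2_eq_2 numeral_3_eq_3)
  qed
  have abelian: "br v w = 0" if "v \<in> F 3" "w \<in> F 3" for v w
    by (rule F_zero[of _ "n + 1"]) (use that z33 in \<open>auto intro!: br_F_row[of v 3 w 3]\<close>)
  obtain p1 where p1: "p1 \<in> H" "X 1 - p1 \<in> perp H" using ex_proj[OF tg_sub[OF tg]] by blast
  obtain p2 where p2: "p2 \<in> H" "X 2 - p2 \<in> perp H" using ex_proj[OF tg_sub[OF tg]] by blast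
  have y1: "br (X 1 - p1) w = br (X 1) w" and y2: "br (X 2 - p2) w = br (X 2) w" if "w \<in> F 3" for w
    using abelian[OF HF[OF p1(1)] that] abelian[OF HF[OF p2(1)] that] by (simp_all add: bilinear_lsub[OF bil])
  have F32: "w \<in> F 2" if "w \<in> F 3" for w using F_mono[OF _ that] by simp
  have sq: "br (X 2) w = br (X 1) (br (X 1) w)" if w: "w \<in> F 3" for w
  proof -
    have j: "br (X 1) (br (X 2) w) + br (X 2) (br w (X 1)) + br w (br (X 1) (X 2)) = 0" by (rule jac)
    have "co l (br (X 2) w) = co l (br (X 1) (br (X 1) w))" if l: "l \<in> {1..n}" for l
    proof (cases "5 \<le> l")
      case False
      have "br (X 2) w \<in> F 5" "br (X 1) (br (X 1) w) \<in> F 5"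
        using br_F'[OF X_F[of 2 2] w, of 5] br_F'[OF X_F[of 1 1] br_F'[OF X_F[of 1 1] w order_refl], of 5] by simp_all
      then show ?thesis using False by (simp add: F_def)
    next
      case True
      have b1: "br (X 1) w \<in> F 2" using br_F'[OF X_F[of 1 1] w, of 2] by simp
      have lhs: "co l (br (X 1) (br (X 1) w)) = co (l - 2) w"
        using co_ad1[OF b1, of l] co_ad1[OF F32[OF w], of "l - 1"] True l by (simp add: numeral_2_eq_2)
      have "co l (br (X 2) w) = (\<Sum>a=1..n. \<Sum>b=1..n. if a + b = l then co a (X 2) * co b w * c a b else 0)"
        using l by (intro co_br) auto
      also have "\<dots> = (\<Sum>a=1..n. if a = 2 then co (l - 2) w else 0)"
      proof (rule sum.cong[OF refl])
        fix a assume "a \<in> {1..n}"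
        show "(\<Sum>b=1..n. if a + b = l then co a (X 2) * co b w * c a b else 0) = (if a = 2 then co (l - 2) w else 0)"
        proof (cases "a = 2")
          case a2: True
          have "(\<Sum>b=1..n. if a + b = l then co a (X 2) * co b w * c a b else 0) = (\<Sum>b=1..n. if b = l - 2 then co (l - 2) w else 0)"
          proof (rule sum.cong[OF refl])
            fix b assume "b \<in> {1..n}"
            show "(if a + b = l then co a (X 2) * co b w * c a b else 0) = (if b = l - 2 then co (l - 2) w else 0)"
            proof (cases "b = l - 2")
              case b: True
              have "c 2 (l - 2) = 1" using True l by (intro one) auto
              then show ?thesis using b a2 True n3 by (simp add: co_X)
            next
              case False
              then have "a + b \<noteq> l" using a2 by auto
              then show ?thesis using False by simp
            qed
          qed
          also have "\<dots> = co (l - 2) w"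
          proof -
            have "l - 2 \<in> {1..n}" using True l by auto
            then show ?thesis by simp
          qed
          finally show ?thesis using a2 by simp
        next
          case False
          then have "co a (X 2) = 0" by (simp add: co_X)
          then show ?thesis using False by (simp add: sum.neutral)
        qed
      qed
      also have "\<dots> = co (l - 2) w" using n3 by simp
      finally show ?thesis using lhs by simp
    qed
    then show ?thesis by (rule vec_eqI)
  qed
  \<comment> \<open>Dimension count inside \<open>F 3\<close>: the dimensions of \<open>H\<close>
    and \<open>ad X_1 H + F (t + 1)\<close> would add up to at least
    \<open>2 * card (D H) + n - t\<close>, more than \<open>n - 2\<close>, if no such
    \<open>x\<close> existed.\<close>
  have "\<exists>x\<in>H. x \<noteq> 0 \<and> (\<exists>h\<in>H. br (X 1) x - h \<in> F (Suc t))"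
  proof (rule ccontr)
    assume no: "\<not> ?thesis"
    define W where "W = {br (X 1) x + f | x f. x \<in> H \<and> f \<in> F (Suc t)}"
    have W: "subspace W"
    proof (rule subspaceI)
      show "0 \<in> W" unfolding W_def using tg_closed(4)[OF tg] F_closed(1)
        by (intro CollectI exI[of _ 0]) (simp add: bilinear_rzero[OF bil])
      show "v + w \<in> W" if vw: "v \<in> W" "w \<in> W" for v w
      proof -
        obtain x f x' f' where "v = br (X 1) x + f" "w = br (X 1) x' + f'" and m: "x \<in> H" "x' \<in> H" "f \<in> F (Suc t)" "f' \<in> F (Suc t)"
          using vw by (auto simp: W_def)
        then have "v + w = br (X 1) (x + x') + (f + f')" by (simp add: bilinear_radd[OF bil])
        then show ?thesis using m tg_closed(1)[OF tg] F_closed(2) unfolding W_def by blast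
      qed
      show "r *\<^sub>R v \<in> W" if v: "v \<in> W" for r v
      proof -
        obtain x f where "v = br (X 1) x + f" and m: "x \<in> H" "f \<in> F (Suc t)" using v by (auto simp: W_def)
        then have "r *\<^sub>R v = br (X 1) (r *\<^sub>R x) + r *\<^sub>R f" by (simp add: bilinear_rmul[OF bil] scaleR_add_right)
        then show ?thesis using m tg_closed(3)[OF tg] F_closed(3) unfolding W_def by blast
      qed
    qed
    have "x = 0" if x: "x \<in> H" "x \<in> W" for x
    proof -
      obtain x' f where e: "x = br (X 1) x' + f" and m: "x' \<in> H" "f \<in> F (Suc t)" using x by (auto simp: W_def)
      have "br (X 1) x' - x = - f" using e by simp
      then have "br (X 1) x' - x \<in> F (Suc t)" using m F_closed(5) by simp
      then have "x' = 0" using no m(1) x(1) by blast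
      then have "x = f" using e by (simp add: bilinear_rzero[OF bil])
      then show ?thesis using tg_zero[OF tg x(1)] m by simp
    qed
    moreover have "H \<subseteq> F 3" using HF by blast
    moreover have "W \<subseteq> F 3"
    proof
      fix w assume "w \<in> W"
      then obtain x f where w: "w = br (X 1) x + f" and m: "x \<in> H" "f \<in> F (Suc t)" by (auto simp: W_def)
      have "br (X 1) x \<in> F 3" using br_F'[OF X_F[of 1 1] HF[OF m(1)], of 3] by simp
      moreover have "f \<in> F 3" using F_mono[OF _ m(2), of 3] t by simp
      ultimately show "w \<in> F 3" unfolding w by (rule F_closed(2))
    qed
    ultimately have le: "card (D H) + card (D W) \<le> n + 1 - 3"
      by (intro card_direct_sum_le[OF tg_sub[OF tg] W]) auto
    have "Suc ` D H \<union> {Suc t..n} \<subseteq> D W"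
    proof
      fix i assume "i \<in> Suc ` D H \<union> {Suc t..n}"
      then show "i \<in> D W"
      proof
        assume "i \<in> Suc ` D H"
        then obtain j where j: "i = Suc j" "j \<in> D H" by auto
        obtain x where x: "x \<in> H" "lead j x" using j(2) by (rule D_obtain)
        have jt: "2 \<le> j" "j \<le> t" "j \<noteq> t" using D_bounds[OF tg j(2)] nc_t(2)[OF nc] j(2) by auto
        have c1j: "c 1 j = 1" using jt t by (intro c1) auto
        have "lead (1 + j) (br (X 1) x)" using jt t c1j by (intro lead_br[OF lead_X x(2)]) auto
        moreover have "br (X 1) x + 0 \<in> W" using x F_closed(1) unfolding W_def by blast
        ultimately show ?thesis using D_I[of "br (X 1) x" W] j(1) by simp
      next
        assume i: "i \<in> {Suc t..n}"
        have "br (X 1) 0 + X i \<in> W" using X_F[of "Suc t" i] i tg_closed(4)[OF tg] unfolding W_def by auto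
        then show ?thesis using lead_X[of i] i D_I[of "X i" W] by (simp add: bilinear_rzero[OF bil])
      qed
    qed
    then have "card (Suc ` D H \<union> {Suc t..n}) \<le> card (D W)" by (intro card_mono finite_D)
    moreover have "card (Suc ` D H \<union> {Suc t..n}) = card (D H) + (n - t)"
    proof -
      have "Suc ` D H \<inter> {Suc t..n} = {}"
      proof -
        have "j < t" if "j \<in> D H" for j using D_bounds(2)[OF tg that] nc_t(2)[OF nc] that by (cases "j = t") auto
        then show ?thesis by fastforce
      qed
      then show ?thesis using finite_D[of H] by (subst card_Un_disjoint) (auto simp: card_image)
    qed
    ultimately show False using le big t by linarith
  qed
  then obtain x h where x: "x \<in> H" "x \<noteq> 0" and h: "h \<in> H" "br (X 1) x - h \<in> F (Suc t)" by blast
  define f where "f = br (X 1) x - h"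
  have xF: "x \<in> F 3" by (rule HF[OF x(1)])
  \<comment> \<open>Skew-symmetry of \<open>ad X_1\<close> makes the product of this vector with
    \<open>x\<close> equal to \<open>- ip h h\<close>, that of \<open>ad X_2\<close> makes it
    0.\<close>
  have "br (X 1) (br (X 1) x) = br (X 1) h + br (X 1) f" by (simp add: f_def bilinear_rsub[OF bil])
  moreover have "ip (br (X 1) f) x = 0" unfolding f_def by (rule perpD[OF tg_perp[OF tg br_ideal[OF h(2)]] x(1)])
  moreover have "ip (br (X 1) h) x = - ip (br (X 1) x) h"
    using tg_skew[OF tg p1(2) h(1) x(1)] y1[OF HF[OF h(1)]] y1[OF xF] by simp
  moreover have "ip (br (X 1) x) h = ip h h"
    using perpD[OF tg_perp[OF tg h(2)] h(1)] by (simp add: bilinear_lsub[OF ip_bil])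
  moreover have "ip (br (X 1) (br (X 1) x)) x = 0"
    using tg_skew0[OF tg p2(2) x(1)] y2[OF xF] sq[OF xF] by simp
  ultimately have "ip h h = 0" by (simp add: bilinear_ladd[OF ip_bil])
  then have "h = 0" by (rule ip_eq_0)
  then have bF: "br (X 1) x \<in> F (Suc t)" using h by simp
  obtain i where i: "lead i x" using ex_lead[OF x(2) xF] by blast
  have iD: "i \<in> D H" by (rule D_I[OF x(1) i])
  have it: "2 \<le> i" "i < t" using D_bounds[OF tg iD] nc_t(2)[OF nc] iD by (cases "i = t", auto)+
  have "c 1 i = 1" using it t by (intro c1) auto
  then have "lead (1 + i) (br (X 1) x)" using it t by (intro lead_br[OF lead_X i]) auto
  then show False using lead_F[OF _ bF] it by fastforce
qed

lemma bounded_ge_6: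
  assumes t: "6 \<le> t" "t \<le> n" shows "bounded t"
proof -
  have B6: "bounded 6" using bounded_6 t by simp
  have S6: "nc_strict 6" using full_Suc_k t by (intro full_strict) auto
  have S7: "nc_strict 7" if n: "7 \<le> n"
  proof -
    consider "s = 0" | "s = 1" | "full 7" using full7 n by blast
    then show ?thesis
    proof cases
      case 1 then show ?thesis using n by (intro nc_strict_m2) auto
    next
      case 2
      then have "c 2 5 = 0" using row7 n by simp
      then show ?thesis using nc_strict_Suc_Suc_k n by simp
    next
      case 3 then show ?thesis by (intro full_strict) auto
    qed
  qed
  have B7: "bounded 7" if n: "7 \<le> n"
    using bounded_Suc_Suc_k[OF _ nc_strict_bounded] S7[OF n] n by simp
  show ?thesis
  proof (cases "s = 0")
    case True
    show ?thesis
      using t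
    proof (induction t rule: less_induct)
      case (less t)
      consider "t = 6" | "t = 7" | "8 \<le> t" using less.prems by linarith
      then show ?case
      proof cases
        case 3
        have "nc_strict t" using less.prems 3 True by (intro nc_strict_m2) auto
        moreover have "nc_strict (t - 1)" using less.prems 3 True by (intro nc_strict_m2) auto
        moreover have "bounded (t - 1)" "bounded (t - 2)" using less.prems 3 by (auto intro!: less.IH)
        ultimately show ?thesis using 3 nc_strict_bounded bounded_step[of t] by auto
      qed (use B6 B7 less.prems in auto)
    qed
  next
    case s0: False
    have N8: "nc_bounded 8" "s \<noteq> 1 / 2 \<Longrightarrow> nc_strict 8" if n: "8 \<le> n"
    proof -
      show "nc_strict 8" if "s \<noteq> 1 / 2" using full8[OF n s0 that] by (intro full_strict) auto
      then show "nc_bounded 8" using nc_bounded_8[OF n] nc_strict_bounded by blast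
    qed
    have B8: "bounded 8" if n: "8 \<le> n"
      by (rule bounded_step) (use B6 B7 N8(1) S7 n in auto)
    have B9: "bounded 9" if n: "9 \<le> n"
    proof -
      \<comment> \<open>At \<open>s = 1/2\<close> only \<open>nc_bounded 8\<close> is available, so
        the other alternative of \<open>bounded_step\<close> is taken: row 9 is full.\<close>
      have "full 9" if "s = 1 / 2" using full9[OF n s0] that by simp
      then have "nc_strict 8 \<or> full 9" using N8(2) n by auto
      then show ?thesis
        by (intro bounded_step[of 9]) (use B7 B8 n nc_strict_9[OF n s0] nc_strict_bounded in auto)
    qed
    have B10: "bounded 10" if n: "10 \<le> n"
      by (rule bounded_step) (use B8 B9 n nc_bounded_10[OF n s0 B7] nc_strict_9[OF _ s0] in auto)
    have B11: "bounded 11" if n: "11 \<le> n"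
    proof -
      \<comment> \<open>At \<open>s = 2/5\<close> only \<open>nc_bounded 10\<close> is available,
        but row 11 is full.\<close>
      have "nc_strict 10 \<or> full 11"
      proof (cases "s = 2 / 5")
        case True then show ?thesis using row11_nz(5)[OF n s0] by blast
      next
        case False
        then have "full 10" using full10 s_neq_1[OF n] s0 n by simp
        then show ?thesis by (intro disjI1 full_strict) auto
      qed
      then show ?thesis
        by (intro bounded_step[of 11]) (use B9 B10 n nc_strict_11[OF n s0] nc_strict_bounded in auto)
    qed
    show ?thesis
    proof (cases "t \<le> 11")
      case True
      then have "t = 6 \<or> t = 7 \<or> t = 8 \<or> t = 9 \<or> t = 10 \<or> t = 11" using t by linarith
      then show ?thesis using B6 B7 B8 B9 B10 B11 t by auto
    next
      case False
      then have s: "s = 1 / 10" using s_cases s0 t by auto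
      show ?thesis
        using t False
      proof (induction t rule: less_induct)
        case (less t)
        have S: "nc_strict t" "nc_strict (t - 1)" using full_witt[OF s] less.prems by (auto intro!: full_strict)
        have B: "bounded j" if "10 \<le> j" "j < t" for j
        proof -
          have "j = 10 \<or> j = 11 \<or> \<not> j \<le> 11" using that by linarith
          then show ?thesis using that less.prems less.IH[of j] B10 B11 by auto
        qed
        show ?case
          by (rule bounded_step) (use S B[of "t - 1"] B[of "t - 2"] less.prems nc_strict_bounded in auto)
      qed
    qed
  qed
qed

end

section \<open>Presentations\<close>

definition coord :: "nat \<Rightarrow> (nat \<Rightarrow> 'a::real_vector) \<Rightarrow> nat \<Rightarrow> 'a \<Rightarrow> real" where
  "coord n Y i v = representation (Y ` {1..n}) v (Y i)"

lemma
  fixes Y :: "nat \<Rightarrow> 'a::real_vector"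
  assumes B: "is_basis_upto n Y"
  shows linear_coord: "linear (coord n Y i)"
    and coord_expand: "v = (\<Sum>i = 1..n. coord n Y i v *\<^sub>R Y i)"
    and coord_basis: "i \<in> {1..n} \<Longrightarrow> j \<in> {1..n} \<Longrightarrow> coord n Y i (Y j) = (if i = j then 1 else 0)"
proof -
  have inj: "inj_on Y {1..n}" and ind: "independent (Y ` {1..n})" and sp: "span (Y ` {1..n}) = UNIV"
    using B by (auto simp: is_basis_upto_def)
  have in_sp: "v \<in> span (Y ` {1..n})" for v using sp by simp
  show "linear (coord n Y i)"
    by (rule linearI) (simp_all only: coord_def representation_add[OF ind in_sp in_sp] representation_scale[OF ind in_sp]
        real_scaleR_def)
  show "v = (\<Sum>i = 1..n. coord n Y i v *\<^sub>R Y i)"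
  proof -
    have "v = (\<Sum>b\<in>Y ` {1..n}. representation (Y ` {1..n}) v b *\<^sub>R b)"
      by (rule sum_representation_eq[symmetric, OF ind in_sp]) auto
    also have "\<dots> = (\<Sum>i = 1..n. representation (Y ` {1..n}) v (Y i) *\<^sub>R Y i)"
      by (subst sum.reindex[OF inj]) (simp add: o_def)
    finally show ?thesis by (simp only: coord_def)
  qed
  assume ij: "i \<in> {1..n}" "j \<in> {1..n}"
  have "representation (Y ` {1..n}) (Y j) = (\<lambda>v. if v = Y j then 1 else 0)"
    by (rule representation_basis[OF ind]) (use ij in blast)
  moreover have "Y i = Y j \<longleftrightarrow> i = j" using inj_on_eq_iff[OF inj ij] .
  ultimately show "coord n Y i (Y j) = (if i = j then 1 else 0)" by (simp only: coord_def)
qed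

lemma graded_filiformI:
  assumes lie: "fin_dim_lie_algebra br" and B: "is_basis_upto n X" and n: "3 \<le> n"
    and r: "\<And>i j. i \<in> {1..n} \<Longrightarrow> j \<in> {1..n} \<Longrightarrow> br (X i) (X j) = (if i + j \<le> n then c i j *\<^sub>R X (i + j) else 0)"
    and c1: "\<And>i. 2 \<le> i \<Longrightarrow> i < n \<Longrightarrow> c 1 i = 1"
  shows "graded_filiform br n (\<lambda>i. if i \<in> {1..n} then X i else 0)
     (\<lambda>i v. if i \<in> {1..n} then coord n X i v else 0) c"
proof -
  interpret fin_dim_lie_algebra br by fact
  show ?thesis
    unfolding graded_filiform_def
  proof (intro conjI allI impI)
    show "bilinear br" by (rule bilinear_br)
    show "br x x = 0" for x by (rule br_self)
    show "br x (br y z) + br y (br z x) + br z (br x y) = 0" for x y z by (rule jacobi)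
    show "3 \<le> n" by (rule n)
    show "linear (\<lambda>v. if i \<in> {1..n} then coord n X i v else 0)" for i
    proof (cases "i \<in> {1..n}")
      case True
      then show ?thesis using linear_coord[OF B, of i] by simp
    next
      case False
      show ?thesis by (simp only: False if_False) (simp add: linear_iff)
    qed
    show "v = (\<Sum>i = 1..n. (if i \<in> {1..n} then coord n X i v else 0) *\<^sub>R (if i \<in> {1..n} then X i else 0))" for v
    proof -
      have "(\<Sum>i = 1..n. (if i \<in> {1..n} then coord n X i v else 0) *\<^sub>R (if i \<in> {1..n} then X i else 0))
        = (\<Sum>i = 1..n. coord n X i v *\<^sub>R X i)" by (rule sum.cong) auto
      then show ?thesis using coord_expand[OF B, of v] by simp
    qed
    show "(if i \<in> {1..n} then coord n X i (if j \<in> {1..n} then X j else 0) else 0) = (if i = j then 1 else 0)"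
      if "i \<in> {1..n}" "j \<in> {1..n}" for i j
      using coord_basis[OF B that] by (simp only: that if_True)
    show "br (if i \<in> {1..n} then X i else 0) (if j \<in> {1..n} then X j else 0) = c i j *\<^sub>R (if i + j \<in> {1..n} then X (i + j) else 0)"
      if "1 \<le> i" "1 \<le> j" for i j
    proof (cases "i \<le> n \<and> j \<le> n")
      case True
      then show ?thesis using that r[of i j] by simp
    next
      case False
      then have "i + j \<notin> {1..n}" "i \<notin> {1..n} \<or> j \<notin> {1..n}" by auto
      then show ?thesis
        by (elim disjE) (simp_all only: if_False bilinear_lzero[OF bilinear_br] bilinear_rzero[OF bilinear_br] scaleR_zero_right)
    qed
    show "c 1 i = 1" if "2 \<le> i" "i < n" for i using c1 that .
  qed auto
qed

lemma dim_basis: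
  fixes X :: "nat \<Rightarrow> 'a::real_vector"
  assumes "is_basis_upto n X" shows "dim (UNIV :: 'a set) = n"
proof -
  have "inj_on X {1..n}" and ind: "independent (X ` {1..n})" and sp: "span (X ` {1..n}) = UNIV"
    using assms by (auto simp: is_basis_upto_def)
  then have "card (X ` {1..n}) = n" by (simp add: card_image)
  moreover have "span (X ` {1..n}) = span UNIV" using sp by simp
  ultimately show ?thesis using dim_eq_card[OF _ ind] by simp
qed

lemma one_dim_generator:
  assumes V: "subspace V" "dim V = 1" obtains e where "e \<noteq> 0" "V = span {e}"
proof -
  obtain B where B: "B \<subseteq> V" "independent B" "V \<subseteq> span B" "card B = dim V" using basis_exists[of V] by metis
  then obtain e where e: "B = {e}" using V(2) by (metis card_1_singletonE)
  have "e \<noteq> 0" using B(2) dependent_zero e by blast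
  moreover have "span B \<subseteq> V" using span_minimal[OF B(1) V(1)] .
  ultimately show thesis using that[of e] B(3) e by auto
qed

lemma basis_from_spanning:
  fixes X :: "nat \<Rightarrow> 'a::real_vector"
  assumes sp: "span (X ` {1..n}) = UNIV" and d: "dim (UNIV :: 'a set) = n" shows "is_basis_upto n X"
proof -
  have le: "n \<le> card T" if "finite T" "UNIV \<subseteq> span T" for T :: "'a set"
    using dim_le_card[OF that(2,1)] d by simp
  have "card (X ` {1..n}) \<le> n" using card_image_le[of "{1..n}" X] by simp
  then have c: "card (X ` {1..n}) = n" using le[of "X ` {1..n}"] sp by simp
  then have "inj_on X {1..n}" by (intro eq_card_imp_inj_on) auto
  moreover have "independent (X ` {1..n})"
  proof
    assume "dependent (X ` {1..n})"
    then obtain a where a: "a \<in> X ` {1..n}" "a \<in> span (X ` {1..n} - {a})" by (auto simp: dependent_def)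
    have "span (X ` {1..n} - {a}) = span (insert a (X ` {1..n} - {a}))" using span_redundant[OF a(2)] by simp
    also have "\<dots> = UNIV" using a(1) sp by (simp add: insert_absorb)
    finally have "n \<le> card (X ` {1..n} - {a})" by (intro le) auto
    moreover have "card (X ` {1..n} - {a}) < card (X ` {1..n})" using a(1) by (intro psubset_card_mono) auto
    ultimately show False using c by simp
  qed
  ultimately show ?thesis using sp by (simp add: is_basis_upto_def)
qed

text \<open>\<open>X i\<close> is obtained by iterating \<open>ad e_1\<close> on a generator of
  \<open>V 2\<close>; as \<open>[V_1, V_i] = V_{i+1}\<close> is a line, no \<open>X i\<close>
  vanishes, and \<open>c 1 i = 1\<close> by construction.\<close>

lemma N_graded_basis:
  fixes br :: "'a::real_vector \<Rightarrow> 'a \<Rightarrow> 'a"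
  assumes lie: "fin_dim_lie_algebra br" and N: "N_graded_filiform br" and n: "n = dim (UNIV :: 'a set)" "3 \<le> n"
  obtains X c where "is_basis_upto n X"
    "\<And>i j. i \<in> {1..n} \<Longrightarrow> j \<in> {1..n} \<Longrightarrow> br (X i) (X j) = (if i + j \<le> n then c i j *\<^sub>R X (i + j) else 0)"
    "\<And>i. 2 \<le> i \<Longrightarrow> i < n \<Longrightarrow> c 1 i = (1::real)"
proof -
  interpret fin_dim_lie_algebra br by fact
  have "\<exists>V. (\<forall>i\<in>{1..n}. subspace (V i) \<and> dim (V i) = 1) \<and> (\<forall>i>n. V i = {0}) \<and> is_direct_sum n V \<and>
      (\<forall>i>1. bracket_span br (V 1) (V i) = V (i + 1)) \<and>
      (\<forall>i\<ge>1. \<forall>j\<ge>1. bracket_span br (V i) (V j) \<subseteq> V (i + j))"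
    using N unfolding N_graded_filiform_def Let_def n(1) by (rule conjunct2)
  then obtain V where V': "(\<forall>i\<in>{1..n}. subspace (V i) \<and> dim (V i) = 1) \<and> (\<forall>i>n. V i = {0}) \<and> is_direct_sum n V \<and>
      (\<forall>i>1. bracket_span br (V 1) (V i) = V (i + 1)) \<and>
      (\<forall>i\<ge>1. \<forall>j\<ge>1. bracket_span br (V i) (V j) \<subseteq> V (i + j))" by (rule exE)
  note rest = V'[THEN conjunct2]
  have V: "subspace (V i) \<and> dim (V i) = 1" if "i \<in> {1..n}" for i by (rule bspec[OF V'[THEN conjunct1] that])
  have Vn: "V i = {0}" if "n < i" for i using rest[THEN conjunct1, rule_format, OF that] .
  have ds: "is_direct_sum n V" by (rule rest[THEN conjunct2, THEN conjunct1])
  have V1: "bracket_span br (V 1) (V i) = V (i + 1)" if "1 < i" for i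
    using rest[THEN conjunct2, THEN conjunct2, THEN conjunct1, rule_format, OF that] .
  have VV: "bracket_span br (V i) (V j) \<subseteq> V (i + j)" if "1 \<le> i" "1 \<le> j" for i j
    using rest[THEN conjunct2, THEN conjunct2, THEN conjunct2, rule_format, OF that] .
  have V12: "subspace (V 1)" "dim (V 1) = 1" "subspace (V 2)" "dim (V 2) = 1"
    using V[of 1] V[of 2] n(2) by simp_all
  obtain e1 where e1: "e1 \<noteq> 0" "V 1 = span {e1}" by (rule one_dim_generator[OF V12(1,2)])
  obtain e2 where e2: "e2 \<noteq> 0" "V 2 = span {e2}" by (rule one_dim_generator[OF V12(3,4)])
  define X where "X i = (if i = 1 then e1 else (br e1 ^^ (i - 2)) e2)" for i
  have X1: "X 1 = e1" and X2: "X 2 = e2" by (simp_all add: X_def)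
  have XS: "X (Suc i) = br e1 (X i)" if "2 \<le> i" for i
  proof -
    from le_Suc_ex[OF that] obtain m where "i = Suc (Suc m)" by auto
    then show ?thesis by (simp add: X_def)
  qed
  have brV: "br x y \<in> V (i + j)" if "x \<in> V i" "y \<in> V j" "1 \<le> i" "1 \<le> j" for x y i j
  proof -
    have "br x y \<in> {br x y |x y. x \<in> V i \<and> y \<in> V j}" using that(1,2) by blast
    then have "br x y \<in> bracket_span br (V i) (V j)" unfolding bracket_span_def by (rule span_base)
    then show ?thesis using VV[OF that(3,4)] by blast
  qed
  have VX: "V i = span {X i} \<and> X i \<noteq> 0" if "2 \<le> i" "i \<le> n" for i
    using that
  proof (induction i rule: dec_induct)
    case base
    then show ?case using e2 X2 by simp
  next
    case (step i)
    have IH: "V i = span {X i}" using step.IH step.prems by simp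
    have "{br x y |x y. x \<in> V 1 \<and> y \<in> V i} \<subseteq> span {X (Suc i)}"
    proof
      fix w assume "w \<in> {br x y |x y. x \<in> V 1 \<and> y \<in> V i}"
      then obtain a b where "w = br (a *\<^sub>R e1) (b *\<^sub>R X i)" using e1(2) IH by (auto simp: span_singleton)
      then have "w = (a * b) *\<^sub>R X (Suc i)"
        using XS[OF step.hyps(1)] by (simp add: bilinear_lmul[OF bilinear_br] bilinear_rmul[OF bilinear_br])
      then show "w \<in> span {X (Suc i)}" by (simp add: span_base span_scale)
    qed
    then have "bracket_span br (V 1) (V i) \<subseteq> span {X (Suc i)}"
      unfolding bracket_span_def by (rule span_minimal) (rule subspace_span)
    then have "V (i + 1) \<subseteq> span {X (Suc i)}" using V1[of i] step.hyps by simp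
    moreover have "X (Suc i) \<in> V (i + 1)"
      unfolding XS[OF step.hyps(1)] using brV[of e1 1 "X i" i] e1 IH step.hyps by (simp add: span_base)
    then have "span {X (Suc i)} \<subseteq> V (i + 1)" using V[of "i + 1"] step.hyps step.prems by (intro span_minimal) auto
    ultimately have eq: "V (Suc i) = span {X (Suc i)}" by simp
    have "X (Suc i) \<noteq> 0"
    proof
      assume "X (Suc i) = 0"
      then have "V (Suc i) \<subseteq> span {}" using eq by simp
      then have "dim (V (Suc i)) = 0" using dim_le_card[of "V (Suc i)" "{}"] by simp
      then show False using V[of "Suc i"] step.hyps step.prems by simp
    qed
    then show ?case using eq by simp
  qed
  have VX': "V i = span {X i} \<and> X i \<noteq> 0" if "i \<in> {1..n}" for i
    using VX[of i] e1 X1 that by (cases "i = 1") auto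
  have "x \<in> span (X ` {1..n})" for x
  proof -
    obtain v where v: "v \<in> (\<Pi>\<^sub>E i\<in>{1..n}. V i)" "x = (\<Sum>i = 1..n. v i)"
      using ds unfolding is_direct_sum_def by metis
    have "v i \<in> span (X ` {1..n})" if i: "i \<in> {1..n}" for i
    proof -
      have "v i \<in> span {X i}" using v(1) VX'[OF i] i by (auto simp: PiE_def Pi_def)
      moreover have "span {X i} \<subseteq> span (X ` {1..n})" using i by (intro span_mono) auto
      ultimately show ?thesis by blast
    qed
    then show ?thesis unfolding v(2) by (rule span_sum)
  qed
  then have B: "is_basis_upto n X" using n by (intro basis_from_spanning) auto
  define c where "c i j = (SOME a. br (X i) (X j) = a *\<^sub>R X (i + j))" for i j
  have r: "br (X i) (X j) = (if i + j \<le> n then c i j *\<^sub>R X (i + j) else 0)" if ij: "i \<in> {1..n}" "j \<in> {1..n}" for i j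
  proof -
    have b: "br (X i) (X j) \<in> V (i + j)"
      using VX'[OF ij(1)] VX'[OF ij(2)] ij by (intro brV) (auto intro: span_base)
    show ?thesis
    proof (cases "i + j \<le> n")
      case True
      then have "br (X i) (X j) \<in> span {X (i + j)}" using b VX'[of "i + j"] ij by simp
      then have "\<exists>a. br (X i) (X j) = a *\<^sub>R X (i + j)" by (auto simp: span_singleton)
      then have "br (X i) (X j) = c i j *\<^sub>R X (i + j)" unfolding c_def by (rule someI_ex)
      then show ?thesis using True by simp
    next
      case False
      then show ?thesis using b Vn by simp
    qed
  qed
  have "c 1 i = 1" if i: "2 \<le> i" "i < n" for i
  proof -
    have "c 1 i *\<^sub>R X (1 + i) = X (Suc i)" using r[of 1 i] i XS[OF i(1)] X1 by simp
    then have "(c 1 i - 1) *\<^sub>R X (Suc i) = 0" by (simp add: scaleR_left_diff_distrib)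
    then show ?thesis using VX'[of "Suc i"] i by simp
  qed
  then show thesis using that[of X c] B r by blast
qed

context graded_filiform
begin

text \<open>For degrees at least 2 both factors of a bracket are scaled but its value only once, so
  these constants gain one factor \<mu>. This serves to normalise \<open>c 2 (k - 2)\<close> and,
  with -1, to match the signs of type (b).\<close>

lemma scale:
  assumes \<mu>: "\<mu> \<noteq> 0"
  shows "graded_filiform br n (\<lambda>i. if i = 1 then X i else \<mu> *\<^sub>R X i) (\<lambda>i v. if i = 1 then co i v else co i v / \<mu>)
    (\<lambda>i j. if i = 1 \<or> j = 1 then c i j else \<mu> * c i j)"
  unfolding graded_filiform_def
proof (intro conjI allI impI)
  show "bilinear br" by (rule bil)
  show "br x x = 0" for x by (rule br_self)
  show "br x (br y z) + br y (br z x) + br z (br x y) = 0" for x y z by (rule jac)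
  show "3 \<le> n" by (rule n3)
  show "linear (\<lambda>v. if i = 1 then co i v else co i v / \<mu>)" for i
    by (cases "i = 1") (auto simp: lin_co linear_add[OF lin_co] linear_scale[OF lin_co] add_divide_distrib intro!: linearI)
  show "v = (\<Sum>i = 1..n. (if i = 1 then co i v else co i v / \<mu>) *\<^sub>R (if i = 1 then X i else \<mu> *\<^sub>R X i))" for v
  proof -
    have "(\<Sum>i = 1..n. (if i = 1 then co i v else co i v / \<mu>) *\<^sub>R (if i = 1 then X i else \<mu> *\<^sub>R X i))
        = (\<Sum>i = 1..n. co i v *\<^sub>R X i)" using \<mu> by (intro sum.cong) auto
    then show ?thesis using expand[of v] by simp
  qed
  show "(if i = 1 then co i (if j = 1 then X j else \<mu> *\<^sub>R X j) else co i (if j = 1 then X j else \<mu> *\<^sub>R X j) / \<mu>) = (if i = j then 1 else 0)"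
    if "i \<in> {1..n}" "j \<in> {1..n}" for i j
    using that \<mu> by (simp add: co_X linear_scale[OF lin_co])
  show "(if i = 1 then co i v else co i v / \<mu>) = 0" if "i \<notin> {1..n}" for i v
    using co_out[OF that, of v] by (cases "i = 1") auto
  show "(if i = 1 then X i else \<mu> *\<^sub>R X i) = 0" if "i \<notin> {1..n}" for i using X_out[OF that] by (cases "i = 1") auto
  show "br (if i = 1 then X i else \<mu> *\<^sub>R X i) (if j = 1 then X j else \<mu> *\<^sub>R X j)
      = (if i = 1 \<or> j = 1 then c i j else \<mu> * c i j) *\<^sub>R (if i + j = 1 then X (i + j) else \<mu> *\<^sub>R X (i + j))"
    if ij: "1 \<le> i" "1 \<le> j" for i j
  proof (cases "i = 1 \<and> j = 1")
    case True
    have "c 1 1 *\<^sub>R X (1 + 1) = 0" using br_X[of 1 1] br_self[of "X 1"] by simp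
    then show ?thesis using True br_self by auto
  next
    case False
    then show ?thesis using br_X[OF ij] ij by (auto simp: bilinear_lmul[OF bil] bilinear_rmul[OF bil])
  qed
  show "(if 1 = (1::nat) \<or> i = 1 then c 1 i else \<mu> * c 1 i) = 1" if "2 \<le> i" "i < n" for i using c1[OF that] by simp
qed

lemma dim_UNIV: "dim (UNIV :: 'a set) = n"
proof -
  have "D UNIV = {1..n}" using D_range[of UNIV] D_I[OF UNIV_I lead_X] by auto
  then show ?thesis using dim_eq_card_D[of UNIV] by simp
qed

lemma basis: "is_basis_upto n X"
  by (rule basis_from_spanning[OF span_X dim_UNIV])

lemma type_a_if_abelian:
  assumes z: "\<And>i j. 2 \<le> i \<Longrightarrow> 2 \<le> j \<Longrightarrow> i + j \<le> n \<Longrightarrow> c i j = 0" shows "type_a br"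
  unfolding type_a_def lie_presentation_def
proof (intro exI conjI)
  show "is_basis_upto n X" by (rule basis)
  show "\<forall>(i, j, v)\<in>{(1, i, X (i + 1)) | i. 1 < i \<and> i < n}. br (X i) (X j) = v"
    using br_X[of 1] c1 by auto
  show "\<forall>i\<in>{1..n}. \<forall>j\<in>{1..n}. (\<forall>v. (i, j, v) \<notin> {(1, i, X (i + 1)) | i. 1 < i \<and> i < n} \<and>
      (j, i, v) \<notin> {(1, i, X (i + 1)) | i. 1 < i \<and> i < n}) \<longrightarrow> br (X i) (X j) = 0"
  proof (intro ballI impI)
    fix i j assume ij: "i \<in> {1..n}" "j \<in> {1..n}"
      and no: "\<forall>v. (i, j, v) \<notin> {(1, i, X (i + 1)) | i. 1 < i \<and> i < n} \<and> (j, i, v) \<notin> {(1, i, X (i + 1)) | i. 1 < i \<and> i < n}"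
    have no1: "\<not> (i = 1 \<and> 1 < j \<and> j < n)" "\<not> (j = 1 \<and> 1 < i \<and> i < n)" using no by auto
    consider "i = j" | "n < i + j" | "2 \<le> i" "2 \<le> j" "i + j \<le> n" using no1 ij by force
    then show "br (X i) (X j) = 0"
    proof cases
      case 1 then show ?thesis using br_self by simp
    next
      case 2 then show ?thesis using br_X[of i j] X_out[of "i + j"] ij by simp
    next
      case 3 then show ?thesis using br_X[of i j] z by simp
    qed
  qed
qed

end

context graded_filiform_k
begin

lemma type_b_if_top: assumes k: "k = n" "7 \<le> k" shows "type_b br"
proof -
  \<comment> \<open>\<open>row_k\<close> starts with 1 at degree 2, the presentation of type (b)
    with -1.\<close>
  define Y where "Y = (\<lambda>i. if i = 1 then X i else (-1) *\<^sub>R X i)"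
  define d where "d = (\<lambda>i j. if i = 1 \<or> j = 1 then c i j else (-1) * c i j)"
  interpret Y: graded_filiform br n Y "\<lambda>i v. if i = 1 then co i v else co i v / (-1)" d
    unfolding Y_def d_def by (rule scale) simp
  obtain m where m: "k = 2 * m + 1" using k_odd by (elim oddE) auto
  have m3: "3 \<le> m" using m k by simp
  have d: "d l (k - l) = (-1) ^ (l + 1)" if "2 \<le> l" "l + 2 \<le> k" for l
  proof -
    have "l \<noteq> 1" "k - l \<noteq> 1" using that by linarith+
    then show ?thesis using row_k[OF that] by (simp add: d_def)
  qed
  let ?R = "{(1, i, Y (i + 1)) | i. 1 < i \<and> i < 2 * m + 1} \<union>
      {(l, 2 * m + 1 - l, (-1) ^ (l + 1) *\<^sub>R Y (2 * m + 1)) | l. 1 < l \<and> l < m + 1}"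
  have "lie_presentation br (2 * m + 1) Y ?R"
    unfolding lie_presentation_def
  proof (intro conjI)
    show "is_basis_upto (2 * m + 1) Y" using Y.basis m k by simp
    have "br (Y 1) (Y i) = Y (i + 1)" if "1 < i" "i < 2 * m + 1" for i
      using Y.br_X[of 1 i] Y.c1[of i] that m k by simp
    moreover have "br (Y l) (Y (2 * m + 1 - l)) = (-1) ^ (l + 1) *\<^sub>R Y (2 * m + 1)" if "1 < l" "l < m + 1" for l
      using Y.br_X[of l "2 * m + 1 - l"] d[of l] that m by simp
    ultimately show "\<forall>(i, j, v)\<in>?R. br (Y i) (Y j) = v" by blast
    show "\<forall>i\<in>{1..2 * m + 1}. \<forall>j\<in>{1..2 * m + 1}. (\<forall>v. (i, j, v) \<notin> ?R \<and> (j, i, v) \<notin> ?R) \<longrightarrow> br (Y i) (Y j) = 0"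
    proof (intro ballI impI)
      fix i j assume ij: "i \<in> {1..2 * m + 1}" "j \<in> {1..2 * m + 1}" and no: "\<forall>v. (i, j, v) \<notin> ?R \<and> (j, i, v) \<notin> ?R"
      have no1: "\<not> (i = 1 \<and> 1 < j \<and> j < 2 * m + 1)" "\<not> (j = 1 \<and> 1 < i \<and> i < 2 * m + 1)" using no by auto
      have no2: "\<not> (1 < i \<and> i < m + 1 \<and> j = 2 * m + 1 - i)" "\<not> (1 < j \<and> j < m + 1 \<and> i = 2 * m + 1 - j)" using no by blast+
      consider "i = j" | "n < i + j" | "2 \<le> i" "2 \<le> j" "i + j \<le> n" using no1 ij m k by force
      then show "br (Y i) (Y j) = 0"
      proof cases
        case 1 then show ?thesis using br_self by simp
      next
        case 2 then show ?thesis using Y.br_X[of i j] Y.X_out[of "i + j"] ij by simp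
      next
        case 3
        have "i + j \<noteq> k"
        proof
          assume s: "i + j = k"
          then have "i < m + 1 \<and> j = 2 * m + 1 - i \<or> j < m + 1 \<and> i = 2 * m + 1 - j" using m by auto
          then show False using no2 3 by auto
        qed
        then have "d i j = 0" using 3 low[of i j] k by (simp add: d_def)
        then show ?thesis using Y.br_X[of i j] 3 by simp
      qed
    qed
  qed
  then show ?thesis unfolding type_b_def using m3 by blast
qed

end

text \<open>In the first nonzero row the recursion reduces to a change of sign, so its first entry
  \<open>c 2 (k - 2)\<close> is nonzero and can be scaled to 1. Row 4 is excluded by
  \<open>c 2 2 = 0\<close>.\<close>

lemma (in graded_filiform) ex_first_row:
  assumes nz: "2 \<le> i" "2 \<le> j" "i + j \<le> n" "c i j \<noteq> 0"
  obtains k X' co' c' where "graded_filiform_k br n X' co' c' k"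
proof -
  let ?P = "\<lambda>k. \<exists>i j. 2 \<le> i \<and> 2 \<le> j \<and> i + j = k \<and> k \<le> n \<and> c i j \<noteq> 0"
  define k where "k = (LEAST k. ?P k)"
  have "?P (i + j)" using nz by blast
  then have Pk: "?P k" unfolding k_def by (rule LeastI[where P = ?P])
  have least: "\<And>k'. k' < k \<Longrightarrow> \<not> ?P k'" unfolding k_def by (rule not_less_Least[where P = ?P])
  have kn: "k \<le> n" using Pk by blast
  have low: "c i j = 0" if "2 \<le> i" "2 \<le> j" "i + j < k" for i j using least[OF that(3)] that kn by auto
  obtain i0 where i0: "2 \<le> i0" "i0 + 2 \<le> k" "c i0 (k - i0) \<noteq> 0"
  proof -
    obtain i j where "2 \<le> i" "2 \<le> j" "i + j = k" "c i j \<noteq> 0" using Pk by blast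
    then show thesis using that[of i] by auto
  qed
  have step: "c (Suc i) (k - Suc i) = - c i (k - i)" if "2 \<le> i" "i + 3 \<le> k" for i
  proof -
    have "c i (Suc (k - 1) - i) = c i (k - 1 - i) - c (Suc i) (k - 1 - i)" using that kn by (intro c_rec_row) auto
    moreover have "c i (k - 1 - i) = 0" using that by (intro low) auto
    moreover have "k - 1 - i = k - Suc i" "Suc (k - 1) - i = k - i" using that by auto
    ultimately show ?thesis by simp
  qed
  have "c i (k - i) = 0 \<longleftrightarrow> c 2 (k - 2) = 0" if "2 \<le> i" "i + 2 \<le> k" for i
    using that
  proof (induction i rule: dec_induct)
    case (step i)
    then show ?case using \<open>\<And>i. 2 \<le> i \<Longrightarrow> i + 3 \<le> k \<Longrightarrow> c (Suc i) (k - Suc i) = - c i (k - i)\<close>[of i] by simp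
  qed simp
  then have ck: "c 2 (k - 2) \<noteq> 0" using i0 by blast
  have "k \<noteq> 4" using ck c_diag[of 2] kn by auto
  then have k5: "5 \<le> k" using i0 by simp
  define \<mu> where "\<mu> = 1 / c 2 (k - 2)"
  have \<mu>: "\<mu> \<noteq> 0" using ck by (simp add: \<mu>_def)
  have "graded_filiform_k br n (\<lambda>i. if i = 1 then X i else \<mu> *\<^sub>R X i) (\<lambda>i v. if i = 1 then co i v else co i v / \<mu>)
    (\<lambda>i j. if i = 1 \<or> j = 1 then c i j else \<mu> * c i j) k"
    unfolding graded_filiform_k_def
  proof (intro conjI scale[OF \<mu>])
    show "graded_filiform_k_axioms n (\<lambda>i j. if i = 1 \<or> j = 1 then c i j else \<mu> * c i j) k"
      using k5 kn low ck by unfold_locales (auto simp: \<mu>_def)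
  qed
  then show thesis by (rule that)
qed

section \<open>Upper bounds\<close>

context graded_filiform_ip
begin

lemma tg_if_geodesic:
  assumes sub: "lie_subalgebra br h" and geo: "totally_geodesic br ip h" and F2: "h \<subseteq> F 2" shows "tg n h"
  unfolding tg_def
proof (intro conjI ballI)
  have zero: "v \<in> F (Suc n) \<Longrightarrow> v = 0" for v by (rule F_zero) auto
  show "n \<le> n" "subspace h" "h \<subseteq> F 2" using sub F2 by (auto simp: lie_subalgebra_def)
  show "F (Suc n) \<subseteq> perp h" using zero perp_closed(1) by blast
  show "\<exists>h'\<in>h. br x y - h' \<in> F (Suc n)" if "x \<in> h" "y \<in> h" for x y
  proof
    show "br x y \<in> h" using sub that by (simp add: lie_subalgebra_def)
    show "br x y - br x y \<in> F (Suc n)" using F_closed(1) by simp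
  qed
  show "ip (br y x) x = 0" if y: "y \<in> perp h" and x: "x \<in> h" for y x
  proof -
    have "ip (br y x) x + ip (br y x) x = 0" using geo y x unfolding totally_geodesic_def by blast
    then show ?thesis by simp
  qed
qed

lemma card_tg_top: assumes tg: "tg n H" shows "card (D H) \<le> n - 2"
proof -
  have sub: "D H \<subseteq> {2..n}" by (rule tg_D[OF tg])
  have "D H \<noteq> {2..n}"
  proof
    assume eq: "D H = {2..n}"
    then have "n \<in> D H" "n - 1 \<in> D H" using n3 unfolding eq by auto
    then show False using consec[OF tg] n3 by simp
  qed
  then have "card (D H) < card {2..n}" using sub by (intro psubset_card_mono) auto
  then show ?thesis by simp
qed

text \<open>Let \<open>p\<close> be the least leading degree of \<open>h\<close> above 1. Brackets
  with \<open>x\<close> show \<open>F p \<subseteq> h\<close>, skew-symmetry shows that normal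
  vectors annihilate \<open>F p\<close>, and \<open>h\<close> is \<open>F p\<close> plus the line of
  a vector \<open>x'\<close> orthogonal to it. Then \<open>ad x'\<close> preserves the normal space,
  but it produces there a leading degree above the highest one.\<close>

lemma card_not_F2:
  assumes sub: "lie_subalgebra br h" and geo: "totally_geodesic br ip h" and proper: "h \<noteq> UNIV"
    and F2: "\<not> h \<subseteq> F 2"
  shows "card (D h) \<le> 1"
proof (rule ccontr)
  assume big: "\<not> card (D h) \<le> 1"
  have subs: "subspace h" using sub by (simp add: lie_subalgebra_def)
  note hc = subspace_add[OF subs] subspace_diff[OF subs] subspace_scale[OF subs]
  have skew: "ip (br y a) b + ip (br y b) a = 0" if "y \<in> perp h" "a \<in> h" "b \<in> h" for y a b
    using geo that unfolding totally_geodesic_def by blast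
  obtain x where x: "x \<in> h" "lead 1 x"
  proof -
    obtain x where "x \<in> h" "x \<notin> F 2" using F2 by blast
    then obtain i where "lead i x" "i < 2" using ex_lead_not_F by blast
    moreover have "i \<in> {1..n}" by (rule lead_range[OF \<open>lead i x\<close>])
    ultimately have "lead 1 x" by (cases "i = 1") auto
    then show thesis using \<open>x \<in> h\<close> by (rule that[rotated])
  qed
  have "\<exists>i. i \<in> D h \<and> 2 \<le> i"
  proof (rule ccontr)
    assume no: "\<nexists>i. i \<in> D h \<and> 2 \<le> i"
    have "D h \<subseteq> {1}"
    proof
      fix i assume i: "i \<in> D h"
      then have "i \<in> {1..n}" "\<not> 2 \<le> i" using D_range no by blast+
      then show "i \<in> {1}" by simp
    qed
    then show False using big card_mono[of "{1}" "D h"] by simp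
  qed
  then obtain p where p: "p \<in> D h" "2 \<le> p" and min: "\<And>i. i \<in> D h \<Longrightarrow> 2 \<le> i \<Longrightarrow> p \<le> i"
    using ex_least_nat_le[of "\<lambda>i. i \<in> D h \<and> 2 \<le> i"] exists_least_iff[of "\<lambda>i. i \<in> D h \<and> 2 \<le> i"]
    by (metis not_le)
  have pn: "p \<le> n" using D_range p by fastforce
  have up: "Suc i \<in> D h" if i: "i \<in> D h" "2 \<le> i" "i < n" for i
  proof -
    obtain z where z: "z \<in> h" "lead i z" using i(1) by (rule D_obtain)
    have "lead (1 + i) (br x z)" using lead_br[OF x(2) z(2)] c1[of i] i by simp
    moreover have "br x z \<in> h" using sub x z by (simp add: lie_subalgebra_def)
    ultimately show ?thesis using D_I by auto
  qed
  have all: "i \<in> D h" if "p \<le> i" "i \<le> n" for i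
    using that
  proof (induction i rule: dec_induct)
    case base
    then show ?case using p by simp
  next
    case (step i)
    have "i \<in> D h" using step.IH step.prems by simp
    then show ?case using up step.hyps step.prems p(2) by simp
  qed
  have Fh: "F i \<subseteq> h" if "p \<le> i" "i \<le> Suc n" for i
    using that(2,1)
  proof (induction i rule: inc_induct)
    case base
    then show ?case using F_zero subspace_0[OF subs] by blast
  next
    case (step i)
    have i: "i \<in> D h" using all step.prems step.hyps by simp
    obtain z where z: "z \<in> h" "lead i z" using i by (rule D_obtain)
    show ?case
    proof
      fix v assume "v \<in> F i"
      then obtain \<alpha> where "v - \<alpha> *\<^sub>R z \<in> F (Suc i)" using reduce[OF z(2)] by blast
      then have "v - \<alpha> *\<^sub>R z \<in> h" using step.IH step.prems by auto
      then show "v \<in> h" using hc(1)[of "v - \<alpha> *\<^sub>R z" "\<alpha> *\<^sub>R z"] hc(3)[OF z(1)] by simp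
    qed
  qed
  \<comment> \<open>With \<open>g = br y f\<close>, skew-symmetry turns \<open>ip g g\<close> into
    \<open>- ip (br y g) f\<close>, and \<open>br y g = 0\<close> by induction, since
    \<open>g\<close> has higher degree.\<close>
  have brF: "br y f = 0" if y: "y \<in> perp h" and "i \<le> Suc n" "p \<le> i" "f \<in> F i" for y i f
    using that(2-)
  proof (induction i arbitrary: f rule: inc_induct)
    case base
    then have "f = 0" by (intro F_zero) auto
    then show ?case by (simp add: br_simps)
  next
    case (step i)
    define g where "g = br y f"
    have g: "g \<in> F (Suc i)" unfolding g_def by (rule br_F'[OF F_1[of y] step.prems(2)]) simp
    have "br y g = 0" using step.IH[OF _ g] step.prems by simp
    moreover have "f \<in> h" "g \<in> h" using Fh[of i] Fh[of "Suc i"] step g by auto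
    ultimately have "ip g g = 0" using skew[OF y, of f g] by (simp add: g_def ip_simps)
    then show ?case using ip_eq_0 g_def by blast
  qed
  obtain q where q: "q \<in> F p" "x - q \<in> perp (F p)" using ex_proj[OF subspace_F] by blast
  define x' where "x' = x - q"
  have x'h: "x' \<in> h" using x(1) q(1) Fh[of p] pn hc(2) unfolding x'_def by auto
  have x'l: "lead 1 x'"
  proof (rule lead_diff[OF x(2)])
    show "x - x' \<in> F (Suc 1)" using F_mono[of 2 p q] q(1) p(2) by (simp add: x'_def numeral_2_eq_2)
  qed
  have small: "v \<in> F p" if v: "v \<in> h" "v \<in> F 2" for v
  proof (cases "v = 0")
    case False
    then obtain l where l: "lead l v" "2 \<le> l" using ex_lead[OF _ v(2)] by blast
    then have "p \<le> l" using min D_I v(1) by blast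
    then show ?thesis using leadD(1)[OF l(1)] F_mono by blast
  qed (use F_closed in simp)
  have perp_x': "br y x' \<in> perp h" if y: "y \<in> perp h" for y
  proof (rule perpI)
    fix z assume z: "z \<in> h"
    obtain \<alpha> where a: "z - \<alpha> *\<^sub>R x' \<in> F 2" using reduce[OF x'l, of z] F_1 by (auto simp: numeral_2_eq_2)
    define f where "f = z - \<alpha> *\<^sub>R x'"
    have "f \<in> F p" using small[of f] a hc(2)[OF z hc(3)[OF x'h]] by (simp add: f_def)
    then have "br y f = 0" using brF[OF y, of p] pn by simp
    moreover have "z = \<alpha> *\<^sub>R x' + f" by (simp add: f_def)
    ultimately have "br y z = \<alpha> *\<^sub>R br y x'" by (simp add: br_simps)
    moreover have "ip (br y x') x' = 0" using skew[OF y x'h x'h] by simp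
    ultimately show "ip (br y x') z = 0" using skew[OF y x'h z] by (simp add: ip_simps)
  qed
  obtain y where y: "y \<in> perp h" "y \<noteq> 0"
  proof -
    obtain v where v: "v \<notin> h" using proper by blast
    obtain r where "r \<in> h" "v - r \<in> perp h" using ex_proj[OF subs] by blast
    moreover have "v - r \<noteq> 0" using v \<open>r \<in> h\<close> by auto
    ultimately show thesis using that by blast
  qed
  have ne: "D (perp h) \<noteq> {}" using y ex_lead[OF _ F_1] D_I by blast
  define m where "m = Max (D (perp h))"
  have "m \<in> D (perp h)" unfolding m_def using Max_in[OF finite_D ne] .
  then obtain w where w: "w \<in> perp h" "lead m w" by (rule D_obtain)
  have mmax: "i \<le> m" if "i \<in> D (perp h)" for i unfolding m_def using Max_ge[OF finite_D that] .
  obtain \<alpha> where a: "w - \<alpha> *\<^sub>R x' \<in> F 2" using reduce[OF x'l, of w] F_1 by (auto simp: numeral_2_eq_2)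
  \<comment> \<open>\<open>w\<close> may have degree 1. Subtracting a multiple of \<open>x'\<close>
    does not change \<open>br w x'\<close> and gives a vector outside \<open>h\<close> whose leading
    degree \<open>l\<close> is at least \<open>m\<close> and below \<open>n\<close>, so that
    \<open>ad x'\<close> raises it to \<open>l + 1 > m\<close>.\<close>
  define u where "u = w - \<alpha> *\<^sub>R x'"
  have "w \<notin> h" using perp_int w lead_nz by blast
  then have uh: "u \<notin> h" using hc(1)[of u "\<alpha> *\<^sub>R x'"] hc(3)[OF x'h] by (auto simp: u_def)
  then have "u \<noteq> 0" using subspace_0[OF subs] by auto
  then obtain l where l: "lead l u" "2 \<le> l" using ex_lead[of u 2] a unfolding u_def by blast
  have "\<not> p \<le> l" using uh Fh[of p] pn leadD(1)[OF l(1)] F_mono by auto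
  then have ln: "l < n" using pn by simp
  have ml: "m \<le> l"
  proof (cases "m \<le> 1")
    case False
    then have "w \<in> F 2" using leadD(1)[OF w(2)] F_mono[of 2 m] by simp
    then have "\<alpha> *\<^sub>R x' \<in> F 2" using a F_closed(4)[of w 2 u] by (simp add: u_def)
    then have "\<alpha> * co 1 x' = 0" by (simp add: F_def co_simps)
    then have "u = w" using leadD(2)[OF x'l] by (simp add: u_def)
    then show ?thesis using lead_unique l w by blast
  qed (use l in simp)
  have "c 1 l = 1" using c1[of l] l ln by simp
  then have "c l 1 \<noteq> 0" using c_skew[of 1 l] l ln by simp
  then have "lead (l + 1) (br u x')" using lead_br[OF l(1) x'l] ln by simp
  moreover have "br u x' = br w x'" by (simp add: u_def br_simps br_self)
  ultimately have "l + 1 \<in> D (perp h)" using perp_x'[OF w(1)] D_I by simp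
  then show False using mmax ml by fastforce
qed

end

context graded_filiform_k_ip
begin

lemma card_tg_k_eq_n: assumes k: "k = n" "7 \<le> k" and tg: "tg n H" shows "card (D H) \<le> n - 4"
proof -
  have tg: "tg k H" using tg k by simp
  show ?thesis
    using level_k_or[OF tg]
  proof
    assume "k \<in> D H"
    then show ?thesis using level_k_tangent[OF tg] k by simp
  next
    assume "k \<in> D (perp H)"
    then show ?thesis using level_k_perp[OF tg] k by linarith
  qed
qed

lemma card_tg_half: assumes k: "\<not> (k = n \<and> 7 \<le> k)" and tg: "tg n H" shows "2 * card (D H) \<le> n"
proof (cases "7 \<le> k")
  case True
  then have "bounded n" using k kn by (intro bounded_k_ge_7) auto
  then show ?thesis using tg by (simp add: bounded_def)
next
  case False
  then have k5': "k = 5" using k5 k_odd by presburger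
  interpret five: graded_filiform_5_ip br n X co c ip
    unfolding graded_filiform_5_ip_def graded_filiform_5_def
    using graded_filiform_k_ip_axioms graded_filiform_k_axioms unfolding k5' by blast
  show ?thesis
  proof (cases "n = 5")
    case True
    then show ?thesis using five.level_5[of H] tg by simp
  next
    case False
    then have "bounded n" using kn k5' by (intro five.bounded_ge_6) auto
    then show ?thesis using tg by (simp add: bounded_def)
  qed
qed

end

section \<open>Coordinates from the presentations (a) and (b)\<close>

lemma lie_presentation_rel: "lie_presentation br n X R \<Longrightarrow> (i, j, v) \<in> R \<Longrightarrow> br (X i) (X j) = v"
  unfolding lie_presentation_def by (drule conjunct2, drule conjunct1, drule (1) bspec) simp

lemma lie_presentation_zero:
  "lie_presentation br n X R \<Longrightarrow> i \<in> {1..n} \<Longrightarrow> j \<in> {1..n} \<Longrightarrow> (\<And>v. (i, j, v) \<notin> R) \<Longrightarrow>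
    (\<And>v. (j, i, v) \<notin> R) \<Longrightarrow> br (X i) (X j) = 0"
  unfolding lie_presentation_def by (drule conjunct2, drule conjunct2, drule (1) bspec, drule (1) bspec) simp

lemma type_a_coordinates:
  fixes br :: "'a::real_vector \<Rightarrow> 'a \<Rightarrow> 'a"
  assumes lie: "fin_dim_lie_algebra br" and n: "dim (UNIV :: 'a set) = n" "3 \<le> n" and a: "type_a br"
  obtains X co c where "graded_filiform br n X co c" "\<And>i j. 2 \<le> i \<Longrightarrow> 2 \<le> j \<Longrightarrow> c i j = (0::real)"
proof -
  interpret fin_dim_lie_algebra br by fact
  obtain n' X where P: "lie_presentation br n' X {(1, i, X (i + 1)) | i. 1 < i \<and> i < n'}"
    using a unfolding type_a_def by blast
  then have B: "is_basis_upto n' X" by (simp add: lie_presentation_def)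
  have n': "n' = n" using dim_basis[OF B] n by simp
  have rel: "br (X 1) (X i) = X (i + 1)" if "1 < i" "i < n" for i
    by (rule lie_presentation_rel[OF P]) (use that n' in simp)
  have zero: "br (X i) (X j) = 0"
    if "i \<in> {1..n}" "j \<in> {1..n}" "\<not> (i = 1 \<and> 1 < j \<and> j < n)" "\<not> (j = 1 \<and> 1 < i \<and> i < n)" for i j
    by (rule lie_presentation_zero[OF P]) (use that n' in auto)
  have skew: "br x y = - br y x" for x y
    by (rule bilinear_alternating_skew[OF bilinear_br br_self])
  define c :: "nat \<Rightarrow> nat \<Rightarrow> real" where
    "c i j = (if i = 1 \<and> 2 \<le> j then 1 else if j = 1 \<and> 2 \<le> i then - 1 else 0)" for i j
  have "graded_filiform br n (\<lambda>i. if i \<in> {1..n} then X i else 0)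
     (\<lambda>i v. if i \<in> {1..n} then coord n X i v else 0) c"
  proof (rule graded_filiformI[OF lie _ n(2)])
    show "is_basis_upto n X" using B n' by simp
    show "c 1 i = 1" if "2 \<le> i" for i using that by (simp add: c_def)
    show "br (X i) (X j) = (if i + j \<le> n then c i j *\<^sub>R X (i + j) else 0)" if ij: "i \<in> {1..n}" "j \<in> {1..n}" for i j
    proof -
      consider "i = 1 \<and> 1 < j \<and> j < n" | "j = 1 \<and> 1 < i \<and> i < n"
        | "\<not> (i = 1 \<and> 1 < j \<and> j < n)" "\<not> (j = 1 \<and> 1 < i \<and> i < n)" by blast
      then show ?thesis
      proof cases
        case 1
        then show ?thesis using rel[of j] by (simp add: c_def)
      next
        case 2
        then show ?thesis using rel[of i] skew[of "X i" "X 1"] by (simp add: c_def)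
      next
        case 3
        have "i + j \<le> n \<Longrightarrow> c i j = 0" using 3 ij n(2) by (auto simp: c_def)
        then show ?thesis using zero[OF ij 3] by simp
      qed
    qed
  qed
  moreover have "c i j = 0" if "2 \<le> i" "2 \<le> j" for i j using that by (simp add: c_def)
  ultimately show thesis by (rule that)
qed

lemma type_b_coordinates:
  fixes br :: "'a::real_vector \<Rightarrow> 'a \<Rightarrow> 'a"
  assumes lie: "fin_dim_lie_algebra br" and n: "dim (UNIV :: 'a set) = n" and b: "type_b br"
  obtains X co c where "graded_filiform_k br n X co c n" "7 \<le> n"
proof -
  interpret fin_dim_lie_algebra br by fact
  define Q where "Q k X = ({(1, i, X (i + 1)) | i. 1 < i \<and> i < 2 * k + 1} \<union>
      {(l, 2 * k + 1 - l, (-1) ^ (l + 1) *\<^sub>R X (2 * k + 1)) | l. 1 < l \<and> l < k + 1})" for k and X :: "nat \<Rightarrow> 'a"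
  obtain k X where k: "3 \<le> k" and P: "lie_presentation br (2 * k + 1) X (Q k X)"
    using b unfolding type_b_def Q_def by blast
  then have B: "is_basis_upto (2 * k + 1) X" by (simp add: lie_presentation_def)
  have n': "n = 2 * k + 1" using dim_basis[OF B] n by simp
  have rel: "br (X 1) (X i) = X (i + 1)" if "1 < i" "i < n" for i
    by (rule lie_presentation_rel[OF P]) (use that n' in \<open>simp add: Q_def\<close>)
  have rel2: "br (X l) (X (n - l)) = (-1) ^ (l + 1) *\<^sub>R X n" if "1 < l" "l < k + 1" for l
    by (rule lie_presentation_rel[OF P]) (use that n' in \<open>simp add: Q_def\<close>)
  have Qcases: "i = 1 \<and> 1 < j \<and> j < n \<or> 1 < i \<and> i < k + 1 \<and> i + j = n" if "(i, j, v) \<in> Q k X" for i j v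
    using that n' by (auto simp: Q_def)
  have zero: "br (X i) (X j) = 0"
    if ij: "i \<in> {1..n}" "j \<in> {1..n}" and no: "\<not> (i = 1 \<and> 1 < j \<and> j < n)" "\<not> (j = 1 \<and> 1 < i \<and> i < n)"
      "\<not> (1 < i \<and> 1 < j \<and> i + j = n)" for i j
  proof -
    have "(i, j, v) \<notin> Q k X" for v
    proof
      assume "(i, j, v) \<in> Q k X"
      from Qcases[OF this] show False using no ij n' by auto
    qed
    moreover have "(j, i, v) \<notin> Q k X" for v
    proof
      assume "(j, i, v) \<in> Q k X"
      from Qcases[OF this] show False using no ij n' by auto
    qed
    ultimately show ?thesis using ij n' by (intro lie_presentation_zero[OF P]) auto
  qed
  have skew: "br x y = - br y x" for x y
    by (rule bilinear_alternating_skew[OF bilinear_br br_self])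
  have rel3: "br (X i) (X j) = (-1) ^ (i + 1) *\<^sub>R X n" if ij: "1 < i" "1 < j" "i + j = n" for i j
  proof (cases "i < k + 1")
    case True
    have "n - i = j" using ij by linarith
    then show ?thesis using rel2[OF ij(1) True] by simp
  next
    case False
    have j: "n - j = i" "j < k + 1" using ij False n' by linarith+
    \<comment> \<open>The listed relations have \<open>l\<close> in the lower half; as
      \<open>i + j\<close> is odd, skew-symmetry extends the sign rule to the upper half.\<close>
    have "even (i + j + 1)" using ij n' by simp
    then have "(-1) ^ (i + 1) = - ((-1) ^ (j + 1) :: real)" by (simp add: minus_one_power_iff)
    then show ?thesis using rel2[OF ij(2) j(2)] skew[of "X i" "X j"] j(1) by simp
  qed
  define c :: "nat \<Rightarrow> nat \<Rightarrow> real" where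
    "c i j = (if i = 1 \<and> 2 \<le> j then 1 else if j = 1 \<and> 2 \<le> i then - 1 else if 2 \<le> i \<and> 2 \<le> j \<and> i + j = n then (-1) ^ (i + 1) else 0)"
    for i j
  interpret Y: graded_filiform br n "\<lambda>i. if i \<in> {1..n} then X i else 0"
     "\<lambda>i v. if i \<in> {1..n} then coord n X i v else 0" c
  proof (rule graded_filiformI[OF lie])
    show "is_basis_upto n X" using B n' by simp
    show "3 \<le> n" using k n' by simp
    show "c 1 i = 1" if "2 \<le> i" for i using that by (simp add: c_def)
    show "br (X i) (X j) = (if i + j \<le> n then c i j *\<^sub>R X (i + j) else 0)" if ij: "i \<in> {1..n}" "j \<in> {1..n}" for i j
    proof -
      consider "i = 1 \<and> 1 < j \<and> j < n" | "j = 1 \<and> 1 < i \<and> i < n" | "1 < i \<and> 1 < j \<and> i + j = n"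
        | "\<not> (i = 1 \<and> 1 < j \<and> j < n)" "\<not> (j = 1 \<and> 1 < i \<and> i < n)" "\<not> (1 < i \<and> 1 < j \<and> i + j = n)" by blast
      then show ?thesis
      proof cases
        case 1
        then show ?thesis using rel[of j] by (simp add: c_def)
      next
        case 2
        then show ?thesis using rel[of i] skew[of "X i" "X 1"] by (simp add: c_def)
      next
        case 3
        then show ?thesis using rel3[of i j] by (simp add: c_def)
      next
        case 4
        have "i + j \<le> n \<Longrightarrow> c i j = 0" using 4 ij by (auto simp: c_def)
        then show ?thesis using zero[OF ij 4] by simp
      qed
    qed
  qed
  \<comment> \<open>The signs of type (b) give -1 in degrees 2, \<open>n - 2\<close>;
    \<open>scale\<close> with -1 turns this into \<open>ck\<close>.\<close>
  have "graded_filiform_k_axioms n (\<lambda>i j. if i = 1 \<or> j = 1 then c i j else - 1 * c i j) n"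
    using k n' by unfold_locales (auto simp: c_def)
  then have "\<exists>X co c. graded_filiform_k br n X co c n"
    unfolding graded_filiform_k_def using Y.scale[of "- 1"] by (intro exI conjI) auto
  moreover have "7 \<le> n" using k n' by simp
  ultimately show thesis using that by blast
qed

section \<open>Sharpness\<close>

text \<open>With \<open>Y\<close> declared orthonormal, \<open>geo\<close> says that each
  \<open>ad (Y a)\<close> with \<open>a\<close> outside \<open>S\<close>, compressed to the span of
  the \<open>Y b\<close> with \<open>b\<close> in \<open>S\<close>, has a skew-symmetric
  matrix.\<close>

lemma ex_geodesic_span:
  fixes Y :: "nat \<Rightarrow> 'a::real_vector"
  assumes bil: "bilinear br" and B: "is_basis_upto n Y" and S: "S \<subseteq> {1..n}"
    and sub: "\<And>b c. b \<in> S \<Longrightarrow> c \<in> S \<Longrightarrow> br (Y b) (Y c) \<in> span (Y ` S)"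
    and geo: "\<And>a b c. a \<in> {1..n} - S \<Longrightarrow> b \<in> S \<Longrightarrow> c \<in> S \<Longrightarrow>
      coord n Y c (br (Y a) (Y b)) + coord n Y b (br (Y a) (Y c)) = 0"
  shows "\<exists>ip h. is_inner_product ip \<and> lie_subalgebra br h \<and> totally_geodesic br ip h \<and> dim h = card S"
proof (intro exI conjI)
  define ip where "ip v w = (\<Sum>i = 1..n. coord n Y i v * coord n Y i w)" for v w
  let ?h = "span (Y ` S)"
  note lin = linear_coord[OF B]
  have ipb: "bilinear ip"
    unfolding bilinear_def ip_def
    by (intro conjI allI linearI)
      (simp_all add: linear_add[OF lin] linear_scale[OF lin] distrib_left distrib_right sum.distrib sum_distrib_left mult_ac)
  note simps = bilinear_ladd[OF bil] bilinear_radd[OF bil] bilinear_lmul[OF bil] bilinear_rmul[OF bil]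
    bilinear_lzero[OF bil] bilinear_rzero[OF bil] bilinear_ladd[OF ipb] bilinear_radd[OF ipb]
    bilinear_lmul[OF ipb] bilinear_rmul[OF ipb] bilinear_lzero[OF ipb] bilinear_rzero[OF ipb]
  show "is_inner_product ip"
    unfolding is_inner_product_def
  proof (intro conjI allI impI ipb)
    show "ip x y = ip y x" for x y by (simp add: ip_def mult.commute)
    fix x :: 'a assume x: "x \<noteq> 0"
    have "\<exists>i\<in>{1..n}. coord n Y i x \<noteq> 0"
    proof (rule ccontr)
      assume "\<not> (\<exists>i\<in>{1..n}. coord n Y i x \<noteq> 0)"
      then have "(\<Sum>i = 1..n. coord n Y i x *\<^sub>R Y i) = 0" by (intro sum.neutral) auto
      then show False using coord_expand[OF B, of x] x by simp
    qed
    then obtain i where i: "i \<in> {1..n}" "coord n Y i x \<noteq> 0" by blast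
    show "0 < ip x x" unfolding ip_def
      by (rule sum_pos2[OF _ i(1)]) (use i(2) in \<open>auto simp: zero_less_mult_iff linorder_neq_iff\<close>)
  qed
  have ip_Y: "ip w (Y b) = coord n Y b w" if "b \<in> {1..n}" for w b
  proof -
    have "ip w (Y b) = (\<Sum>i = 1..n. if i = b then coord n Y i w else 0)"
      unfolding ip_def using that by (intro sum.cong) (auto simp: coord_basis[OF B])
    then show ?thesis using that by simp
  qed
  show "lie_subalgebra br ?h"
    unfolding lie_subalgebra_def
  proof (intro conjI ballI)
    fix x y assume x: "x \<in> ?h" and y: "y \<in> ?h"
    have 1: "br (Y b) y \<in> ?h" if "b \<in> S" for b
      using y
    proof (induction rule: span_induct)
      case base
      show ?case by (auto simp: subspace_def simps span_zero span_add span_scale)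
    next
      case (step z)
      then show ?case using sub that by auto
    qed
    show "br x y \<in> ?h" using x
    proof (induction rule: span_induct)
      case base
      show ?case by (auto simp: subspace_def simps span_zero span_add span_scale)
    next
      case (step z)
      then show ?case using 1 by auto
    qed
  qed simp
  show "totally_geodesic br ip ?h"
    unfolding totally_geodesic_def
  proof (intro ballI)
    fix w x y assume w: "w \<in> ortho_compl ip ?h" and x: "x \<in> ?h" and y: "y \<in> ?h"
    have 1: "ip (br (Y a) (Y b)) y + ip (br (Y a) y) (Y b) = 0" if a: "a \<in> {1..n} - S" and b: "b \<in> S" for a b
      using y
    proof (induction rule: span_induct)
      case base
      show ?case by (auto simp: subspace_def simps algebra_simps simp flip: distrib_left)
    next
      case (step z)
      then obtain c where c: "c \<in> S" "z = Y c" by blast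
      have "c \<in> {1..n}" "b \<in> {1..n}" using S b c(1) by blast+
      then show ?case using geo[OF a b c(1)] unfolding c(2) by (simp only: ip_Y)
    qed
    have 2: "ip (br (Y a) x) y + ip (br (Y a) y) x = 0" if a: "a \<in> {1..n} - S" for a
      using x
    proof (induction rule: span_induct)
      case base
      show ?case by (auto simp: subspace_def simps algebra_simps simp flip: distrib_left)
    next
      case (step z)
      then show ?case using 1[OF a] by auto
    qed
    have "w = (\<Sum>i\<in>{1..n} - S. coord n Y i w *\<^sub>R Y i)"
    proof -
      have "coord n Y i w = 0" if "i \<in> S" for i
        using w ip_Y[of i w] S that span_base[of "Y i" "Y ` S"] by (auto simp: ortho_compl_def)
      then have "(\<Sum>i = 1..n. coord n Y i w *\<^sub>R Y i) = (\<Sum>i\<in>{1..n} - S. coord n Y i w *\<^sub>R Y i)"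
        by (intro sum.mono_neutral_right) auto
      then show ?thesis using coord_expand[OF B, of w] by simp
    qed
    then have "w \<in> span (Y ` ({1..n} - S))"
      by (metis (no_types, lifting) image_eqI span_base span_scale span_sum)
    then show "ip (br w x) y + ip (br w y) x = 0"
    proof (induction rule: span_induct)
      case base
      show ?case by (auto simp: subspace_def simps algebra_simps simp flip: distrib_left)
    next
      case (step z)
      then show ?case using 2 by auto
    qed
  qed
  have "inj_on Y S" "independent (Y ` S)"
    using B S inj_on_subset independent_mono[OF _ image_mono[OF S]] unfolding is_basis_upto_def by blast+
  then show "dim ?h = card S" by (simp add: card_image dim_eq_card_independent)
qed

context graded_filiform
begin

text \<open>The bracket of an odd and an even degree is odd, hence orthogonal to the even
  degrees.\<close>

lemma ex_geodesic_half:
  "\<exists>ip h. is_inner_product ip \<and> lie_subalgebra br h \<and> totally_geodesic br ip h \<and> dim h = n div 2"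
proof -
  let ?S = "{i \<in> {1..n}. even i}"
  have ev: "br (X b) (X c') \<in> span (X ` ?S)" if "b \<in> ?S" "c' \<in> ?S" for b c'
  proof (cases "b + c' \<le> n")
    case True
    then have "X (b + c') \<in> span (X ` ?S)" using that by (intro span_base) auto
    then show ?thesis using br_X[of b c'] that by (simp add: span_scale)
  next
    case False
    then show ?thesis using br_X[of b c'] X_out[of "b + c'"] that by (simp add: span_zero)
  qed
  have odd: "coord n X d (br (X a) (X b)) = 0" if "a \<in> {1..n} - ?S" "b \<in> ?S" "d \<in> ?S" for a b d
  proof -
    note lin = linear_coord[OF basis]
    have ne: "d \<noteq> a + b" using that by auto
    have "coord n X d (X (a + b)) = 0"
    proof (cases "a + b \<le> n")
      case True
      then show ?thesis using coord_basis[OF basis, of d "a + b"] that ne by simp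
    next
      case False
      then show ?thesis using X_out[of "a + b"] linear_0[OF lin] by simp
    qed
    then show ?thesis using br_X[of a b] that linear_scale[OF lin] by simp
  qed
  have "bij_betw (\<lambda>i. 2 * i) {1..n div 2} ?S"
    by (rule bij_betwI[where g = "\<lambda>i. i div 2"]) (auto elim!: evenE)
  then have "card ?S = n div 2" using bij_betw_same_card by fastforce
  moreover have "\<exists>ip h. is_inner_product ip \<and> lie_subalgebra br h \<and> totally_geodesic br ip h \<and> dim h = card ?S"
    by (rule ex_geodesic_span[OF bil basis]) (use ev odd in auto)
  ultimately show ?thesis by simp
qed

definition \<Phi> :: "real fps \<Rightarrow> 'a" where "\<Phi> f = (\<Sum>i\<le>n - 2. fps_nth f i *\<^sub>R X (i + 2))"

lemma \<Phi>_add: "\<Phi> (f + g) = \<Phi> f + \<Phi> g" and \<Phi>_diff: "\<Phi> (f - g) = \<Phi> f - \<Phi> g"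
  by (simp_all add: \<Phi>_def scaleR_left_distrib scaleR_left_diff_distrib sum.distrib sum_subtractf)

lemma br_X1_\<Phi>: "br (X 1) (\<Phi> f) = \<Phi> (fps_X * f)"
proof -
  have lr: "linear (br (X 1))" using bil by (simp add: bilinear_def)
  obtain q where q: "n - 2 = Suc q" using n3 by (metis Suc_diff_Suc less_eq_Suc_le numeral_2_eq_2 numeral_3_eq_3)
  have X: "br (X 1) (X (i + 2)) = X (i + 3)" for i
  proof (cases "i + 2 < n")
    case True
    then show ?thesis using br_X[of 1 "i + 2"] c1[of "i + 2"] by (simp add: eval_nat_numeral)
  next
    case False
    then show ?thesis using br_X[of 1 "i + 2"] X_out[of "i + 3"] by (simp add: eval_nat_numeral)
  qed
  have "br (X 1) (\<Phi> f) = (\<Sum>i\<le>Suc q. fps_nth f i *\<^sub>R X (i + 3))"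
    unfolding \<Phi>_def q linear_sum[OF lr] by (simp only: linear_scale[OF lr] X)
  also have "\<dots> = (\<Sum>i\<le>q. fps_nth f i *\<^sub>R X (i + 3))"
  proof -
    have "X (Suc q + 3) = 0" using q by (intro X_out) simp
    then show ?thesis by simp
  qed
  also have "\<dots> = \<Phi> (fps_X * f)"
    unfolding \<Phi>_def q sum.atMost_Suc_shift by (simp add: eval_nat_numeral)
  finally show ?thesis .
qed

end

text \<open>The Fibonacci polynomials with index shifted by one; \<open>E i\<close> is also the
  characteristic polynomial of the skew-symmetric shift matrix of size \<open>i\<close>.\<close>

fun E :: "nat \<Rightarrow> real fps" where
  "E 0 = 1"
| "E (Suc 0) = fps_X"
| "E (Suc (Suc i)) = fps_X * E (Suc i) + E i"

lemma E_high: "i < j \<Longrightarrow> fps_nth (E i) j = 0"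
  by (induction i arbitrary: j rule: E.induct) auto

lemma E_0: "even i \<Longrightarrow> fps_nth (E i) 0 = 1"
  by (induction i rule: E.induct) auto

text \<open>The substitution of -x for x; it accounts for the alternating signs of row
  \<open>k\<close> in \<open>br_\<Phi>_\<Phi>\<close>.\<close>

definition flip :: "real fps \<Rightarrow> real fps" where "flip f = Abs_fps (\<lambda>i. (-1) ^ i * fps_nth f i)"

lemma flip_nth [simp]: "fps_nth (flip f) i = (-1) ^ i * fps_nth f i"
  by (simp add: flip_def)

lemma flip_mult: "flip (f * g) = flip f * flip g"
proof (rule fps_ext)
  fix m
  have "(-1) ^ m * (fps_nth f i * fps_nth g (m - i)) = ((-1) ^ i * fps_nth f i) * ((-1) ^ (m - i) * fps_nth g (m - i))"
    if "i \<le> m" for i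
  proof -
    have "(-1 :: real) ^ m = (-1) ^ i * (-1) ^ (m - i)" using that by (simp flip: power_add)
    then show ?thesis by simp
  qed
  then show "fps_nth (flip (f * g)) m = fps_nth (flip f * flip g) m"
    unfolding flip_nth fps_mult_nth sum_distrib_left by (intro sum.cong[OF refl]) (simp only: atLeastAtMost_iff)
qed

lemma flip_add: "flip (f + g) = flip f + flip g"
  by (rule fps_ext) (simp add: distrib_left)

lemma flip_X: "flip fps_X = - fps_X"
  by (rule fps_ext) (auto simp: fps_X_def)

lemma flip_1: "flip 1 = 1"
  by (rule fps_ext) auto

lemma flip_E: "flip (E i) = (-1) ^ i * E i"
  by (induction i rule: E.induct) (simp_all add: flip_mult flip_add flip_X flip_1 algebra_simps)

text \<open>With \<open>v\<close> also \<open>flip v\<close> is an inverse square root of the even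
  series \<open>D\<close>, hence equal to \<open>v\<close> or \<open>- v\<close>; the nonzero
  constant term excludes \<open>- v\<close>.\<close>

lemma ex_even_inverse_sqrt:
  assumes "fps_nth D 0 = 1" "flip D = D"
  obtains v where "v * v * D = 1" "flip v = v" "fps_nth v 0 \<noteq> 0"
proof -
  define u where "u = fps_radical (\<lambda>_ _. 1) 2 D"
  have "u ^ Suc 1 = D"
    using power_radical[of D "\<lambda>_ _. 1" 1] assms(1) unfolding u_def numeral_2_eq_2 by simp
  then have u: "u * u = D" by (simp add: power2_eq_square)
  then have u0: "fps_nth u 0 \<noteq> 0" using assms(1) by (metis fps_mult_nth_0 mult_zero_left zero_neq_one)
  define v where "v = inverse u"
  have uv: "v * u = 1" unfolding v_def using u0 by (rule inverse_mult_eq_1)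
  have v0: "fps_nth v 0 \<noteq> 0" using uv by (metis fps_mult_nth_0 fps_one_nth mult_zero_left zero_neq_one)
  have "v * v * D = (v * u) * (v * u)" unfolding u[symmetric] by (simp add: mult_ac)
  then have v: "v * v * D = 1" using uv by simp
  have "D \<noteq> 0" using assms(1) by auto
  have "flip v * flip v * D = 1" using arg_cong[OF v, of flip] by (simp add: flip_mult flip_1 assms(2))
  then have "(flip v - v) * (flip v + v) * D = 0" using v by (simp add: algebra_simps)
  then have "flip v - v = 0 \<or> flip v + v = 0" using \<open>D \<noteq> 0\<close> by simp
  moreover have "flip v + v \<noteq> 0"
  proof
    assume "flip v + v = 0"
    then have "fps_nth (flip v + v) 0 = 0" by simp
    then show False using v0 by simp
  qed
  ultimately show thesis using that v v0 by simp
qed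

context graded_filiform
begin

text \<open>The recursion of \<open>E\<close> turns the series \<open>E i * v\<close> into
  \<open>fps_X ^ l * v\<close>; since \<open>v\<close> has nonzero constant term, these are
  triangular in the \<open>X j\<close> and can be solved from the top degree down.\<close>

lemma X_in_triangular:
  assumes U: "subspace U" and v0: "fps_nth v 0 \<noteq> 0" and q: "q + 2 \<le> n"
    and E: "\<And>i. i \<le> q \<Longrightarrow> \<Phi> (E i * v) \<in> U" and high: "\<And>j. q + 2 < j \<Longrightarrow> j \<le> n \<Longrightarrow> X j \<in> U"
    and j: "2 \<le> j" "j \<le> n"
  shows "X j \<in> U"
proof -
  have step: "\<Phi> (fps_X ^ l * E i * v) \<in> U" if "i + l \<le> q" for i l
    using that
  proof (induction l arbitrary: i)
    case 0
    then show ?case using E by simp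
  next
    case (Suc l)
    show ?case
    proof (cases i)
      case 0
      have "\<Phi> (fps_X ^ l * E (Suc 0) * v) \<in> U" by (rule Suc.IH) (use Suc.prems 0 in simp)
      then show ?thesis using 0 by (simp add: mult.commute[of fps_X])
    next
      case i: (Suc i')
      have "fps_X ^ Suc l * E i * v = fps_X ^ l * E (Suc i) * v - fps_X ^ l * E i' * v"
        by (simp add: i algebra_simps)
      moreover have "\<Phi> (fps_X ^ l * E (Suc i) * v) \<in> U" by (rule Suc.IH) (use Suc.prems in simp)
      moreover have "\<Phi> (fps_X ^ l * E i' * v) \<in> U" by (rule Suc.IH) (use Suc.prems i in simp)
      ultimately show ?thesis by (simp add: \<Phi>_diff subspace_diff[OF U])
    qed
  qed
  have pow: "\<Phi> (fps_X ^ l * v) \<in> U" if "l \<le> q" for l using step[of 0 l] that by simp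
  have low: "X j \<in> U" if "j \<le> q + 2" "2 \<le> j" for j
    using that
  proof (induction "q + 2 - j" arbitrary: j rule: less_induct)
    case less
    have above: "X i \<in> U" if "j < i" "i \<le> n" for i
    proof (cases "q + 2 < i")
      case False
      then show ?thesis using less.prems that by (intro less.hyps) auto
    qed (use high that in simp)
    let ?g = "fps_X ^ (j - 2) * v"
    have g: "fps_nth ?g i = (if i < j - 2 then 0 else fps_nth v (i - (j - 2)))" for i
      by (simp add: fps_X_power_mult_nth)
    let ?s = "\<Sum>i\<in>{..n - 2} - {j - 2}. fps_nth ?g i *\<^sub>R X (i + 2)"
    have eq: "\<Phi> ?g = fps_nth v 0 *\<^sub>R X j + ?s"
    proof -
      have m: "j - 2 \<in> {..n - 2}" "j - 2 + 2 = j" using less.prems q by auto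
      have "fps_nth ?g (j - 2) = fps_nth v 0" by (simp add: g)
      then show ?thesis unfolding \<Phi>_def sum.remove[OF finite_atMost m(1)] using m(2) by simp
    qed
    have "?s \<in> U"
    proof (rule subspace_sum[OF U])
      fix i assume i: "i \<in> {..n - 2} - {j - 2}"
      show "fps_nth ?g i *\<^sub>R X (i + 2) \<in> U"
      proof (cases "i < j - 2")
        case True
        then show ?thesis using subspace_0[OF U] by (simp add: g)
      next
        case False
        then have "X (i + 2) \<in> U" using i n3 less.prems by (intro above) auto
        then show ?thesis by (rule subspace_scale[OF U])
      qed
    qed
    moreover have "\<Phi> ?g \<in> U" using less.prems by (intro pow) auto
    ultimately have "\<Phi> ?g - ?s \<in> U" by (intro subspace_diff[OF U])
    then have "fps_nth v 0 *\<^sub>R X j \<in> U" unfolding eq by simp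
    then have "(1 / fps_nth v 0) *\<^sub>R fps_nth v 0 *\<^sub>R X j \<in> U" by (rule subspace_scale[OF U])
    then show ?case using v0 by simp
  qed
  show ?thesis using low high j by (cases "j \<le> q + 2") auto
qed

lemma basis_if_contains_X:
  assumes "\<And>i. i \<in> {1..n} \<Longrightarrow> X i \<in> span (Y ` {1..n})" shows "is_basis_upto n Y"
proof (rule basis_from_spanning[OF _ dim_UNIV])
  have "X ` {1..n} \<subseteq> span (Y ` {1..n})" using assms by blast
  then have "span (X ` {1..n}) \<subseteq> span (Y ` {1..n})" by (intro span_minimal) auto
  then show "span (Y ` {1..n}) = UNIV" using basis by (auto simp: is_basis_upto_def)
qed

text \<open>In the coordinates given by the polynomials \<open>E i\<close>, multiplication by the variable is the
  skew-symmetric shift \<open>e\<^sub>i \<mapsto> e\<^bsub>i+1\<^esub> - e\<^bsub>i-1\<^esub>\<close>.\<close>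

lemma br_X1_E: "br (X 1) (\<Phi> (E i * v)) = \<Phi> (E (Suc i) * v) - (if i = 0 then 0 else \<Phi> (E (i - 1) * v))"
proof (cases i)
  case 0
  then show ?thesis by (simp only: br_X1_\<Phi>) simp
next
  case (Suc i')
  have "fps_X * (E i * v) = E (Suc i) * v - E i' * v" by (simp add: Suc algebra_simps)
  then show ?thesis by (simp only: br_X1_\<Phi>) (simp add: \<Phi>_diff Suc)
qed

text \<open>In the basis of the \<open>E i\<close> the only normal vector that acts nontrivially on
  \<open>F 2\<close> is \<open>Y 1\<close>, by the skew shift; stopping before the last basis vector
  \<open>Y n\<close> keeps its compression skew.\<close>

lemma ex_geodesic_abelian:
  assumes z: "\<And>i j. 2 \<le> i \<Longrightarrow> 2 \<le> j \<Longrightarrow> c i j = 0"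
  shows "\<exists>ip h. is_inner_product ip \<and> lie_subalgebra br h \<and> totally_geodesic br ip h \<and> dim h = n - 2"
proof -
  define Y where "Y i = (if i = 1 then X 1 else \<Phi> (E (i - 2) * 1))" for i
  let ?S = "{2..n - 1}"
  have br\<Phi>: "br (\<Phi> f) (\<Phi> g) = 0" for f g
    unfolding \<Phi>_def bilinear_sum[OF bil]
    by (rule sum.neutral) (auto simp: br_simps br_X z)
  have B: "is_basis_upto n Y"
  proof (rule basis_if_contains_X)
    fix i assume i: "i \<in> {1..n}"
    have Y: "Y j \<in> span (Y ` {1..n})" if "1 \<le> j" "j \<le> n" for j using that by (intro span_base) auto
    show "X i \<in> span (Y ` {1..n})"
    proof (cases "i = 1")
      case True
      then show ?thesis using Y[of 1] n3 by (simp add: Y_def)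
    next
      case False
      show ?thesis
      proof (rule X_in_triangular[where v = 1 and q = "n - 2"])
        show "\<Phi> (E l * 1) \<in> span (Y ` {1..n})" if "l \<le> n - 2" for l
          using Y[of "l + 2"] that n3 by (simp add: Y_def)
      qed (use i False n3 in auto)
    qed
  qed
  note lin = linear_coord[OF B]
  have br1: "br (Y 1) (Y b) = Y (b + 1) - (if b = 2 then 0 else Y (b - 1))" if "b \<in> ?S" for b
    using br_X1_E[of "b - 2" 1] that by (auto simp: Y_def Suc_diff_le numeral_2_eq_2 diff_Suc split: nat.splits)
  have br2: "br (Y a) (Y b) = 0" if "2 \<le> a" "2 \<le> b" for a b using that br\<Phi> by (simp add: Y_def)
  have coord_br: "coord n Y d (br (Y 1) (Y b)) = (if d = b + 1 then 1 else 0) - (if d + 1 = b then 1 else 0)"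
    if "b \<in> ?S" "d \<in> ?S" for b d
  proof -
    have b2: "2 \<le> b" "b + 1 \<le> n" and d2: "d \<in> {1..n}" "2 \<le> d" using that by auto
    have "coord n Y d (Y (b + 1)) = (if d = b + 1 then 1 else 0)"
      using b2 by (intro coord_basis[OF B d2(1)]) auto
    moreover have "coord n Y d (Y (b - 1)) = (if d + 1 = b then 1 else 0)" if "b \<noteq> 2"
    proof -
      have "coord n Y d (Y (b - 1)) = (if d = b - 1 then 1 else 0)"
        using b2 that by (intro coord_basis[OF B d2(1)]) auto
      moreover have "d = b - 1 \<longleftrightarrow> d + 1 = b" using b2 by linarith
      ultimately show ?thesis by simp
    qed
    ultimately show ?thesis unfolding br1[OF that(1)] using d2
      by (cases "b = 2") (simp_all add: linear_diff[OF lin] linear_0[OF lin])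
  qed
  have "coord n Y d (br (Y a) (Y b)) + coord n Y b (br (Y a) (Y d)) = 0" if "a \<in> {1..n} - ?S" "b \<in> ?S" "d \<in> ?S" for a b d
  proof (cases "a = 1")
    case True
    then show ?thesis using coord_br that by auto
  next
    case False
    then show ?thesis using br2[of a] that by (simp add: linear_0[OF lin])
  qed
  moreover have "br (Y b) (Y d) \<in> span (Y ` ?S)" if "b \<in> ?S" "d \<in> ?S" for b d
    using br2[of b d] that by (simp add: span_zero)
  moreover have "card ?S = n - 2" "?S \<subseteq> {1..n}" by auto
  ultimately show ?thesis using ex_geodesic_span[OF bil B, of ?S] by metis
qed

end

context graded_filiform_k
begin

text \<open>Only row \<open>n\<close> contributes, with the alternating signs of
  \<open>row_k\<close>; series degrees \<open>i\<close> and \<open>j\<close> meet in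
  \<open>X n\<close> when \<open>i + j = n - 4\<close>, because \<open>\<Phi>\<close> shifts degrees
  by 2.\<close>

lemma br_\<Phi>_\<Phi>: assumes k: "k = n" shows "br (\<Phi> f) (\<Phi> g) = fps_nth (flip f * g) (n - 4) *\<^sub>R X n"
proof -
  have t: "br (X (i + 2)) (X (j + 2)) = (if i \<le> n - 4 \<and> j = n - 4 - i then (-1) ^ i *\<^sub>R X n else 0)" for i j
  proof -
    consider "i + j + 4 < n" | "i + j + 4 = n" | "n < i + j + 4" by linarith
    then show ?thesis
    proof cases
      case 1
      then show ?thesis using br_X[of "i + 2" "j + 2"] low[of "i + 2" "j + 2"] k by auto
    next
      case 2
      have "c (i + 2) (k - (i + 2)) = (-1) ^ (i + 2)" using 2 k by (intro row_k) auto
      moreover have "k - (i + 2) = j + 2" "i + 2 + (j + 2) = n" using 2 k by linarith+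
      ultimately have "br (X (i + 2)) (X (j + 2)) = (-1) ^ i *\<^sub>R X n"
        using br_X[of "i + 2" "j + 2"] by simp
      moreover have "i \<le> n - 4 \<and> j = n - 4 - i" using 2 by linarith
      ultimately show ?thesis by simp
    next
      case 3
      then show ?thesis using br_X[of "i + 2" "j + 2"] X_out[of "i + 2 + (j + 2)"] k5 k by auto
    qed
  qed
  have "br (\<Phi> f) (\<Phi> g) = (\<Sum>i\<le>n - 2. \<Sum>j\<le>n - 2. br (fps_nth f i *\<^sub>R X (i + 2)) (fps_nth g j *\<^sub>R X (j + 2)))"
    unfolding \<Phi>_def bilinear_sum[OF bil] by (simp only: sum.cartesian_product)
  also have "\<dots> = (\<Sum>i\<le>n - 2. if i \<le> n - 4 then (((-1) ^ i * fps_nth f i) * fps_nth g (n - 4 - i)) *\<^sub>R X n else 0)"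
  proof (rule sum.cong[OF refl])
    fix i assume "i \<in> {..n - 2}"
    have "(\<Sum>j\<le>n - 2. br (fps_nth f i *\<^sub>R X (i + 2)) (fps_nth g j *\<^sub>R X (j + 2)))
        = (\<Sum>j\<le>n - 2. if j = n - 4 - i then (if i \<le> n - 4 then (((-1) ^ i * fps_nth f i) * fps_nth g j) *\<^sub>R X n else 0) else 0)"
      by (rule sum.cong[OF refl]) (simp only: bilinear_lmul[OF bil] bilinear_rmul[OF bil] t, simp)
    also have "\<dots> = (if i \<le> n - 4 then (((-1) ^ i * fps_nth f i) * fps_nth g (n - 4 - i)) *\<^sub>R X n else 0)"
      by (subst sum.delta) auto
    finally show "(\<Sum>j\<le>n - 2. br (fps_nth f i *\<^sub>R X (i + 2)) (fps_nth g j *\<^sub>R X (j + 2)))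
        = (if i \<le> n - 4 then (((-1) ^ i * fps_nth f i) * fps_nth g (n - 4 - i)) *\<^sub>R X n else 0)" .
  qed
  also have "\<dots> = (\<Sum>i\<le>n - 4. (((-1) ^ i * fps_nth f i) * fps_nth g (n - 4 - i)) *\<^sub>R X n)"
    by (rule sum.mono_neutral_cong_right) auto
  also have "\<dots> = fps_nth (flip f * g) (n - 4) *\<^sub>R X n"
    by (simp add: fps_mult_nth scaleR_sum_left atMost_atLeast0)
  finally show ?thesis .
qed

lemma br_\<Phi>_top: assumes k: "k = n" shows "br (\<Phi> f) (X (n - 1)) = 0" "br (X (n - 1)) (\<Phi> f) = 0"
    "br (\<Phi> f) (X n) = 0" "br (X n) (\<Phi> f) = 0" "br (X n) (X n) = 0" "br (X (n - 1)) (X n) = 0" "br (X 1) (X n) = 0"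
proof -
  have X: "br (X (i + 2)) (X j) = 0" "br (X j) (X (i + 2)) = 0" if "n - 1 \<le> j" for i j
    using that br_X[of "i + 2" j] br_X[of j "i + 2"] X_out[of "i + 2 + j"] k5 k by (auto simp: add.commute)
  have l1: "linear (br x)" and l2: "linear (\<lambda>x. br x y)" for x y using bil by (auto simp: bilinear_def)
  show "br (\<Phi> f) (X (n - 1)) = 0" "br (X (n - 1)) (\<Phi> f) = 0" "br (\<Phi> f) (X n) = 0" "br (X n) (\<Phi> f) = 0"
    by (simp_all only: \<Phi>_def linear_sum[OF l1] linear_sum[OF l2] linear_scale[OF l1] linear_scale[OF l2]
        X[OF order_refl] X[of n, OF diff_le_self] scaleR_zero_right sum.neutral_const)
  show "br (X n) (X n) = 0" by (rule br_self)
  have "X (n - 1 + n) = 0" "X (1 + n) = 0" using n3 by (auto intro!: X_out)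
  then show "br (X (n - 1)) (X n) = 0" "br (X 1) (X n) = 0"
    using br_X[of "n - 1" n] br_X[of 1 n] n3 by (simp_all only:) auto
qed

text \<open>Tangential are the \<open>E i * v\<close> with \<open>i < n - 5\<close>, and
  \<open>X n\<close>, which receives their brackets. The neighbour \<open>D * v\<close> of the last
  of them must commute with them: its bracket with \<open>E i * v\<close> is the coefficient of
  degree \<open>n - 4\<close> in \<open>v * v * D * E i\<close>, so \<open>v * v * D = 1\<close>
  leaves a coefficient of \<open>E i\<close> beyond its degree.\<close>

lemma ex_geodesic_top:
  assumes k: "k = n" "7 \<le> n"
  shows "\<exists>ip h. is_inner_product ip \<and> lie_subalgebra br h \<and> totally_geodesic br ip h \<and> dim h = n - 4"
proof -
  define D where "D = E (n - 5)"
  have ev: "even (n - 5)" using k_odd k by simp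
  obtain v where v: "v * v * D = 1" "flip v = v" "fps_nth v 0 \<noteq> 0"
    by (rule ex_even_inverse_sqrt[of D]) (use ev in \<open>auto simp: D_def E_0 flip_E\<close>)
  \<comment> \<open>Position \<open>n - 2\<close> carries \<open>fps_X * D * v\<close> rather than
    \<open>E (n - 4) * v\<close>: its bracket with \<open>E i * v\<close> is, up to sign, a
    coefficient of \<open>fps_X * E i\<close>, again beyond the degree.\<close>
  define Y where "Y i = (if i = 1 \<or> i = n - 1 \<or> i = n then X i else if i = n - 2 then \<Phi> (fps_X * D * v)
      else \<Phi> (E (i - 2) * v))" for i
  let ?S = "insert n {2..n - 4}"
  have YX: "Y 1 = X 1" "Y (n - 1) = X (n - 1)" "Y n = X n" by (simp_all add: Y_def)
  have YE: "Y i = \<Phi> (E (i - 2) * v)" if "2 \<le> i" "i \<le> n - 3" for i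
  proof -
    have "i \<noteq> 1" "i \<noteq> n" "i \<noteq> n - 1" "i \<noteq> n - 2" using that k by linarith+
    then show ?thesis by (simp add: Y_def)
  qed
  have Y2: "Y (n - 2) = \<Phi> (fps_X * D * v)"
  proof -
    have "n - 2 \<noteq> 1" "n - 2 \<noteq> n" "n - 2 \<noteq> n - 1" using k by linarith+
    then show ?thesis by (simp add: Y_def)
  qed
  have B: "is_basis_upto n Y"
  proof (rule basis_if_contains_X)
    let ?U = "span (Y ` {1..n})"
    have Y: "Y j \<in> ?U" if "1 \<le> j" "j \<le> n" for j using that by (intro span_base) auto
    have low: "\<Phi> (E l * v) \<in> ?U" if "l \<le> n - 5" for l using Y[of "l + 2"] YE[of "l + 2"] that k by simp
    fix i assume i: "i \<in> {1..n}"
    show "X i \<in> ?U"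
    proof (cases "i = 1")
      case True
      then show ?thesis using Y[of 1] n3 YX by simp
    next
      case False
      show ?thesis
      proof (rule X_in_triangular[where v = v and q = "n - 4"])
        show "\<Phi> (E l * v) \<in> ?U" if l: "l \<le> n - 4" for l
        proof (cases "l = n - 4")
          case True
          define r where "r = n - 6"
          have r: "n - 5 = Suc r" "n - 4 = Suc (Suc r)" unfolding r_def using k by linarith+
          have "E l * v = fps_X * D * v + E r * v" using True r by (simp add: D_def algebra_simps)
          then have "\<Phi> (E l * v) = Y (n - 2) + \<Phi> (E r * v)" by (simp add: \<Phi>_add Y2)
          moreover have "Y (n - 2) \<in> ?U" using Y[of "n - 2"] k by simp
          moreover have "\<Phi> (E r * v) \<in> ?U" using low[of r] r by simp
          ultimately show ?thesis by (simp add: span_add)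
        qed (use l low in simp)
        show "X j \<in> ?U" if "n - 4 + 2 < j" "j \<le> n" for j
        proof -
          have "j = n - 1 \<or> j = n" using that k by linarith
          then show ?thesis using Y[of "n - 1"] Y[of n] YX k by auto
        qed
      qed (use i False k v in auto)
    qed
  qed
  note lin = linear_coord[OF B]
  have D: "fps_nth (flip (D * v) * (E i * v)) (n - 4) = 0" "fps_nth (flip (fps_X * D * v) * (E i * v)) (n - 4) = 0"
    if i: "i < n - 5" for i
  proof -
    have "flip (D * v) = D * v" using ev by (simp add: flip_mult D_def flip_E v(2))
    moreover from this have "flip (fps_X * D * v) = - (fps_X * (D * v))" by (simp only: mult.assoc flip_mult flip_X) simp
    moreover have "D * v * (E i * v) = E i"
    proof -
      have "D * v * (E i * v) = E i * (v * v * D)" by (simp add: mult_ac)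
      then show ?thesis using v(1) by simp
    qed
    ultimately have e: "flip (D * v) * (E i * v) = E i" "flip (fps_X * D * v) * (E i * v) = - (fps_X * E i)"
      by (simp_all only: mult.assoc mult_minus_left)
    show "fps_nth (flip (D * v) * (E i * v)) (n - 4) = 0" "fps_nth (flip (fps_X * D * v) * (E i * v)) (n - 4) = 0"
      unfolding e using i by (simp_all add: E_high)
  qed
  have S: "b = n \<or> 2 \<le> b \<and> b \<le> n - 4" if "b \<in> ?S" for b using that by auto
  have br1: "br (Y 1) (Y b) = Y (b + 1) - (if b = 2 then 0 else Y (b - 1))" if b: "2 \<le> b" "b \<le> n - 4" for b
  proof -
    have i: "b + 1 - 2 = Suc (b - 2)" "b - 1 - 2 = b - 2 - 1" using b by linarith+
    have "Y b = \<Phi> (E (b - 2) * v)" using b by (intro YE) auto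
    moreover have "Y (b + 1) = \<Phi> (E (Suc (b - 2)) * v)" unfolding i(1)[symmetric] using b k by (intro YE) auto
    moreover have "b \<noteq> 2 \<Longrightarrow> Y (b - 1) = \<Phi> (E (b - 2 - 1) * v)"
      unfolding i(2)[symmetric] using b by (intro YE) auto
    ultimately show ?thesis using br_X1_E[of "b - 2" v] YX(1) b by auto
  qed
  have zero: "br (Y a) (Y b) = 0" if a: "a \<in> {1..n} - ?S" "a \<noteq> 1" and b: "b \<in> ?S" for a b
  proof -
    have "a = n - 3 \<or> a = n - 2 \<or> a = n - 1" using a by auto
    moreover have "Y (n - 3) = \<Phi> (D * v)" using YE[of "n - 3"] k by (simp add: D_def)
    ultimately have Ya: "Y a = \<Phi> (D * v) \<or> Y a = \<Phi> (fps_X * D * v) \<or> Y a = X (n - 1)" using Y2 YX by auto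
    show ?thesis
    proof (cases "b = n")
      case True
      then show ?thesis using Ya br_\<Phi>_top[OF k(1)] YX by auto
    next
      case False
      then have b2: "2 \<le> b" "b \<le> n - 4" using S[OF b] by auto
      then have "Y b = \<Phi> (E (b - 2) * v)" "b - 2 < n - 5" using YE k by auto
      then show ?thesis using Ya D[of "b - 2"] br_\<Phi>_top[OF k(1)] br_\<Phi>_\<Phi>[OF k(1)] by auto
    qed
  qed
  have sub: "br (Y b) (Y d) \<in> span (Y ` ?S)" if "b \<in> ?S" "d \<in> ?S" for b d
  proof -
    have Yn: "r *\<^sub>R X n \<in> span (Y ` ?S)" for r using YX(3) by (intro span_scale span_base) force
    have "Y b = X n \<or> Y b = \<Phi> (E (b - 2) * v)" if "b \<in> ?S" for b
    proof (cases "b = n")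
      case False
      then have "2 \<le> b" "b \<le> n - 3" using S[OF that] by linarith+
      then show ?thesis using YE by blast
    qed (use YX in simp)
    from this[OF that(1)] this[OF that(2)] show ?thesis using br_\<Phi>_top[OF k(1)] br_\<Phi>_\<Phi>[OF k(1)] Yn span_zero by auto
  qed
  have coord_br: "coord n Y d (br (Y 1) (Y b)) = (if d = b + 1 then 1 else 0) - (if d + 1 = b then 1 else 0)"
    if b: "b \<in> ?S" and d: "d \<in> ?S" for b d
  proof (cases "b = n")
    case True
    then have "br (Y 1) (Y b) = 0" using br_\<Phi>_top[OF k(1)] YX by simp
    moreover have "d \<noteq> b + 1" "d + 1 \<noteq> b" using S[OF d] True k by auto
    ultimately show ?thesis by (simp add: linear_0[OF lin])
  next
    case False
    then have b2: "2 \<le> b" "b \<le> n - 4" using S[OF b] by auto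
    have d2: "d \<in> {1..n}" "2 \<le> d" using S[OF d] k by auto
    have "coord n Y d (Y (b + 1)) = (if d = b + 1 then 1 else 0)"
      using b2 d2 k by (intro coord_basis[OF B]) auto
    moreover have "coord n Y d (Y (b - 1)) = (if d + 1 = b then 1 else 0)" if "b \<noteq> 2"
    proof -
      have "coord n Y d (Y (b - 1)) = (if d = b - 1 then 1 else 0)"
        using b2 k that by (intro coord_basis[OF B d2(1)]) auto
      moreover have "d = b - 1 \<longleftrightarrow> d + 1 = b" using b2 by linarith
      ultimately show ?thesis by simp
    qed
    ultimately show ?thesis unfolding br1[OF b2] using d2
      by (cases "b = 2") (simp_all add: linear_diff[OF lin] linear_0[OF lin])
  qed
  have geo: "coord n Y d (br (Y a) (Y b)) + coord n Y b (br (Y a) (Y d)) = 0"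
    if "a \<in> {1..n} - ?S" "b \<in> ?S" "d \<in> ?S" for a b d
  proof (cases "a = 1")
    case True
    show ?thesis unfolding True coord_br[OF that(2,3)] coord_br[OF that(3,2)] by auto
  next
    case False
    then show ?thesis using zero that by (simp add: linear_0[OF lin])
  qed
  have "?S \<subseteq> {1..n}" using k by auto
  then have "\<exists>ip h. is_inner_product ip \<and> lie_subalgebra br h \<and> totally_geodesic br ip h \<and> dim h = card ?S"
    by (rule ex_geodesic_span[OF bil B]) (blast intro: sub geo)+
  moreover have "card ?S = n - 4" using k by auto
  ultimately show ?thesis by simp
qed

end

theorem theorem1p2:
  fixes br :: "'a::real_vector \<Rightarrow> 'a \<Rightarrow> 'a"
  assumes "fin_dim_lie_algebra br"
    and "N_graded_filiform br"
    and "dim (UNIV :: 'a set) \<ge> 3"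
  shows
    "(\<forall>h. lie_subalgebra br h \<and> h \<noteq> UNIV \<and>
          (\<exists>ip. is_inner_product ip \<and> totally_geodesic br ip h) \<longrightarrow>
        (type_a br \<or> type_b br \<or> type_c br) \<and>
        (type_a br \<longrightarrow> dim h \<le> dim (UNIV :: 'a set) - 2) \<and>
        (type_b br \<longrightarrow> dim h \<le> dim (UNIV :: 'a set) - 4) \<and>
        (type_c br \<longrightarrow> dim h \<le> dim (UNIV :: 'a set) div 2)) \<and>
     (\<exists>ip h. is_inner_product ip \<and> lie_subalgebra br h \<and> h \<noteq> UNIV \<and> totally_geodesic br ip h \<and>
        (type_a br \<longrightarrow> dim h = dim (UNIV :: 'a set) - 2) \<and>
        (type_b br \<longrightarrow> dim h = dim (UNIV :: 'a set) - 4) \<and>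
        (type_c br \<longrightarrow> dim h = dim (UNIV :: 'a set) div 2))"
proof -
  define n where "n = dim (UNIV :: 'a set)"
  have n3: "3 \<le> n" using assms(3) by (simp add: n_def)
  obtain X c where B: "is_basis_upto n X"
    and tab: "\<And>i j. i \<in> {1..n} \<Longrightarrow> j \<in> {1..n} \<Longrightarrow> br (X i) (X j) = (if i + j \<le> n then c i j *\<^sub>R X (i + j) else 0)"
    and c1: "\<And>i. 2 \<le> i \<Longrightarrow> i < n \<Longrightarrow> c 1 i = (1::real)"
    by (rule N_graded_basis[OF assms(1,2) n_def n3]) (rule that)
  interpret graded_filiform br n "\<lambda>i. if i \<in> {1..n} then X i else 0"
     "\<lambda>i v. if i \<in> {1..n} then coord n X i v else 0" c
    by (rule graded_filiformI[OF assms(1) B n3 tab c1])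
  have bound: "dim h \<le> (if type_b br then n - 4 else if type_a br then n - 2 else n div 2)"
    if sub: "lie_subalgebra br h" and proper: "h \<noteq> UNIV" and ip: "is_inner_product ip"
      and geo: "totally_geodesic br ip h" for ip h
  proof -
    consider "type_b br" | "type_a br" "\<not> type_b br" | "\<not> type_a br" "\<not> type_b br" by blast
    then show ?thesis
    proof cases
      case 1
      obtain X co c where k: "graded_filiform_k br n X co c n" "7 \<le> n"
        by (rule type_b_coordinates[OF assms(1) n_def[symmetric] 1])
      interpret K: graded_filiform_k br n X co c n by (rule k)
      interpret K: graded_filiform_k_ip br n X co c n ip
        by (intro graded_filiform_k_ip.intro graded_filiform_ip.intro graded_filiform_ip_axioms.intro ip
            K.graded_filiform_axioms K.graded_filiform_k_axioms)
      have "dim h = card (K.D h)" using sub by (intro K.dim_eq_card_D) (simp add: lie_subalgebra_def)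
      moreover have "card (K.D h) \<le> n - 4"
      proof (cases "h \<subseteq> K.F 2")
        case True
        then show ?thesis using K.card_tg_k_eq_n[OF refl k(2)] K.tg_if_geodesic[OF sub geo] by blast
      next
        case False
        then show ?thesis using K.card_not_F2[OF sub geo proper] k(2) by simp
      qed
      ultimately show ?thesis using 1 by simp
    next
      case 2
      interpret G: graded_filiform_ip br n "\<lambda>i. if i \<in> {1..n} then X i else 0"
        "\<lambda>i v. if i \<in> {1..n} then coord n X i v else 0" c ip
        by (intro graded_filiform_ip.intro graded_filiform_ip_axioms.intro ip graded_filiform_axioms)
      have "dim h = card (D h)" using sub by (intro dim_eq_card_D) (simp add: lie_subalgebra_def)
      moreover have "card (D h) \<le> n - 2"
      proof (cases "h \<subseteq> F 2")
        case True
        then show ?thesis using G.card_tg_top G.tg_if_geodesic[OF sub geo] by blast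
      next
        case False
        then show ?thesis using G.card_not_F2[OF sub geo proper] n3 by simp
      qed
      ultimately show ?thesis using 2 by simp
    next
      case 3
      obtain i j where ij: "2 \<le> i" "2 \<le> j" "i + j \<le> n" "c i j \<noteq> 0" using type_a_if_abelian 3(1) by blast
      obtain k X co c where k: "graded_filiform_k br n X co c k" by (rule ex_first_row[OF ij])
      interpret K: graded_filiform_k br n X co c k by (rule k)
      interpret K: graded_filiform_k_ip br n X co c k ip
        by (intro graded_filiform_k_ip.intro graded_filiform_ip.intro graded_filiform_ip_axioms.intro ip
            K.graded_filiform_axioms K.graded_filiform_k_axioms)
      have top: "\<not> (k = n \<and> 7 \<le> k)" using K.type_b_if_top 3(2) by blast
      have "dim h = card (K.D h)" using sub by (intro K.dim_eq_card_D) (simp add: lie_subalgebra_def)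
      moreover have "card (K.D h) \<le> n div 2"
      proof (cases "h \<subseteq> K.F 2")
        case True
        then show ?thesis using K.card_tg_half[OF top K.tg_if_geodesic[OF sub geo True]] by simp
      next
        case False
        then show ?thesis using K.card_not_F2[OF sub geo proper] n3 by simp
      qed
      ultimately show ?thesis using 3 by simp
    qed
  qed
  have small: "h \<noteq> UNIV" if "dim h < n" for h :: "'a set" using that n_def by auto
  have ex_a: "\<exists>ip h. is_inner_product ip \<and> lie_subalgebra br h \<and> totally_geodesic br ip h \<and> dim h = n - 2" if "type_a br"
  proof -
    obtain X co c where g: "graded_filiform br n X co c" "\<And>i j. 2 \<le> i \<Longrightarrow> 2 \<le> j \<Longrightarrow> c i j = (0::real)"
      using type_a_coordinates[OF assms(1) n_def[symmetric] n3 \<open>type_a br\<close>] by metis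
    then show ?thesis using graded_filiform.ex_geodesic_abelian by blast
  qed
  have ex_b: "\<exists>ip h. is_inner_product ip \<and> lie_subalgebra br h \<and> totally_geodesic br ip h \<and> dim h = n - 4 \<and> 7 \<le> n" if "type_b br"
  proof -
    obtain X co c where k: "graded_filiform_k br n X co c n" "7 \<le> n"
      by (rule type_b_coordinates[OF assms(1) n_def[symmetric] \<open>type_b br\<close>])
    then show ?thesis using graded_filiform_k.ex_geodesic_top[OF k(1) refl k(2)] by blast
  qed
  \<comment> \<open>A subalgebra of dimension \<open>n - 2\<close>, supplied by the presentation
    (a), violates the bound \<open>n - 4\<close> of (b).\<close>
  have not_both: "\<not> (type_a br \<and> type_b br)"
  proof
    assume ab: "type_a br \<and> type_b br"
    then obtain ip h where w: "is_inner_product ip" "lie_subalgebra br h" "totally_geodesic br ip h" "dim h = n - 2"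
      using ex_a by blast
    have n7: "7 \<le> n" using ex_b ab by blast
    then have "dim h \<le> n - 4" using bound[OF w(2) small w(1,3)] w(4) ab by simp
    then show False using w(4) n7 by simp
  qed
  have "\<exists>ip h. is_inner_product ip \<and> lie_subalgebra br h \<and> totally_geodesic br ip h \<and> dim h < n \<and>
      (type_a br \<longrightarrow> dim h = n - 2) \<and> (type_b br \<longrightarrow> dim h = n - 4) \<and> (type_c br \<longrightarrow> dim h = n div 2)"
  proof -
    consider "type_a br" | "type_b br" | "type_c br" by (auto simp: type_c_def)
    then show ?thesis
    proof cases
      case 1
      then obtain ip h where "is_inner_product ip" "lie_subalgebra br h" "totally_geodesic br ip h" "dim h = n - 2"
        using ex_a by blast
      then show ?thesis using 1 not_both n3 by (intro exI[of _ ip] exI[of _ h]) (auto simp: type_c_def)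
    next
      case 2
      then obtain ip h where "is_inner_product ip" "lie_subalgebra br h" "totally_geodesic br ip h" "dim h = n - 4" "7 \<le> n"
        using ex_b by blast
      then show ?thesis using 2 not_both by (intro exI[of _ ip] exI[of _ h]) (auto simp: type_c_def)
    next
      case 3
      obtain ip h where "is_inner_product ip" "lie_subalgebra br h" "totally_geodesic br ip h" "dim h = n div 2"
        using ex_geodesic_half by blast
      then show ?thesis using 3 n3 by (intro exI[of _ ip] exI[of _ h]) (auto simp: type_c_def)
    qed
  qed
  then obtain ip h where w: "is_inner_product ip" "lie_subalgebra br h" "totally_geodesic br ip h" "dim h < n"
    "type_a br \<longrightarrow> dim h = n - 2" "type_b br \<longrightarrow> dim h = n - 4" "type_c br \<longrightarrow> dim h = n div 2" by blast
  show ?thesis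
    unfolding n_def[symmetric]
  proof (intro conjI allI impI)
    show "\<exists>ip h. is_inner_product ip \<and> lie_subalgebra br h \<and> h \<noteq> UNIV \<and> totally_geodesic br ip h \<and>
        (type_a br \<longrightarrow> dim h = n - 2) \<and> (type_b br \<longrightarrow> dim h = n - 4) \<and> (type_c br \<longrightarrow> dim h = n div 2)"
      using w small[OF w(4)] by blast
    fix h assume h: "lie_subalgebra br h \<and> h \<noteq> UNIV \<and> (\<exists>ip. is_inner_product ip \<and> totally_geodesic br ip h)"
    show "type_a br \<or> type_b br \<or> type_c br" by (auto simp: type_c_def)
    have b: "dim h \<le> (if type_b br then n - 4 else if type_a br then n - 2 else n div 2)" using h bound by blast
    show "dim h \<le> n - 2" if "type_a br" using b that not_both by simp
    show "dim h \<le> n - 4" if "type_b br" using b that by simp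
    show "dim h \<le> n div 2" if "type_c br" using b that by (simp add: type_c_def)
  qed
qed

end
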